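(* Let $d\ge 1$ and let $\mathbf{f}=(f_1,\ldots,f_d)\in L^2(\mathbb{R};\mathbb{C}^d)$ with $f_i\in\mathcal{S}(\mathbb{R})$ (Schwartz space) for all $i$ and $\langle f_i,f_j\rangle=\delta_{i,j}$ for all $1\le i,j\le d$. Then there exists a constant $0<C_{\mathbf{f}}\le 1$ such that for every invertible real $2\times 2$ matrix $\mathcal{M}$ with $\|\mathcal{M}\|<C_{\mathbf{f}}$, the Gabor system $\mathcal{G}(\mathbf{f},\mathcal{M}(\mathbb{Z}^2))$ is a frame of $L^2(\mathbb{R};\mathbb{C}^d)$ with lower frame bound $\frac{1}{|\det(\mathcal{M})|}\left(1-\frac{\|\mathcal{M}\|}{C_{\mathbf{f}}}\right)^2$ and upper frame bound $\frac{1}{|\det(\mathcal{M})|}\left(1+\frac{\|\mathcal{M}\|}{C_{\mathbf{f}}}\right)^2$.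
   Context: $L^2(\mathbb{R};\mathbb{C}^d)$ is identified with the $d$-fold direct sum of $L^2(\mathbb{R})$, with scalar product $\langle \mathbf{g},\mathbf{f}\rangle=\sum_{i=1}^d\langle g_i,f_i\rangle$. Translations and modulations are $(T_y\mathbf{f})(x)=\mathbf{f}(x-y)$ and $(M_\xi\mathbf{f})(x)=e^{2\pi i\xi x}\mathbf{f}(x)$ for $y,\xi\in\mathbb{R}$. For $\gamma=(\gamma_1,\gamma_2)\in\mathbb{R}^2$ put $\mathbf{f}_\gamma=T_{\gamma_1}M_{\gamma_2}\mathbf{f}$, and for $\Gamma\subset\mathbb{R}^2$ the Gabor system is $\mathcal{G}(\mathbf{f},\Gamma)=(\mathbf{f}_\gamma)_{\gamma\in\Gamma}$. A family $(\eta_i)_{i\in I}$ in a Hilbert space $\mathcal{H}$ is a frame with (lower, upper) frame bounds $0<A\le B$ if $A\|\varphi\|^2\le\sum_{i\in I}|\langle\varphi,\eta_i\rangle|^2\le B\|\varphi\|^2$ for all $\varphi\in\mathcal{H}$. Frame bounds are not assumed to be optimal. The matrix norm is $\|\mathcal{M}\|=\sup\{\|\mathcal{M}z\|_2: z\in\mathbb{R}^2,\ \|z\|_\infty\le 1/2\}$, where $\|\cdot\|_p$ is the $\ell^p$-norm on $\mathbb{R}^2$. *)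

theory Defs
  imports "HOL-Analysis.Analysis"
begin

text \<open>
  Elements of \<open>L\<^sup>2\<close> are represented by Borel measurable square-integrable functions, not
  by classes modulo almost everywhere equality. Every class of Lebesgue measurable functions has
  such a representative, and all notions below depend only on the class.
\<close>

definition L2 :: "(real \<Rightarrow> complex) set" where
  "L2 = {f. f \<in> borel_measurable lborel \<and> integrable lborel (\<lambda>x. (cmod (f x))\<^sup>2)}"

definition L2_inner :: "(real \<Rightarrow> complex) \<Rightarrow> (real \<Rightarrow> complex) \<Rightarrow> complex" where
  "L2_inner g f = (LINT x|lborel. g x * cnj (f x))"

definition L2_vec :: "(real \<Rightarrow> complex ^ 'd) set" where
  "L2_vec = {f. \<forall>i. (\<lambda>x. f x $ i) \<in> L2}"

definition L2_vec_inner ::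
    "(real \<Rightarrow> complex ^ 'd) \<Rightarrow> (real \<Rightarrow> complex ^ 'd) \<Rightarrow> complex" where
  "L2_vec_inner g f = (\<Sum>i\<in>UNIV. L2_inner (\<lambda>x. g x $ i) (\<lambda>x. f x $ i))"

definition higher_vderiv :: "nat \<Rightarrow> (real \<Rightarrow> complex) \<Rightarrow> real \<Rightarrow> complex" where
  "higher_vderiv n f = ((\<lambda>g x. vector_derivative g (at x)) ^^ n) f"

definition schwartz :: "(real \<Rightarrow> complex) set" where
  "schwartz = {f. (\<forall>n x. higher_vderiv n f differentiable (at x)) \<and>
                  (\<forall>m n. bounded (range (\<lambda>x. x ^ m *\<^sub>R higher_vderiv n f x)))}"

definition translation :: "real \<Rightarrow> (real \<Rightarrow> complex ^ 'd) \<Rightarrow> real \<Rightarrow> complex ^ 'd" where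
  "translation y f = (\<lambda>x. f (x - y))"

definition modulation :: "real \<Rightarrow> (real \<Rightarrow> complex ^ 'd) \<Rightarrow> real \<Rightarrow> complex ^ 'd" where
  "modulation \<xi> f = (\<lambda>x. exp (2 * of_real pi * \<i> * of_real \<xi> * of_real x) *s f x)"

definition gabor_shift :: "(real \<Rightarrow> complex ^ 'd) \<Rightarrow> real ^ 2 \<Rightarrow> real \<Rightarrow> complex ^ 'd" where
  "gabor_shift f \<gamma> = translation (\<gamma> $ 1) (modulation (\<gamma> $ 2) f)"

text \<open>
  The Hilbert space is given by a carrier \<open>H\<close> (here: of representatives) and its scalar
  product, so \<open>Re (ip \<phi> \<phi>)\<close> is the squared norm of \<open>\<phi>\<close>. Summability has
  to be required because \<open>infsum\<close> is 0 for a divergent series.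
\<close>

definition frame_with_bounds ::
    "'a set \<Rightarrow> ('a \<Rightarrow> 'a \<Rightarrow> complex) \<Rightarrow> 'i set \<Rightarrow> ('i \<Rightarrow> 'a) \<Rightarrow> real \<Rightarrow> real \<Rightarrow> bool" where
  "frame_with_bounds H ip I \<eta> A B \<longleftrightarrow>
     0 < A \<and> A \<le> B \<and> (\<forall>i\<in>I. \<eta> i \<in> H) \<and>
     (\<forall>\<phi>\<in>H. (\<lambda>i. (cmod (ip \<phi> (\<eta> i)))\<^sup>2) summable_on I \<and>
        A * Re (ip \<phi> \<phi>) \<le> (\<Sum>\<^sub>\<infinity>i\<in>I. (cmod (ip \<phi> (\<eta> i)))\<^sup>2) \<and>
        (\<Sum>\<^sub>\<infinity>i\<in>I. (cmod (ip \<phi> (\<eta> i)))\<^sup>2) \<le> B * Re (ip \<phi> \<phi>))"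

definition gabor_frame ::
    "(real \<Rightarrow> complex ^ 'd) \<Rightarrow> (real ^ 2) set \<Rightarrow> real \<Rightarrow> real \<Rightarrow> bool" where
  "gabor_frame f \<Gamma> A B \<longleftrightarrow> frame_with_bounds L2_vec L2_vec_inner \<Gamma> (gabor_shift f) A B"

definition int_lattice :: "(real ^ 2) set" where
  "int_lattice = {z. \<forall>i. z $ i \<in> \<int>}"

definition matrix_norm :: "real ^ 2 ^ 2 \<Rightarrow> real" where
  "matrix_norm M = (SUP z\<in>{z. infnorm z \<le> 1/2}. norm (M *v z))"

end

(* For orthonormal f_1, ..., f_d the map V g (gamma) = <g, f_gamma> is an isometry of L^2(R; C^d) into
   L^2(R^2) (Moyal's identity, a consequence of Plancherel), and R^2 is tiled by the cells
   M(k + [-1/2,1/2)^2), so 1/|det M| times the squared norm of g is the sum over k of the mean of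
   |V g|^2 over the k-th cell. It remains to compare, in l^2(Z^2; L^2), V g on a cell with its value
   at the lattice point M k. After removing a phase that does not change |V g|, the directional
   derivatives of V g are short-time Fourier transforms with the Schwartz windows x f and f'; applying
   the fundamental theorem of calculus first in one direction of the cell and then in the other bounds
   the oscillation on a cell by ||M|| times the mean over the same cell of transforms whose windows are
   built from f by at most two such steps. By Moyal's identity again, these contribute at most
   const * ||M||^2 / |det M| * ||g||^2. *)
theory Submission
  imports Defs "HOL-Probability.Characteristic_Functions" "HOL-Probability.Sinc_Integral"
begin

section \<open>Continuity of translation in the mean\<close>

text \<open>The obstacle is that the y-derivative of a Gabor atom contains its frequency as a
  factor, which is unbounded over the lattice. \<open>stft_shift\<close> therefore moves g instead
  of the cell: all comparisons are made at the origin, where the frequency on a cell is at most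
  \<open>matrix_norm M\<close> < C \<le> 1. Two integration steps are needed because in the plane
  first derivatives in the mean do not control a value at a point. On a line they do, and using this
  across each leg of a path costs a second derivative. Squares are compared with weights 1 + e and 1
  + 1/e and then summed; optimizing e at the end recovers the triangle inequality in l^2, hence the
  factors (1 - r)^2 and (1 + r)^2 with r = ||M|| / C. Everything is done with extended nonnegative
  integrals, so summability comes out of the upper bound. If K is the Moyal constant of the second
  order majorant, the squared error is at most (4 ||M||)^2 K ||g||^2 / |det M|. This gives C = 1 /
  (1 + 4 sqrt K), where the summand 1 ensures C \<le> 1. Plancherel's theorem is proved here as
  well, from continuity of translation in the mean.\<close>

lemma integral_lborel_shift:
  fixes f :: "real \<Rightarrow> 'a :: {banach, second_countable_topology}"
  shows "(LINT x|lborel. f (x - t)) = (LINT x|lborel. f x)"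
  using lborel_integral_real_affine[of 1 f "- t"] by simp

lemma integrable_lborel_shift:
  fixes f :: "real \<Rightarrow> 'a :: {banach, second_countable_topology}"
  assumes "integrable lborel f"
  shows "integrable lborel (\<lambda>x. f (x - t))"
  using lborel_integrable_real_affine[OF assms, of 1 "- t"] by simp

lemma nn_integral_lborel_shift:
  fixes f :: "real \<Rightarrow> ennreal"
  assumes "f \<in> borel_measurable borel"
  shows "(\<integral>\<^sup>+x. f (x - t) \<partial>lborel) = (\<integral>\<^sup>+x. f x \<partial>lborel)"
  using nn_integral_real_affine[OF assms, of 1 "- t"] by simp

text \<open>A three-term estimate, in which translation invariance makes the first and the last term
  equal. It carries continuity of translation from open sets to Borel sets, and from there to limits
  in L1.\<close>

lemma L1_shift_closed:
  fixes u :: "real \<Rightarrow> real"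
  assumes u: "integrable lborel u"
    and approx: "\<And>e. e > 0 \<Longrightarrow> \<exists>v. integrable lborel v \<and> (LINT x|lborel. \<bar>u x - v x\<bar>) < e \<and>
       (\<lambda>n. LINT x|lborel. \<bar>v (x - \<tau> n) - v x\<bar>) \<longlonglongrightarrow> 0"
  shows "(\<lambda>n::nat. LINT x|lborel. \<bar>u (x - \<tau> n) - u x\<bar>) \<longlonglongrightarrow> 0"
proof (rule LIMSEQ_I)
  fix e :: real assume "e > 0"
  then obtain v where v: "integrable lborel v" "(LINT x|lborel. \<bar>u x - v x\<bar>) < e / 3"
    and lim: "(\<lambda>n. LINT x|lborel. \<bar>v (x - \<tau> n) - v x\<bar>) \<longlonglongrightarrow> 0"
    using approx[of "e / 3"] by auto
  note int = u v(1) integrable_lborel_shift[OF u] integrable_lborel_shift[OF v(1)]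
  from LIMSEQ_D[OF lim, of "e / 3"] \<open>e > 0\<close> obtain N where
    N: "\<And>n. n \<ge> N \<Longrightarrow> (LINT x|lborel. \<bar>v (x - \<tau> n) - v x\<bar>) < e / 3"
    by auto
  have "(LINT x|lborel. \<bar>u (x - t) - u x\<bar>) \<le>
     (LINT x|lborel. \<bar>u (x - t) - v (x - t)\<bar> + \<bar>v (x - t) - v x\<bar> + \<bar>u x - v x\<bar>)" for t
    by (intro integral_mono) (use int in auto)
  also have "\<dots> t = (LINT x|lborel. \<bar>u (x - t) - v (x - t)\<bar>) + (LINT x|lborel. \<bar>v (x - t) - v x\<bar>)
     + (LINT x|lborel. \<bar>u x - v x\<bar>)" for t
    using int by simp
  also have "(LINT x|lborel. \<bar>u (x - t) - v (x - t)\<bar>) = (LINT x|lborel. \<bar>u x - v x\<bar>)" for t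
    by (rule integral_lborel_shift)
  finally have *: "(LINT x|lborel. \<bar>u (x - t) - u x\<bar>) \<le> (LINT x|lborel. \<bar>u x - v x\<bar>) +
      (LINT x|lborel. \<bar>v (x - t) - v x\<bar>) + (LINT x|lborel. \<bar>u x - v x\<bar>)" for t .
  show "\<exists>N. \<forall>n\<ge>N. norm ((LINT x|lborel. \<bar>u (x - \<tau> n) - u x\<bar>) - 0) < e"
  proof (intro exI allI impI)
    fix n assume "n \<ge> N"
    then show "norm ((LINT x|lborel. \<bar>u (x - \<tau> n) - u x\<bar>) - 0) < e"
      using N[of n] v(2) *[of "\<tau> n"] by simp
  qed
qed

text \<open>At a boundary point of U the shifted indicators need not converge, so dominated
  convergence does not apply directly. But |p - q| = 2 q (1 - p) + (p - q) for p, q in {0, 1}, and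
  the last difference integrates to 0 by translation invariance. What remains lives on U, where
  openness gives pointwise convergence and the indicator of U dominates.\<close>

lemma L1_shift_open_tendsto:
  fixes U :: "real set"
  assumes U: "open U" "emeasure lborel U < \<infinity>" and \<tau>: "\<tau> \<longlonglongrightarrow> 0"
  shows "(\<lambda>n::nat. LINT x|lborel. \<bar>indicator U (x - \<tau> n) - indicator U x\<bar> :: real) \<longlonglongrightarrow> 0"
proof -
  have [measurable]: "U \<in> sets borel" using U by auto
  have int: "integrable lborel (indicator U :: real \<Rightarrow> real)"
    using U by (intro integrable_real_indicator) auto
  note ints = int integrable_lborel_shift[OF int]
  have "(LINT x|lborel. \<bar>indicator U (x - t) - indicator U x\<bar>) =
      (LINT x|lborel. 2 * (indicator U x * (1 - indicator U (x - t))) + (indicator U (x - t) - indicator U x :: real))" for t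
    by (intro Bochner_Integration.integral_cong) (auto simp: indicator_def)
  also have "\<dots> t = 2 * (LINT x|lborel. indicator U x * (1 - indicator U (x - t)) :: real)" for t
  proof -
    have i: "integrable lborel (\<lambda>x. indicator U x * (1 - indicator U (x - t)) :: real)"
      by (rule Bochner_Integration.integrable_bound[OF int]) (auto simp: indicator_def)
    then show ?thesis
      using ints integral_lborel_shift[of "indicator U :: real \<Rightarrow> real" t] by simp
  qed
  finally have eq: "(LINT x|lborel. \<bar>indicator U (x - t) - indicator U x\<bar>) =
    2 * (LINT x|lborel. indicator U x * (1 - indicator U (x - t)) :: real)" for t .
  have "(\<lambda>n. LINT x|lborel. indicator U x * (1 - indicator U (x - \<tau> n)) :: real) \<longlonglongrightarrow> (LINT x|(lborel::real measure). 0)"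
  proof (rule integral_dominated_convergence[where w="indicator U"])
    show "AE x in lborel. (\<lambda>n. indicator U x * (1 - indicator U (x - \<tau> n)) :: real) \<longlonglongrightarrow> 0"
    proof (rule AE_I2)
      fix x :: real
      show "(\<lambda>n. indicator U x * (1 - indicator U (x - \<tau> n)) :: real) \<longlonglongrightarrow> 0"
      proof (cases "x \<in> U")
        case True
        have "(\<lambda>n. x - \<tau> n) \<longlonglongrightarrow> x - 0" by (intro tendsto_intros \<tau>)
        then have "eventually (\<lambda>n. x - \<tau> n \<in> U) sequentially"
          using U(1) True topological_tendstoD by fastforce
        then show ?thesis
          using True by (intro tendsto_eventually) (auto elim!: eventually_mono)
      qed simp
    qed
  qed (use int in \<open>auto simp: indicator_def\<close>)
  then show ?thesis
    unfolding eq by (auto intro: tendsto_mult_right_zero)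
qed

lemma L1_shift_tendsto:
  fixes u :: "real \<Rightarrow> real"
  assumes u: "integrable lborel u" and \<tau>: "\<tau> \<longlonglongrightarrow> 0"
  shows "(\<lambda>n::nat. LINT x|lborel. \<bar>u (x - \<tau> n) - u x\<bar>) \<longlonglongrightarrow> 0"
  using u
proof (induction rule: integrable_induct)
  case (base A c)
  have A[measurable]: "A \<in> sets borel" using base by simp
  have intA: "integrable lborel (\<lambda>x. indicator A x :: real)"
    using base by (intro integrable_real_indicator) auto
  have "(\<lambda>n. LINT x|lborel. \<bar>indicator A (x - \<tau> n) - indicator A x\<bar> :: real) \<longlonglongrightarrow> 0"
  proof (rule L1_shift_closed[OF intA])
    fix e :: real assume "e > 0"
    \<comment> \<open>Outer regularity puts A within e, in L1, of an open set; finiteness of the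
      measure of A passes to U.\<close>
    obtain U where U: "open U" "A \<subseteq> U" "emeasure lborel (U - A) < ennreal e"
      using outer_regular_lborel[OF A \<open>e > 0\<close>] by blast
    have [measurable]: "U \<in> sets borel" using U by auto
    have "emeasure lborel U = emeasure lborel A + emeasure lborel (U - A)"
      using U by (subst plus_emeasure) (auto simp: Un_absorb1)
    also have "\<dots> < \<infinity>" using base(2) U(3) by (auto simp: less_top[symmetric] top_unique)
    finally have Ufin: "emeasure lborel U < \<infinity>" .
    have "(LINT x|lborel. \<bar>indicator A x - indicator U x :: real\<bar>) = (LINT x|lborel. indicator (U - A) x)"
      using U(2) by (intro Bochner_Integration.integral_cong) (auto simp: indicator_def)
    also have "\<dots> = measure lborel (U - A)" by simp
    also have "\<dots> < e" using U(3) \<open>e > 0\<close>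
      by (metis ennreal_less_iff emeasure_eq_ennreal_measure measure_nonneg not_less_iff_gr_or_eq top.not_eq_extremum less_trans ennreal_less_top)
    finally show "\<exists>v. integrable lborel v \<and> (LINT x|lborel. \<bar>indicator A x - v x\<bar>) < e \<and>
       (\<lambda>n. LINT x|lborel. \<bar>v (x - \<tau> n) - v x\<bar>) \<longlonglongrightarrow> 0"
      using L1_shift_open_tendsto[OF U(1) Ufin \<tau>] Ufin
      by (intro exI[of _ "indicator U"] conjI integrable_real_indicator) auto
  qed
  then have "(\<lambda>n. (LINT x|lborel. \<bar>indicator A (x - \<tau> n) - indicator A x\<bar> :: real) * \<bar>c\<bar>) \<longlonglongrightarrow> 0"
    by (rule tendsto_mult_left_zero)
  then show ?case
    by (simp add: left_diff_distrib[symmetric] abs_mult)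
next
  case (add f g)
  show ?case
  proof (rule tendsto_sandwich[OF _ _ tendsto_const])
    show "(\<lambda>n. (LINT x|lborel. \<bar>f (x - \<tau> n) - f x\<bar>) + (LINT x|lborel. \<bar>g (x - \<tau> n) - g x\<bar>)) \<longlonglongrightarrow> 0"
      using tendsto_add[OF add(3,4)] by simp
    show "\<forall>\<^sub>F n in sequentially. (LINT x|lborel. \<bar>f (x - \<tau> n) + g (x - \<tau> n) - (f x + g x)\<bar>) \<le>
       (LINT x|lborel. \<bar>f (x - \<tau> n) - f x\<bar>) + (LINT x|lborel. \<bar>g (x - \<tau> n) - g x\<bar>)"
    proof (intro always_eventually allI)
      fix n
      note i = add(1,2) add(1,2)[THEN integrable_lborel_shift[of _ "\<tau> n"]]
      have "(LINT x|lborel. \<bar>f (x - \<tau> n) + g (x - \<tau> n) - (f x + g x)\<bar>) \<le>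
          (LINT x|lborel. \<bar>f (x - \<tau> n) - f x\<bar> + \<bar>g (x - \<tau> n) - g x\<bar>)"
        by (rule integral_mono) (use i in auto)
      then show "(LINT x|lborel. \<bar>f (x - \<tau> n) + g (x - \<tau> n) - (f x + g x)\<bar>) \<le>
       (LINT x|lborel. \<bar>f (x - \<tau> n) - f x\<bar>) + (LINT x|lborel. \<bar>g (x - \<tau> n) - g x\<bar>)"
        using i by simp
    qed
  qed auto
next
  case (lim f s)
  have "(\<lambda>i. LINT x|lborel. \<bar>f x - s i x\<bar>) \<longlonglongrightarrow> (LINT x|(lborel::real measure). 0)"
  proof (rule integral_dominated_convergence[where w="\<lambda>x. 3 * norm (f x)"])
    show "AE x in lborel. (\<lambda>i. \<bar>f x - s i x\<bar>) \<longlonglongrightarrow> 0"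
    proof (rule AE_I2)
      fix x
      have "(\<lambda>i. s i x) \<longlonglongrightarrow> f x" using lim(2)[of x] by simp
      then have "(\<lambda>i. \<bar>f x - s i x\<bar>) \<longlonglongrightarrow> \<bar>f x - f x\<bar>"
        by (intro tendsto_intros)
      then show "(\<lambda>i. \<bar>f x - s i x\<bar>) \<longlonglongrightarrow> 0" by simp
    qed
    \<comment> \<open>The approximants supplied by \<open>integrable_induct\<close> satisfy |s i|
      \<le> 2 |f|, which explains the factor 3.\<close>
    show "AE x in lborel. norm \<bar>f x - s i x\<bar> \<le> 3 * norm (f x)" for i
      using lim(3)[of _ i] by (intro AE_I2) (smt (verit) real_norm_def space_lborel UNIV_I space_borel)
  qed (use lim in auto)
  then have L: "(\<lambda>i. LINT x|lborel. \<bar>f x - s i x\<bar>) \<longlonglongrightarrow> 0" by simp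
  show ?case
  proof (rule L1_shift_closed[OF lim(4)])
    fix e :: real assume "e > 0"
    from LIMSEQ_D[OF L this] obtain i where "(LINT x|lborel. \<bar>f x - s i x\<bar>) < e" by auto
    then show "\<exists>v. integrable lborel v \<and> (LINT x|lborel. \<bar>f x - v x\<bar>) < e \<and>
       (\<lambda>n. LINT x|lborel. \<bar>v (x - \<tau> n) - v x\<bar>) \<longlonglongrightarrow> 0"
      using lim(1,5) by blast
  qed
qed

lemma pos_part_diff_square_le:
  fixes a b :: real
  shows "(max 0 a - max 0 b)\<^sup>2 \<le> \<bar>(max 0 a)\<^sup>2 - (max 0 b)\<^sup>2\<bar>"
proof -
  have "(p - q)\<^sup>2 \<le> \<bar>p\<^sup>2 - q\<^sup>2\<bar>" if "p \<ge> 0" "q \<ge> 0" for p q :: real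
  proof -
    have "(p - q)\<^sup>2 = \<bar>p - q\<bar> * \<bar>p - q\<bar>" by (simp add: power2_eq_square)
    also have "\<dots> \<le> \<bar>p - q\<bar> * (p + q)" using that by (intro mult_left_mono) auto
    also have "\<dots> = \<bar>(p - q) * (p + q)\<bar>" using that by (simp add: abs_mult)
    finally show ?thesis by (simp add: power2_eq_square algebra_simps)
  qed
  then show ?thesis by simp
qed

text \<open>The estimate (p - q)^2 \<le> |p^2 - q^2| needs equal signs, hence the split into
  positive and negative parts. It reduces continuity of translation in L2 to the L1 case, applied to
  the squares of the two parts.\<close>

lemma square_diff_le_pos_parts:
  fixes a b :: real
  shows "(a - b)\<^sup>2 \<le> 2 * \<bar>(max 0 a)\<^sup>2 - (max 0 b)\<^sup>2\<bar> + 2 * \<bar>(max 0 (- a))\<^sup>2 - (max 0 (- b))\<^sup>2\<bar>"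
proof -
  have "a - b = (max 0 a - max 0 b) - (max 0 (- a) - max 0 (- b))" by auto
  moreover have "(p - q)\<^sup>2 \<le> 2 * p\<^sup>2 + 2 * q\<^sup>2" for p q :: real
    using zero_le_power2[of "p + q"] by (simp add: power2_eq_square algebra_simps)
  ultimately have "(a - b)\<^sup>2 \<le> 2 * (max 0 a - max 0 b)\<^sup>2 + 2 * (max 0 (- a) - max 0 (- b))\<^sup>2"
    by metis
  then show ?thesis
    using pos_part_diff_square_le[of a b] pos_part_diff_square_le[of "-a" "-b"] by linarith
qed

lemma L2_shift_tendsto_real:
  fixes u :: "real \<Rightarrow> real"
  assumes [measurable]: "u \<in> borel_measurable borel"
    and u: "integrable lborel (\<lambda>x. (u x)\<^sup>2)" and \<tau>: "\<tau> \<longlonglongrightarrow> 0"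
  shows "(\<lambda>n::nat. LINT x|lborel. (u (x - \<tau> n) - u x)\<^sup>2) \<longlonglongrightarrow> 0"
proof -
  define p q where "p x = (max 0 (u x))\<^sup>2" and "q x = (max 0 (- u x))\<^sup>2" for x
  have p: "integrable lborel p" and q: "integrable lborel q"
    unfolding p_def q_def
    by (rule Bochner_Integration.integrable_bound[OF u]; auto simp: max_def)+
  note ints = p q p[THEN integrable_lborel_shift] q[THEN integrable_lborel_shift]
  show ?thesis
  proof (rule tendsto_sandwich[OF _ _ tendsto_const])
    show "(\<lambda>n. 2 * (LINT x|lborel. \<bar>p (x - \<tau> n) - p x\<bar>) + 2 * (LINT x|lborel. \<bar>q (x - \<tau> n) - q x\<bar>)) \<longlonglongrightarrow> 0"
      using tendsto_add[OF tendsto_mult_right_zero[OF L1_shift_tendsto[OF p \<tau>], of 2]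
          tendsto_mult_right_zero[OF L1_shift_tendsto[OF q \<tau>], of 2]] by simp
    have "(LINT x|lborel. (u (x - t) - u x)\<^sup>2) \<le>
       2 * (LINT x|lborel. \<bar>p (x - t) - p x\<bar>) + 2 * (LINT x|lborel. \<bar>q (x - t) - q x\<bar>)" for t
    proof -
      have "(LINT x|lborel. (u (x - t) - u x)\<^sup>2) \<le>
          (LINT x|lborel. 2 * \<bar>p (x - t) - p x\<bar> + 2 * \<bar>q (x - t) - q x\<bar>)"
        by (rule integral_mono')
          (use ints in simp, use square_diff_le_pos_parts in \<open>auto simp: p_def q_def\<close>)
      also have "\<dots> = 2 * (LINT x|lborel. \<bar>p (x - t) - p x\<bar>) + 2 * (LINT x|lborel. \<bar>q (x - t) - q x\<bar>)"
        using ints by simp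
      finally show ?thesis .
    qed
    then show "\<forall>\<^sub>F n in sequentially. (LINT x|lborel. (u (x - \<tau> n) - u x)\<^sup>2) \<le>
       2 * (LINT x|lborel. \<bar>p (x - \<tau> n) - p x\<bar>) + 2 * (LINT x|lborel. \<bar>q (x - \<tau> n) - q x\<bar>)"
      by simp
  qed auto
qed

lemma L2_shift_tendsto:
  fixes u :: "real \<Rightarrow> complex"
  assumes u: "u \<in> L2" and \<tau>: "\<tau> \<longlonglongrightarrow> 0"
  shows "(\<lambda>n::nat. LINT x|lborel. (cmod (u (x - \<tau> n) - u x))\<^sup>2) \<longlonglongrightarrow> 0"
proof -
  have [measurable]: "u \<in> borel_measurable borel" and i: "integrable lborel (\<lambda>x. (cmod (u x))\<^sup>2)"
    using u by (auto simp: L2_def)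
  have re: "integrable lborel (\<lambda>x. (Re (u x))\<^sup>2)" and im: "integrable lborel (\<lambda>x. (Im (u x))\<^sup>2)"
    by (rule Bochner_Integration.integrable_bound[OF i]; simp add: cmod_def)+
  have sq: "integrable lborel (\<lambda>x. (w (x - t) - w x)\<^sup>2)"
    if [measurable]: "w \<in> borel_measurable borel" and "integrable lborel (\<lambda>x. (w x)\<^sup>2)"
    for w :: "real \<Rightarrow> real" and t
  proof (rule Bochner_Integration.integrable_bound)
    show "integrable lborel (\<lambda>x. 2 * (w (x - t))\<^sup>2 + 2 * (w x)\<^sup>2)"
      using that(2) integrable_lborel_shift[OF that(2), of t] by auto
    have "(a - b)\<^sup>2 \<le> 2 * a\<^sup>2 + 2 * b\<^sup>2" for a b :: real
      using zero_le_power2[of "a + b"] by (simp add: power2_eq_square algebra_simps)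
    then show "AE x in lborel. norm ((w (x - t) - w x)\<^sup>2) \<le> norm (2 * (w (x - t))\<^sup>2 + 2 * (w x)\<^sup>2)"
      by simp
  qed simp
  have "(LINT x|lborel. (cmod (u (x - t) - u x))\<^sup>2) =
     (LINT x|lborel. (Re (u (x - t)) - Re (u x))\<^sup>2) + (LINT x|lborel. (Im (u (x - t)) - Im (u x))\<^sup>2)" for t
    using sq[OF _ re, of t] sq[OF _ im, of t] by (simp add: cmod_power2)
  then show ?thesis
    using tendsto_add[OF L2_shift_tendsto_real[OF _ re \<tau>] L2_shift_tendsto_real[OF _ im \<tau>]] by simp
qed

section \<open>Iterated integrals, the Fourier transform and its Gaussian averages\<close>

lemma integrable_lborel_pairI:
  fixes f :: "real \<times> real \<Rightarrow> 'b :: {banach, second_countable_topology}"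
  assumes "f \<in> borel_measurable (lborel \<Otimes>\<^sub>M lborel)"
    and "(\<integral>\<^sup>+x. \<integral>\<^sup>+y. ennreal (norm (f (x, y))) \<partial>lborel \<partial>lborel) < \<infinity>"
  shows "integrable (lborel \<Otimes>\<^sub>M lborel) f"
  using assms by (intro integrableI_bounded) (auto simp: lborel.nn_integral_fst[symmetric])

lemma Fubini_lborel:
  fixes f :: "real \<Rightarrow> real \<Rightarrow> 'b :: {banach, second_countable_topology}"
  assumes "case_prod f \<in> borel_measurable (lborel \<Otimes>\<^sub>M lborel)"
    and "(\<integral>\<^sup>+x. \<integral>\<^sup>+y. ennreal (norm (f x y)) \<partial>lborel \<partial>lborel) < \<infinity>"
  shows "(LINT x|lborel. LINT y|lborel. f x y) = (LINT y|lborel. LINT x|lborel. f x y)"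
  using lborel_pair.Fubini_integral[of f] integrable_lborel_pairI[of "case_prod f"] assms by simp

lemma cis_measurable [measurable]:
  "f \<in> borel_measurable M \<Longrightarrow> (\<lambda>x. cis (f x)) \<in> borel_measurable M"
proof -
  have "cis \<in> borel_measurable borel"
    by (intro borel_measurable_continuous_onI) (simp add: cis_conv_exp continuous_intros)
  then show "f \<in> borel_measurable M \<Longrightarrow> (\<lambda>x. cis (f x)) \<in> borel_measurable M"
    by simp
qed

lemma cnj_measurable [measurable]:
  "f \<in> borel_measurable M \<Longrightarrow> (\<lambda>x. cnj (f x)) \<in> borel_measurable M"
proof -
  have "cnj \<in> borel_measurable borel"
    by (intro borel_measurable_continuous_onI continuous_intros)
  then show "f \<in> borel_measurable M \<Longrightarrow> (\<lambda>x. cnj (f x)) \<in> borel_measurable M"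
    by simp
qed

definition fourier :: "(real \<Rightarrow> complex) \<Rightarrow> real \<Rightarrow> complex" where
  "fourier u \<xi> = (LINT x|lborel. u x * cis (- (2 * pi * \<xi> * x)))"

lemma fourier_measurable [measurable]:
  assumes [measurable]: "u \<in> borel_measurable borel"
  shows "fourier u \<in> borel_measurable borel"
  unfolding fourier_def by measurable

lemma norm_fourier_le: "cmod (fourier u \<xi>) \<le> (LINT x|lborel. cmod (u x))"
  unfolding fourier_def
  by (rule order_trans[OF integral_norm_bound]) (simp add: norm_mult)

lemma integrable_mult_cis:
  assumes "integrable lborel u" and [measurable]: "p \<in> borel_measurable borel"
  shows "integrable lborel (\<lambda>x::real. u x * cis (p x))"
  by (rule Bochner_Integration.integrable_bound[OF assms(1)])
    (use assms(1) in \<open>auto simp: norm_mult\<close>)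

lemma integral_std_normal_cis:
  "(LINT s|lborel. of_real (std_normal_density s) * cis (t * s)) = complex_of_real (exp (- t\<^sup>2 / 2))"
proof -
  have "char std_normal_distribution t = (LINT s|lborel. std_normal_density s *\<^sub>R cis (t * s))"
    unfolding char_def cis_conv_exp by (subst integral_density) auto
  then show ?thesis
    by (simp add: char_std_normal_distribution scaleR_conv_of_real)
qed

lemma nn_integral_std_normal: "(\<integral>\<^sup>+s. ennreal (std_normal_density s) \<partial>lborel) = 1"
  by (subst nn_integral_eq_integral) simp_all

text \<open>
  Plancherel's theorem is obtained by damping \<open>\<bar>fourier u\<bar>\<^sup>2\<close> with a Gaussian of width \<open>m\<close>. This turns it
  into a Gaussian average, of width of order \<open>1 / m\<close>, of the autocorrelation of \<open>u\<close>, which tends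
  to its value at 0 as \<open>m\<close> grows.
\<close>

lemma gaussian_average_fourier:
  assumes u: "integrable lborel u"
  shows "(LINT s|lborel. of_real (std_normal_density s) * (fourier u (m * s) * cnj (fourier u (m * s)))) =
    (LINT x|lborel. u x * (LINT y|lborel. cnj (u y) * of_real (exp (- (2 * pi * m * (x - y))\<^sup>2 / 2))))"
proof -
  have [measurable]: "u \<in> borel_measurable borel" using u by auto
  define B where "B = (LINT x|lborel. cmod (u x))"
  have B: "(\<integral>\<^sup>+x. ennreal (cmod (u x)) \<partial>lborel) = ennreal B"
    unfolding B_def using u by (intro nn_integral_eq_integral) auto
  have B0: "B \<ge> 0" unfolding B_def by simp
  let ?\<phi> = std_normal_density
  \<comment> \<open>For fixed x, the conjugate transform is expanded as an integral over y and the
    integral over s is carried out first; it is the characteristic function of the standard normal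
    law at 2 pi m (y - x).\<close>
  have inner: "(LINT s|lborel. of_real (?\<phi> s) * (cis (- (2 * pi * (m * s) * x)) * cnj (fourier u (m * s)))) =
      (LINT y|lborel. cnj (u y) * of_real (exp (- (2 * pi * m * (x - y))\<^sup>2 / 2)))" for x
  proof -
    let ?f = "\<lambda>s y. of_real (?\<phi> s) * cis (- (2 * pi * (m * s) * x)) * (cnj (u y) * cis (2 * pi * (m * s) * y))"
    have "(LINT s|lborel. of_real (?\<phi> s) * (cis (- (2 * pi * (m * s) * x)) * cnj (fourier u (m * s)))) =
        (LINT s|lborel. LINT y|lborel. ?f s y)"
    proof (rule Bochner_Integration.integral_cong[OF refl])
      fix s
      have "cnj (fourier u (m * s)) = (LINT y|lborel. cnj (u y) * cis (2 * pi * (m * s) * y))"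
        unfolding fourier_def by (simp add: Bochner_Integration.integral_cnj[symmetric] cis_cnj del: Bochner_Integration.integral_cnj)
      then show "of_real (?\<phi> s) * (cis (- (2 * pi * (m * s) * x)) * cnj (fourier u (m * s))) =
          (LINT y|lborel. ?f s y)"
        by (simp add: mult.assoc)
    qed
    also have "\<dots> = (LINT y|lborel. LINT s|lborel. ?f s y)"
    proof (rule Fubini_lborel)
      show "case_prod ?f \<in> borel_measurable (lborel \<Otimes>\<^sub>M lborel)" by measurable
      have "(\<integral>\<^sup>+s. \<integral>\<^sup>+y. ennreal (norm (?f s y)) \<partial>lborel \<partial>lborel) =
          (\<integral>\<^sup>+s. ennreal (?\<phi> s) * ennreal B \<partial>lborel)"
        by (simp add: norm_mult ennreal_mult nn_integral_cmult B)
      also have "\<dots> < \<infinity>"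
        by (subst nn_integral_multc) (auto simp: nn_integral_std_normal)
      finally show "(\<integral>\<^sup>+s. \<integral>\<^sup>+y. ennreal (norm (?f s y)) \<partial>lborel \<partial>lborel) < \<infinity>" .
    qed
    also have "\<dots> = (LINT y|lborel. cnj (u y) * of_real (exp (- (2 * pi * m * (x - y))\<^sup>2 / 2)))"
    proof (rule Bochner_Integration.integral_cong[OF refl])
      fix y
      have "?f s y = cnj (u y) * (of_real (?\<phi> s) * cis ((2 * pi * m * (y - x)) * s))" for s
        by (simp add: cis_mult[symmetric] algebra_simps flip: cis_mult) (simp add: cis_mult algebra_simps)
      then have "(LINT s|lborel. ?f s y) = cnj (u y) * of_real (exp (- (2 * pi * m * (y - x))\<^sup>2 / 2))"
        by (simp only: integral_mult_right_zero integral_std_normal_cis)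
      also have "(2 * pi * m * (y - x))\<^sup>2 = (2 * pi * m * (x - y))\<^sup>2"
        by (simp add: power2_eq_square algebra_simps)
      finally show "(LINT s|lborel. ?f s y) = cnj (u y) * of_real (exp (- (2 * pi * m * (x - y))\<^sup>2 / 2))" .
    qed
    finally show ?thesis .
  qed
  let ?g = "\<lambda>s x. u x * (of_real (?\<phi> s) * (cis (- (2 * pi * (m * s) * x)) * cnj (fourier u (m * s))))"
  have "(LINT s|lborel. of_real (?\<phi> s) * (fourier u (m * s) * cnj (fourier u (m * s)))) =
      (LINT s|lborel. LINT x|lborel. ?g s x)"
  proof (rule Bochner_Integration.integral_cong[OF refl])
    fix s
    have "(LINT x|lborel. ?g s x) =
      (LINT x|lborel. (of_real (?\<phi> s) * cnj (fourier u (m * s))) * (u x * cis (- (2 * pi * (m * s) * x))))"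
      by (intro Bochner_Integration.integral_cong) (auto simp: mult_ac)
    also have "\<dots> = of_real (?\<phi> s) * cnj (fourier u (m * s)) * fourier u (m * s)"
      unfolding fourier_def[of u "m * s"] by (rule integral_mult_right_zero)
    finally show "of_real (?\<phi> s) * (fourier u (m * s) * cnj (fourier u (m * s))) = (LINT x|lborel. ?g s x)"
      by (simp add: mult_ac)
  qed
  also have "\<dots> = (LINT x|lborel. LINT s|lborel. ?g s x)"
  proof (rule Fubini_lborel)
    show "case_prod ?g \<in> borel_measurable (lborel \<Otimes>\<^sub>M lborel)" by measurable
    have "(\<integral>\<^sup>+s. \<integral>\<^sup>+x. ennreal (norm (?g s x)) \<partial>lborel \<partial>lborel) =
        (\<integral>\<^sup>+s. ennreal B * (ennreal (?\<phi> s) * ennreal (cmod (fourier u (m * s)))) \<partial>lborel)"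
      by (simp add: norm_mult ennreal_mult nn_integral_multc B)
    also have "\<dots> \<le> (\<integral>\<^sup>+s. ennreal B * (ennreal (?\<phi> s) * ennreal B) \<partial>lborel)"
      by (intro nn_integral_mono mult_left_mono ennreal_leI) (auto simp: B_def norm_fourier_le)
    also have "\<dots> < \<infinity>"
      by (simp add: nn_integral_cmult nn_integral_multc nn_integral_std_normal ennreal_mult_less_top)
    finally show "(\<integral>\<^sup>+s. \<integral>\<^sup>+x. ennreal (norm (?g s x)) \<partial>lborel \<partial>lborel) < \<infinity>" .
  qed
  also have "\<dots> = (LINT x|lborel. u x * (LINT y|lborel. cnj (u y) * of_real (exp (- (2 * pi * m * (x - y))\<^sup>2 / 2))))"
    by (simp add: inner)
  finally show ?thesis .
qed

text \<open>The substitution y = x - s / (2 pi m) moves the parameter m out of the Gaussian and into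
  a translation of v, so that for large m only the behaviour of small translations matters. The
  denominator combines the Jacobian 1 / (2 pi m) with the normalization sqrt (2 pi) of the
  density.\<close>

lemma gaussian_convolution_rescale:
  fixes v :: "real \<Rightarrow> complex"
  assumes "m > 0"
  shows "(LINT y|lborel. v y * of_real (exp (- (2 * pi * m * (x - y))\<^sup>2 / 2))) =
    (LINT s|lborel. of_real (std_normal_density s) * v (x - s / (2 * pi * m))) / of_real (sqrt (2 * pi) * m)"
proof -
  let ?c = "1 / (2 * pi * m)"
  have "(LINT y|lborel. v y * of_real (exp (- (2 * pi * m * (x - y))\<^sup>2 / 2))) =
      \<bar>- ?c\<bar> *\<^sub>R (LINT s|lborel. v (x + - ?c * s) * of_real (exp (- (2 * pi * m * (x - (x + - ?c * s)))\<^sup>2 / 2)))"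
    using assms by (intro lborel_integral_real_affine) auto
  also have "(\<lambda>s. v (x + - ?c * s) * of_real (exp (- (2 * pi * m * (x - (x + - ?c * s)))\<^sup>2 / 2))) =
     (\<lambda>s. of_real (sqrt (2 * pi)) * (of_real (std_normal_density s) * v (x - s / (2 * pi * m))))"
    using assms by (intro ext) (simp add: normal_density_def real_sqrt_mult)
  also have "\<bar>- ?c\<bar> *\<^sub>R (LINT s|lborel. of_real (sqrt (2 * pi)) * (of_real (std_normal_density s) * v (x - s / (2 * pi * m)))) =
     of_real (?c * sqrt (2 * pi)) * (LINT s|lborel. of_real (std_normal_density s) * v (x - s / (2 * pi * m)))"
    using assms by (simp add: scaleR_conv_of_real)
  also have "?c * sqrt (2 * pi) = 1 / (sqrt (2 * pi) * m)"
  proof -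
    have "2 * pi = sqrt (2 * pi) * sqrt (2 * pi)" by simp
    then show ?thesis using assms by (simp add: field_simps)
  qed
  finally show ?thesis by (simp add: field_simps)
qed

section \<open>Plancherel's theorem\<close>

lemma L2_measurable [measurable_dest]: "u \<in> L2 \<Longrightarrow> u \<in> borel_measurable borel"
  by (simp add: L2_def)

lemma L2_integrable: "u \<in> L2 \<Longrightarrow> integrable lborel (\<lambda>x. (cmod (u x))\<^sup>2)"
  by (simp add: L2_def)

lemma L2_nn_integral:
  "u \<in> L2 \<Longrightarrow> (\<integral>\<^sup>+x. ennreal ((cmod (u x))\<^sup>2) \<partial>lborel) = ennreal (LINT x|lborel. (cmod (u x))\<^sup>2)"
  by (intro nn_integral_eq_integral L2_integrable) auto

lemma norm_mult_le_half_squares: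
  fixes a b :: complex
  shows "cmod (a * b) \<le> ((cmod a)\<^sup>2 + (cmod b)\<^sup>2) / 2"
  using sum_squares_bound[of "cmod a" "cmod b"] by (simp add: norm_mult)

lemma norm_diff_square_le:
  fixes a b :: complex
  shows "(cmod (a - b))\<^sup>2 \<le> 2 * (cmod a)\<^sup>2 + 2 * (cmod b)\<^sup>2"
proof -
  have "(cmod (a - b))\<^sup>2 \<le> (cmod a + cmod b)\<^sup>2"
    by (intro power_mono norm_triangle_ineq4) auto
  also have "\<dots> \<le> 2 * (cmod a)\<^sup>2 + 2 * (cmod b)\<^sup>2"
    using sum_squares_bound[of "cmod a" "cmod b"] by (simp add: power2_sum)
  finally show ?thesis .
qed

lemma L2_mult_integrable:
  assumes "u \<in> L2" "v \<in> L2"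
  shows "integrable lborel (\<lambda>x. u x * v x)"
proof (rule Bochner_Integration.integrable_bound)
  show "integrable lborel (\<lambda>x. ((cmod (u x))\<^sup>2 + (cmod (v x))\<^sup>2) / 2)"
    using assms[THEN L2_integrable] by auto
  show "AE x in lborel. norm (u x * v x) \<le> norm (((cmod (u x))\<^sup>2 + (cmod (v x))\<^sup>2) / 2)"
    using norm_mult_le_half_squares by (auto simp: abs_of_nonneg)
qed (use assms in measurable)

lemma L2_cnj: "u \<in> L2 \<Longrightarrow> (\<lambda>x. cnj (u x)) \<in> L2"
  by (auto simp: L2_def)

lemma L2_shift: "u \<in> L2 \<Longrightarrow> (\<lambda>x. u (x - t)) \<in> L2"
  using integrable_lborel_shift[of "\<lambda>x. (cmod (u x))\<^sup>2" t] by (auto simp: L2_def)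

lemma L2_mult_cis:
  "u \<in> L2 \<Longrightarrow> p \<in> borel_measurable borel \<Longrightarrow> (\<lambda>x. cis (p x) * u x) \<in> L2"
  by (auto simp: L2_def norm_mult)

lemma L2_diff_integrable:
  assumes "u \<in> L2" "v \<in> L2"
  shows "integrable lborel (\<lambda>x. (cmod (u x - v x))\<^sup>2)"
proof (rule Bochner_Integration.integrable_bound)
  show "integrable lborel (\<lambda>x. 2 * (cmod (u x))\<^sup>2 + 2 * (cmod (v x))\<^sup>2)"
    using assms[THEN L2_integrable] by auto
  show "AE x in lborel. norm ((cmod (u x - v x))\<^sup>2) \<le> norm (2 * (cmod (u x))\<^sup>2 + 2 * (cmod (v x))\<^sup>2)"
    using norm_diff_square_le by auto
qed (use assms in measurable)

lemma Re_mult_cnj_polarization: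
  "Re (a * cnj b) = ((cmod a)\<^sup>2 + (cmod b)\<^sup>2 - (cmod (a - b))\<^sup>2) / 2"
  unfolding cmod_power2 by (simp add: power2_eq_square algebra_simps)

text \<open>Polarization. In this form the distance of the autocorrelation from its value at 0 is a
  translation error, to which \<open>L2_shift_tendsto\<close> applies.\<close>

lemma Re_autocorrelation:
  assumes u: "u \<in> L2"
  shows "Re (LINT x|lborel. u x * cnj (u (x - t))) =
    (LINT x|lborel. (cmod (u x))\<^sup>2) - (LINT x|lborel. (cmod (u (x - t) - u x))\<^sup>2) / 2"
proof -
  have "Re (LINT x|lborel. u x * cnj (u (x - t))) = (LINT x|lborel. Re (u x * cnj (u (x - t))))"
    by (intro integral_Re[symmetric] L2_mult_integrable u L2_cnj L2_shift)
  also have "\<dots> = (LINT x|lborel. ((cmod (u x))\<^sup>2 + (cmod (u (x - t)))\<^sup>2 - (cmod (u (x - t) - u x))\<^sup>2) / 2)"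
    unfolding Re_mult_cnj_polarization by (simp add: norm_minus_commute)
  also have "\<dots> = ((LINT x|lborel. (cmod (u x))\<^sup>2) + (LINT x|lborel. (cmod (u (x - t)))\<^sup>2)
      - (LINT x|lborel. (cmod (u (x - t) - u x))\<^sup>2)) / 2"
    using L2_integrable[OF u] L2_integrable[OF L2_shift[OF u, of t]] L2_diff_integrable[OF L2_shift[OF u, of t] u]
    by simp
  also have "(LINT x|lborel. (cmod (u (x - t)))\<^sup>2) = (LINT x|lborel. (cmod (u x))\<^sup>2)"
    by (rule integral_lborel_shift)
  finally show ?thesis by (simp add: field_simps)
qed

lemma L2_shift_diff_le:
  assumes u: "u \<in> L2"
  shows "(LINT x|lborel. (cmod (u (x - t) - u x))\<^sup>2) \<le> 4 * (LINT x|lborel. (cmod (u x))\<^sup>2)"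
proof -
  note i = L2_integrable[OF u] L2_integrable[OF L2_shift[OF u, of t]]
  have "(LINT x|lborel. (cmod (u (x - t) - u x))\<^sup>2) \<le>
      (LINT x|lborel. 2 * (cmod (u (x - t)))\<^sup>2 + 2 * (cmod (u x))\<^sup>2)"
    by (rule integral_mono) (use i L2_diff_integrable[OF L2_shift[OF u] u] norm_diff_square_le in auto)
  also have "\<dots> = 2 * (LINT x|lborel. (cmod (u (x - t)))\<^sup>2) + 2 * (LINT x|lborel. (cmod (u x))\<^sup>2)"
    using i by simp
  also have "(LINT x|lborel. (cmod (u (x - t)))\<^sup>2) = (LINT x|lborel. (cmod (u x))\<^sup>2)"
    by (rule integral_lborel_shift)
  finally show ?thesis by simp
qed

text \<open>Both assumptions on u are used for exchanging integrals: integrability for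
  \<open>gaussian_average_fourier\<close>, square integrability for bringing the Gaussian variable
  outside and leaving the autocorrelation of u inside, which is at most the squared norm of
  u.\<close>

lemma gaussian_average_fourier_L2:
  assumes u1: "integrable lborel u" and u2: "u \<in> L2" and m: "m > 0"
  shows "sqrt (2 * pi) * m * (LINT s|lborel. std_normal_density s * (cmod (fourier u (m * s)))\<^sup>2) =
    (LINT s|lborel. std_normal_density s * ((LINT x|lborel. (cmod (u x))\<^sup>2) -
       (LINT x|lborel. (cmod (u (x - s / (2 * pi * m)) - u x))\<^sup>2) / 2))"
proof -
  have [measurable]: "u \<in> borel_measurable borel" using u1 by auto
  let ?\<phi> = std_normal_density and ?K = "sqrt (2 * pi) * m"
  define N where "N = (LINT x|lborel. (cmod (u x))\<^sup>2)"
  define A where "A t = (LINT x|lborel. u x * cnj (u (x - t)))" for t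
  let ?g = "\<lambda>s x. u x * (of_real (?\<phi> s) * cnj (u (x - s / (2 * pi * m))))"
  have "complex_of_real (?K * (LINT s|lborel. ?\<phi> s * (cmod (fourier u (m * s)))\<^sup>2)) =
     of_real ?K * (LINT s|lborel. of_real (?\<phi> s) * (fourier u (m * s) * cnj (fourier u (m * s))))"
    unfolding of_real_mult integral_complex_of_real[symmetric] by (simp flip: complex_norm_square)
  also have "\<dots> = of_real ?K * (LINT x|lborel. (LINT s|lborel. ?g s x) / of_real ?K)"
    unfolding gaussian_average_fourier[OF u1] gaussian_convolution_rescale[OF m] by simp
  also have "\<dots> = (LINT x|lborel. LINT s|lborel. ?g s x)"
    using m by simp
  also have "\<dots> = (LINT s|lborel. LINT x|lborel. ?g s x)"
  proof (rule Fubini_lborel[symmetric])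
    show "case_prod ?g \<in> borel_measurable (lborel \<Otimes>\<^sub>M lborel)" by measurable
    have "(\<integral>\<^sup>+s. \<integral>\<^sup>+x. ennreal (norm (?g s x)) \<partial>lborel \<partial>lborel) \<le> (\<integral>\<^sup>+s. ennreal (?\<phi> s) * ennreal N \<partial>lborel)"
    proof (rule nn_integral_mono)
      fix s
      let ?t = "s / (2 * pi * m)"
      have "(\<integral>\<^sup>+x. ennreal (norm (?g s x)) \<partial>lborel) = ennreal (?\<phi> s) * (\<integral>\<^sup>+x. ennreal (cmod (u x * u (x - ?t))) \<partial>lborel)"
        by (subst nn_integral_cmult[symmetric]) (auto simp: norm_mult ennreal_mult[symmetric] mult_ac)
      also have "(\<integral>\<^sup>+x. ennreal (cmod (u x * u (x - ?t))) \<partial>lborel) = ennreal (LINT x|lborel. cmod (u x * u (x - ?t)))"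
        by (intro nn_integral_eq_integral integrable_norm L2_mult_integrable u2 L2_shift) auto
      also have "(LINT x|lborel. cmod (u x * u (x - ?t))) \<le> (LINT x|lborel. ((cmod (u x))\<^sup>2 + (cmod (u (x - ?t)))\<^sup>2) / 2)"
        by (intro integral_mono norm_mult_le_half_squares integrable_norm L2_mult_integrable u2 L2_shift
            Bochner_Integration.integrable_divide Bochner_Integration.integrable_add L2_integrable)
      also have "\<dots> = ((LINT x|lborel. (cmod (u x))\<^sup>2) + (LINT x|lborel. (cmod (u (x - ?t)))\<^sup>2)) / 2"
        using L2_integrable[OF u2] L2_integrable[OF L2_shift[OF u2, of ?t]] by simp
      also have "(LINT x|lborel. (cmod (u (x - ?t)))\<^sup>2) = N"
        unfolding N_def by (rule integral_lborel_shift)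
      finally show "(\<integral>\<^sup>+x. ennreal (norm (?g s x)) \<partial>lborel) \<le> ennreal (?\<phi> s) * ennreal N"
        by (simp add: N_def mult_left_mono ennreal_leI)
    qed
    also have "\<dots> < \<infinity>"
      by (simp add: nn_integral_multc nn_integral_std_normal)
    finally show "(\<integral>\<^sup>+s. \<integral>\<^sup>+x. ennreal (norm (?g s x)) \<partial>lborel \<partial>lborel) < \<infinity>" .
  qed
  also have "\<dots> = (LINT s|lborel. of_real (?\<phi> s) * A (s / (2 * pi * m)))"
    unfolding A_def by (simp add: mult.left_commute[of "u _"])
  finally have eq: "complex_of_real (?K * (LINT s|lborel. ?\<phi> s * (cmod (fourier u (m * s)))\<^sup>2)) =
     (LINT s|lborel. of_real (?\<phi> s) * A (s / (2 * pi * m)))" .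
  have [measurable]: "A \<in> borel_measurable borel" unfolding A_def by measurable
  have Abd: "cmod (A t) \<le> N" for t
  proof -
    have "cmod (A t) \<le> (LINT x|lborel. cmod (u x * cnj (u (x - t))))"
      unfolding A_def by (rule integral_norm_bound)
    also have "\<dots> \<le> (LINT x|lborel. ((cmod (u x))\<^sup>2 + (cmod (cnj (u (x - t))))\<^sup>2) / 2)"
      by (intro integral_mono norm_mult_le_half_squares integrable_norm L2_mult_integrable u2 L2_cnj L2_shift
          Bochner_Integration.integrable_divide Bochner_Integration.integrable_add L2_integrable)
    also have "\<dots> = ((LINT x|lborel. (cmod (u x))\<^sup>2) + (LINT x|lborel. (cmod (u (x - t)))\<^sup>2)) / 2"
      using L2_integrable[OF u2] L2_integrable[OF L2_shift[OF u2, of t]] by simp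
    also have "(LINT x|lborel. (cmod (u (x - t)))\<^sup>2) = N"
      unfolding N_def by (rule integral_lborel_shift)
    finally show ?thesis by (simp add: N_def)
  qed
  \<comment> \<open>The left side of \<open>eq\<close> is real, so the autocorrelation may be
    replaced by its real part; this integrability lets the real part pass under the
    integral.\<close>
  have "integrable lborel (\<lambda>s. of_real (?\<phi> s) * A (s / (2 * pi * m)))"
  proof (rule Bochner_Integration.integrable_bound)
    show "integrable lborel (\<lambda>s. ?\<phi> s * N)" by simp
    show "AE s in lborel. norm (of_real (?\<phi> s) * A (s / (2 * pi * m))) \<le> norm (?\<phi> s * N)"
      using Abd order_trans[OF norm_ge_zero Abd] by (auto simp: norm_mult intro!: mult_left_mono)
  qed simp
  then have "Re (LINT s|lborel. of_real (?\<phi> s) * A (s / (2 * pi * m))) =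
      (LINT s|lborel. Re (of_real (?\<phi> s) * A (s / (2 * pi * m))))"
    by (rule integral_Re[symmetric])
  also have "\<dots> = (LINT s|lborel. ?\<phi> s * (N - (LINT x|lborel. (cmod (u (x - s / (2 * pi * m)) - u x))\<^sup>2) / 2))"
    unfolding A_def N_def Re_complex_of_real by (simp add: Re_autocorrelation[OF u2])
  finally show ?thesis
    unfolding eq[symmetric] N_def by simp
qed

text \<open>The same Gaussian averages have two limits. On the Fourier side the weights increase to
  1, so monotone convergence applies even to an integral that might be infinite; on the other side
  dominated convergence leaves the autocorrelation at 0.\<close>

theorem plancherel:
  assumes u1: "integrable lborel u" and u2: "u \<in> L2"
  shows "(\<integral>\<^sup>+\<xi>. ennreal ((cmod (fourier u \<xi>))\<^sup>2) \<partial>lborel) = (\<integral>\<^sup>+x. ennreal ((cmod (u x))\<^sup>2) \<partial>lborel)"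
proof (rule LIMSEQ_unique)
  have [measurable]: "u \<in> borel_measurable borel" using u1 by auto
  let ?\<phi> = std_normal_density
  define N where "N = (LINT x|lborel. (cmod (u x))\<^sup>2)"
  define D where "D t = (LINT x|lborel. (cmod (u (x - t) - u x))\<^sup>2)" for t
  have [measurable]: "D \<in> borel_measurable borel" unfolding D_def by measurable
  let ?w = "\<lambda>n \<xi>. exp (- (\<xi> / real (Suc n))\<^sup>2 / 2)"
  show "(\<lambda>n. \<integral>\<^sup>+\<xi>. ennreal (?w n \<xi> * (cmod (fourier u \<xi>))\<^sup>2) \<partial>lborel) \<longlonglongrightarrow>
      (\<integral>\<^sup>+\<xi>. ennreal ((cmod (fourier u \<xi>))\<^sup>2) \<partial>lborel)"
  proof (rule nn_integral_LIMSEQ)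
    show "incseq (\<lambda>n \<xi>. ennreal (?w n \<xi> * (cmod (fourier u \<xi>))\<^sup>2))"
    proof (intro incseq_SucI le_funI ennreal_leI mult_right_mono)
      fix n \<xi>
      have "(\<xi> / real (Suc (Suc n)))\<^sup>2 \<le> (\<xi> / real (Suc n))\<^sup>2"
        unfolding power_divide by (intro divide_left_mono power_mono mult_pos_pos) auto
      then show "?w n \<xi> \<le> ?w (Suc n) \<xi>" by simp
    qed simp
    fix \<xi>
    have "(\<lambda>n. \<xi> / real (Suc n)) \<longlonglongrightarrow> 0"
      by (rule LIMSEQ_Suc) (rule lim_const_over_n)
    then have "(\<lambda>n. ?w n \<xi> * (cmod (fourier u \<xi>))\<^sup>2) \<longlonglongrightarrow> exp (- 0\<^sup>2 / 2) * (cmod (fourier u \<xi>))\<^sup>2"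
      by (intro tendsto_intros) auto
    then show "(\<lambda>n. ennreal (?w n \<xi> * (cmod (fourier u \<xi>))\<^sup>2)) \<longlonglongrightarrow> ennreal ((cmod (fourier u \<xi>))\<^sup>2)"
      by (intro tendsto_ennrealI) simp
  qed simp
  define I where "I n = (LINT s|lborel. ?\<phi> s * (N - D (s / (2 * pi * real (Suc n))) / 2))" for n
  have "(\<integral>\<^sup>+\<xi>. ennreal (?w n \<xi> * (cmod (fourier u \<xi>))\<^sup>2) \<partial>lborel) = ennreal (I n)" for n
  proof -
    let ?m = "real (Suc n)"
    define F where "F s = ?\<phi> s * (cmod (fourier u (?m * s)))\<^sup>2" for s
    have Fint: "integrable lborel F"
    proof (rule Bochner_Integration.integrable_bound)
      show "integrable lborel (\<lambda>s. ?\<phi> s * (LINT x|lborel. cmod (u x))\<^sup>2)" by simp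
      show "AE s in lborel. norm (F s) \<le> norm (?\<phi> s * (LINT x|lborel. cmod (u x))\<^sup>2)"
        by (auto simp: F_def intro!: mult_left_mono power_mono norm_fourier_le)
    qed (simp add: F_def[abs_def])
    have Fpos: "F s \<ge> 0" for s by (simp add: F_def)
    have F: "(\<integral>\<^sup>+s. ennreal (F s) \<partial>lborel) = ennreal (LINT s|lborel. F s)"
      using Fint Fpos by (intro nn_integral_eq_integral) auto
    \<comment> \<open>Substituting \<xi> = m s turns the weight into sqrt (2 pi) times the normal
      density. Together with the Jacobian m this is the factor in front of the average in
      \<open>gaussian_average_fourier_L2\<close>.\<close>
    have "(\<integral>\<^sup>+\<xi>. ennreal (?w n \<xi> * (cmod (fourier u \<xi>))\<^sup>2) \<partial>lborel) =
      ennreal \<bar>?m\<bar> * (\<integral>\<^sup>+s. ennreal (?w n (0 + ?m * s) * (cmod (fourier u (0 + ?m * s)))\<^sup>2) \<partial>lborel)"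
      by (rule nn_integral_real_affine) auto
    also have "(\<lambda>s. ennreal (?w n (0 + ?m * s) * (cmod (fourier u (0 + ?m * s)))\<^sup>2)) =
      (\<lambda>s. ennreal (sqrt (2 * pi)) * ennreal (F s))"
      by (intro ext) (simp add: F_def normal_density_def ennreal_mult[symmetric] del: of_nat_Suc)
    also have "ennreal \<bar>?m\<bar> * (\<integral>\<^sup>+s. ennreal (sqrt (2 * pi)) * ennreal (F s) \<partial>lborel) =
        ennreal (sqrt (2 * pi) * ?m * (LINT s|lborel. F s))"
      using Fint Fpos
      by (simp add: nn_integral_cmult nn_integral_multc F ennreal_mult mult_ac del: of_nat_Suc)
    also have "sqrt (2 * pi) * ?m * (LINT s|lborel. F s) = I n"
      unfolding F_def I_def N_def D_def by (rule gaussian_average_fourier_L2[OF u1 u2]) simp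
    finally show ?thesis .
  qed
  moreover have "I \<longlonglongrightarrow> (LINT s|lborel. ?\<phi> s * N)"
    unfolding I_def
  proof (rule integral_dominated_convergence[where w="\<lambda>s. ?\<phi> s * N"])
    show "AE s in lborel. (\<lambda>n. ?\<phi> s * (N - D (s / (2 * pi * real (Suc n))) / 2)) \<longlonglongrightarrow> ?\<phi> s * N"
    proof (rule AE_I2)
      fix s
      have "(\<lambda>n. (s / (2 * pi)) / real (Suc n)) \<longlonglongrightarrow> 0"
        by (rule LIMSEQ_Suc) (rule lim_const_over_n)
      then have "(\<lambda>n. s / (2 * pi * real (Suc n))) \<longlonglongrightarrow> 0" by simp
      then have "(\<lambda>n. D (s / (2 * pi * real (Suc n)))) \<longlonglongrightarrow> 0"
        unfolding D_def by (rule L2_shift_tendsto[OF u2])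
      then have "(\<lambda>n. ?\<phi> s * (N - D (s / (2 * pi * real (Suc n))) / 2)) \<longlonglongrightarrow> ?\<phi> s * (N - 0 / 2)"
        by (intro tendsto_intros) auto
      then show "(\<lambda>n. ?\<phi> s * (N - D (s / (2 * pi * real (Suc n))) / 2)) \<longlonglongrightarrow> ?\<phi> s * N" by simp
    qed
    \<comment> \<open>Since 0 \<le> D t \<le> 4 N, the bracket stays between -N and N, which gives
      the dominating function.\<close>
    have "\<bar>N - D t / 2\<bar> \<le> N" for t
      using L2_shift_diff_le[OF u2, of t] by (auto simp: N_def D_def abs_le_iff)
    then show "AE s in lborel. norm (?\<phi> s * (N - D (s / (2 * pi * real (Suc n))) / 2)) \<le> ?\<phi> s * N" for n
      by (auto simp: abs_mult intro!: mult_left_mono)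
  qed auto
  then have "I \<longlonglongrightarrow> N" by simp
  ultimately show "(\<lambda>n. \<integral>\<^sup>+\<xi>. ennreal (?w n \<xi> * (cmod (fourier u \<xi>))\<^sup>2) \<partial>lborel) \<longlonglongrightarrow>
      (\<integral>\<^sup>+x. ennreal ((cmod (u x))\<^sup>2) \<partial>lborel)"
    by (simp add: L2_nn_integral[OF u2] N_def tendsto_ennrealI)
qed

section \<open>The short-time Fourier transform and Moyal's identity\<close>

definition gabor_atom :: "(real \<Rightarrow> complex) \<Rightarrow> real \<Rightarrow> real \<Rightarrow> real \<Rightarrow> complex" where
  "gabor_atom h y \<xi> = (\<lambda>x. cis (2 * pi * \<xi> * (x - y)) * h (x - y))"

text \<open>This is the usual short-time Fourier transform times the phase e^(2 pi i \<xi> y),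
  because \<open>gabor_shift\<close> modulates before it translates.\<close>

definition stft :: "(real \<Rightarrow> complex) \<Rightarrow> (real \<Rightarrow> complex) \<Rightarrow> real \<Rightarrow> real \<Rightarrow> complex" where
  "stft h g y \<xi> = L2_inner g (gabor_atom h y \<xi>)"

lemma gabor_atom_L2: "h \<in> L2 \<Longrightarrow> gabor_atom h y \<xi> \<in> L2"
  unfolding gabor_atom_def by (intro L2_mult_cis L2_shift) auto

lemma stft_measurable [measurable]:
  assumes [measurable]: "h \<in> borel_measurable borel" "g \<in> borel_measurable borel"
    and [measurable]: "p \<in> borel_measurable M" "q \<in> borel_measurable M"
  shows "(\<lambda>z. stft h g (p z) (q z)) \<in> borel_measurable M"
  unfolding stft_def L2_inner_def gabor_atom_def by measurable

lemma stft_eq_fourier: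
  "stft h g y \<xi> = cis (2 * pi * \<xi> * y) * fourier (\<lambda>x. g x * cnj (h (x - y))) \<xi>"
proof -
  have "g x * cnj (gabor_atom h y \<xi> x) =
      cis (2 * pi * \<xi> * y) * (g x * cnj (h (x - y)) * cis (- (2 * pi * \<xi> * x)))" for x
  proof -
    have "cnj (cis (2 * pi * \<xi> * (x - y))) = cis (2 * pi * \<xi> * y) * cis (- (2 * pi * \<xi> * x))"
      by (simp add: cis_cnj cis_mult algebra_simps)
    then show ?thesis by (simp add: gabor_atom_def)
  qed
  then show ?thesis
    unfolding stft_def L2_inner_def fourier_def by (simp only: integral_mult_right_zero)
qed

lemma L2_mult_bounded:
  assumes "u \<in> L2" and [measurable]: "v \<in> borel_measurable borel" and v: "\<And>x. cmod (v x) \<le> B"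
  shows "(\<lambda>x. u x * v x) \<in> L2"
proof -
  have [measurable]: "u \<in> borel_measurable borel" using assms(1) by measurable
  have "integrable lborel (\<lambda>x. (cmod (u x * v x))\<^sup>2)"
  proof (rule Bochner_Integration.integrable_bound)
    show "integrable lborel (\<lambda>x. (cmod (u x))\<^sup>2 * B\<^sup>2)" using L2_integrable[OF assms(1)] by simp
    show "AE x in lborel. norm ((cmod (u x * v x))\<^sup>2) \<le> norm ((cmod (u x))\<^sup>2 * B\<^sup>2)"
      using v by (auto simp: norm_mult power_mult_distrib intro!: mult_left_mono power_mono)
  qed simp
  then show ?thesis by (simp add: L2_def)
qed

lemma L2_add:
  assumes "u \<in> L2" "v \<in> L2"
  shows "(\<lambda>x. u x + v x) \<in> L2"
proof -
  have "(\<lambda>x. - v x) \<in> L2" using assms(2) by (simp add: L2_def)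
  from L2_diff_integrable[OF assms(1) this] show ?thesis
    using assms[THEN L2_measurable] by (simp add: L2_def)
qed

lemma L2_sum: "(\<And>i. i \<in> I \<Longrightarrow> u i \<in> L2) \<Longrightarrow> (\<lambda>x. \<Sum>i\<in>I. u i x) \<in> L2"
proof (induction I rule: infinite_finite_induct)
  case (insert i I)
  then show ?case by (auto intro: L2_add)
qed (auto simp: L2_def)

text \<open>For fixed y the sum is, up to a phase, the Fourier transform of \<open>u y\<close>. This
  function is integrable as a sum of products of L2 functions, and square integrable because the
  windows are bounded, so Plancherel applies in \<xi>. Tonelli and the reflection y to x - y then
  separate the variables of g and h.\<close>

lemma moyal:
  assumes g: "\<And>i. i \<in> I \<Longrightarrow> g i \<in> L2" and h: "\<And>i. i \<in> I \<Longrightarrow> h i \<in> L2"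
    and bd: "\<And>i x. i \<in> I \<Longrightarrow> cmod (h i x) \<le> B i"
  shows "(\<integral>\<^sup>+y. \<integral>\<^sup>+\<xi>. ennreal ((cmod (\<Sum>i\<in>I. stft (h i) (g i) y \<xi>))\<^sup>2) \<partial>lborel \<partial>lborel) =
    (\<integral>\<^sup>+x. \<integral>\<^sup>+y. ennreal ((cmod (\<Sum>i\<in>I. g i x * cnj (h i y)))\<^sup>2) \<partial>lborel \<partial>lborel)"
proof -
  have [measurable]: "g i \<in> borel_measurable borel" "h i \<in> borel_measurable borel" if "i \<in> I" for i
    using g[OF that] h[OF that] by measurable
  define u where "u y x = (\<Sum>i\<in>I. g i x * cnj (h i (x - y)))" for y x
  have u1: "integrable lborel (u y)" for y
    unfolding u_def by (intro Bochner_Integration.integrable_sum L2_mult_integrable g h L2_cnj L2_shift)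
  have u2: "u y \<in> L2" for y
    unfolding u_def
    by (intro L2_sum L2_mult_bounded) (auto simp: g intro: bd)
  have "(\<Sum>i\<in>I. stft (h i) (g i) y \<xi>) = cis (2 * pi * \<xi> * y) * fourier (u y) \<xi>" for y \<xi>
    unfolding stft_eq_fourier sum_distrib_left[symmetric] fourier_def u_def sum_distrib_right
    by (subst Bochner_Integration.integral_sum)
      (auto intro!: integrable_mult_cis[OF L2_mult_integrable[OF g L2_cnj[OF L2_shift[OF h]]]])
  then have "(\<integral>\<^sup>+\<xi>. ennreal ((cmod (\<Sum>i\<in>I. stft (h i) (g i) y \<xi>))\<^sup>2) \<partial>lborel) =
      (\<integral>\<^sup>+x. ennreal ((cmod (u y x))\<^sup>2) \<partial>lborel)" for y
    by (simp add: norm_mult plancherel[OF u1 u2])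
  then have "(\<integral>\<^sup>+y. \<integral>\<^sup>+\<xi>. ennreal ((cmod (\<Sum>i\<in>I. stft (h i) (g i) y \<xi>))\<^sup>2) \<partial>lborel \<partial>lborel) =
      (\<integral>\<^sup>+y. \<integral>\<^sup>+x. ennreal ((cmod (u y x))\<^sup>2) \<partial>lborel \<partial>lborel)" by simp
  also have "\<dots> = (\<integral>\<^sup>+x. \<integral>\<^sup>+y. ennreal ((cmod (u y x))\<^sup>2) \<partial>lborel \<partial>lborel)"
    unfolding u_def by (rule lborel_pair.Fubini') measurable
  also have "\<dots> = (\<integral>\<^sup>+x. \<integral>\<^sup>+y. ennreal ((cmod (\<Sum>i\<in>I. g i x * cnj (h i y)))\<^sup>2) \<partial>lborel \<partial>lborel)"
  proof (rule nn_integral_cong)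
    fix x
    have "(\<lambda>y. ennreal ((cmod (\<Sum>i\<in>I. g i x * cnj (h i y)))\<^sup>2)) \<in> borel_measurable borel"
      by measurable
    from nn_integral_real_affine[OF this, of "-1" x]
    show "(\<integral>\<^sup>+y. ennreal ((cmod (u y x))\<^sup>2) \<partial>lborel) =
        (\<integral>\<^sup>+y. ennreal ((cmod (\<Sum>i\<in>I. g i x * cnj (h i y)))\<^sup>2) \<partial>lborel)"
      by (simp add: u_def)
  qed
  finally show ?thesis .
qed

text \<open>For each x the inner integral of \<open>moyal\<close> is the squared norm of a linear
  combination of the orthonormal functions \<open>cnj (h i y)\<close> with coefficients
  \<open>g i x\<close>, so Pythagoras' theorem evaluates it.\<close>

lemma moyal_orthonormal:
  assumes fin: "finite I" and g: "\<And>i. i \<in> I \<Longrightarrow> g i \<in> L2" and h: "\<And>i. i \<in> I \<Longrightarrow> h i \<in> L2"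
    and bd: "\<And>i x. i \<in> I \<Longrightarrow> cmod (h i x) \<le> B i"
    and orth: "\<And>i j. i \<in> I \<Longrightarrow> j \<in> I \<Longrightarrow> L2_inner (h i) (h j) = (if i = j then 1 else 0)"
  shows "(\<integral>\<^sup>+y. \<integral>\<^sup>+\<xi>. ennreal ((cmod (\<Sum>i\<in>I. stft (h i) (g i) y \<xi>))\<^sup>2) \<partial>lborel \<partial>lborel) =
    ennreal (\<Sum>i\<in>I. LINT x|lborel. (cmod (g i x))\<^sup>2)"
proof -
  have inner: "(\<integral>\<^sup>+y. ennreal ((cmod (\<Sum>i\<in>I. v i * cnj (h i y)))\<^sup>2) \<partial>lborel) = ennreal (\<Sum>i\<in>I. (cmod (v i))\<^sup>2)"
    for v
  proof -
    have "(\<lambda>y. \<Sum>i\<in>I. v i * cnj (h i y)) \<in> L2"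
    proof (rule L2_sum)
      fix i assume "i \<in> I"
      then have "(\<lambda>y. cnj (h i y) * v i) \<in> L2"
        by (intro L2_mult_bounded[where B="cmod (v i)"] L2_cnj h) auto
      then show "(\<lambda>y. v i * cnj (h i y)) \<in> L2" by (simp add: mult.commute)
    qed
    then have eq: "(\<integral>\<^sup>+y. ennreal ((cmod (\<Sum>i\<in>I. v i * cnj (h i y)))\<^sup>2) \<partial>lborel) =
        ennreal (LINT y|lborel. (cmod (\<Sum>i\<in>I. v i * cnj (h i y)))\<^sup>2)"
      by (rule L2_nn_integral)
    have "complex_of_real (LINT y|lborel. (cmod (\<Sum>i\<in>I. v i * cnj (h i y)))\<^sup>2) =
        (LINT y|lborel. (\<Sum>i\<in>I. \<Sum>j\<in>I. v i * cnj (v j) * (h j y * cnj (h i y))))"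
      unfolding integral_complex_of_real[symmetric] complex_norm_square
      by (intro Bochner_Integration.integral_cong) (simp_all add: sum_product mult_ac)
    also have "\<dots> = (\<Sum>i\<in>I. \<Sum>j\<in>I. v i * cnj (v j) * L2_inner (h j) (h i))"
    proof -
      have int: "integrable lborel (\<lambda>y. v i * cnj (v j) * (h j y * cnj (h i y)))" if "i \<in> I" "j \<in> I" for i j
        by (intro integrable_mult_right L2_mult_integrable h L2_cnj that)
      then have "(LINT y|lborel. (\<Sum>i\<in>I. \<Sum>j\<in>I. v i * cnj (v j) * (h j y * cnj (h i y)))) =
          (\<Sum>i\<in>I. LINT y|lborel. (\<Sum>j\<in>I. v i * cnj (v j) * (h j y * cnj (h i y))))"
        by (intro Bochner_Integration.integral_sum Bochner_Integration.integrable_sum) auto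
      also have "\<dots> = (\<Sum>i\<in>I. \<Sum>j\<in>I. LINT y|lborel. v i * cnj (v j) * (h j y * cnj (h i y)))"
        by (intro sum.cong refl Bochner_Integration.integral_sum int) auto
      finally show ?thesis
        unfolding L2_inner_def by simp
    qed
    also have "\<dots> = (\<Sum>i\<in>I. v i * cnj (v i))"
      by (rule sum.cong) (auto simp: orth fin if_distrib[of "\<lambda>x. _ * x"] cong: if_cong)
    also have "\<dots> = complex_of_real (\<Sum>i\<in>I. (cmod (v i))\<^sup>2)"
      by (simp only: of_real_sum complex_norm_square)
    finally show ?thesis unfolding eq of_real_eq_iff by simp
  qed
  have "(\<integral>\<^sup>+y. \<integral>\<^sup>+\<xi>. ennreal ((cmod (\<Sum>i\<in>I. stft (h i) (g i) y \<xi>))\<^sup>2) \<partial>lborel \<partial>lborel) =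
      (\<integral>\<^sup>+x. ennreal (\<Sum>i\<in>I. (cmod (g i x))\<^sup>2) \<partial>lborel)"
    using moyal[of I g h B] g h bd by (simp add: inner)
  also have "\<dots> = ennreal (LINT x|lborel. (\<Sum>i\<in>I. (cmod (g i x))\<^sup>2))"
    by (intro nn_integral_eq_integral Bochner_Integration.integrable_sum L2_integrable g AE_I2 sum_nonneg)
      auto
  also have "(LINT x|lborel. (\<Sum>i\<in>I. (cmod (g i x))\<^sup>2)) = (\<Sum>i\<in>I. LINT x|lborel. (cmod (g i x))\<^sup>2)"
    by (intro Bochner_Integration.integral_sum L2_integrable g)
  finally show ?thesis .
qed

text \<open>This version is for the windows produced by differentiation: they are neither normalized
  nor mutually orthogonal, so each is treated alone and its squared norm becomes the
  constant.\<close>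

lemma moyal_scalar:
  assumes g: "g \<in> L2" and h: "h \<in> L2" and bd: "\<And>x. cmod (h x) \<le> B"
  shows "(\<integral>\<^sup>+y. \<integral>\<^sup>+\<xi>. ennreal ((cmod (stft h g y \<xi>))\<^sup>2) \<partial>lborel \<partial>lborel) =
    ennreal ((LINT x|lborel. (cmod (h x))\<^sup>2) * (LINT x|lborel. (cmod (g x))\<^sup>2))"
proof -
  have [measurable]: "g \<in> borel_measurable borel" "h \<in> borel_measurable borel"
    using g h by measurable
  have "(\<integral>\<^sup>+y. \<integral>\<^sup>+\<xi>. ennreal ((cmod (stft h g y \<xi>))\<^sup>2) \<partial>lborel \<partial>lborel) =
      (\<integral>\<^sup>+x. \<integral>\<^sup>+y. ennreal ((cmod (g x * cnj (h y)))\<^sup>2) \<partial>lborel \<partial>lborel)"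
    using moyal[of "{()}" "\<lambda>_. g" "\<lambda>_. h" "\<lambda>_. B"] g h bd by simp
  also have "\<dots> = (\<integral>\<^sup>+x. ennreal ((cmod (g x))\<^sup>2) \<partial>lborel) * (\<integral>\<^sup>+y. ennreal ((cmod (h y))\<^sup>2) \<partial>lborel)"
    by (simp add: norm_mult power_mult_distrib ennreal_mult nn_integral_cmult nn_integral_multc)
  finally show ?thesis
    by (simp add: L2_nn_integral g h ennreal_mult mult.commute)
qed

section \<open>Schwartz windows and their stability under differentiation and multiplication by
  x\<close>

definition vderiv :: "(real \<Rightarrow> complex) \<Rightarrow> real \<Rightarrow> complex" where
  "vderiv h = (\<lambda>x. vector_derivative h (at x))"

definition xmul :: "(real \<Rightarrow> complex) \<Rightarrow> real \<Rightarrow> complex" where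
  "xmul h = (\<lambda>x. x *\<^sub>R h x)"

lemma higher_vderiv_0 [simp]: "higher_vderiv 0 f = f"
  by (simp add: higher_vderiv_def)

lemma higher_vderiv_Suc: "higher_vderiv (Suc n) f = vderiv (higher_vderiv n f)"
  by (simp add: higher_vderiv_def vderiv_def)

lemma higher_vderiv_vderiv: "higher_vderiv n (vderiv f) = higher_vderiv (Suc n) f"
  by (induction n) (simp_all add: higher_vderiv_Suc)

lemma schwartz_vderiv: "h \<in> schwartz \<Longrightarrow> vderiv h \<in> schwartz"
  unfolding schwartz_def by (simp add: higher_vderiv_vderiv)

lemma schwartz_higher_deriv:
  assumes "h \<in> schwartz"
  shows "(higher_vderiv n h has_vector_derivative higher_vderiv (Suc n) h x) (at x)"
  using assms by (auto simp: schwartz_def higher_vderiv_Suc vderiv_def vector_derivative_works)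

lemma schwartz_deriv:
  "h \<in> schwartz \<Longrightarrow> (h has_vector_derivative vderiv h x) (at x)"
  using schwartz_higher_deriv[of h 0 x] by (simp add: higher_vderiv_Suc)

text \<open>Leibniz' rule for a linear factor, whose higher derivatives vanish. At n = 0 the
  truncated \<open>n - 1\<close> is harmless because its coefficient is 0.\<close>

lemma higher_vderiv_xmul:
  assumes "h \<in> schwartz"
  shows "higher_vderiv n (xmul h) = (\<lambda>x. x *\<^sub>R higher_vderiv n h x + of_nat n * higher_vderiv (n - 1) h x)"
proof (induction n)
  case (Suc n)
  have "((\<lambda>x. x *\<^sub>R higher_vderiv n h x + of_nat n * higher_vderiv (n - 1) h x) has_vector_derivative
      (x *\<^sub>R higher_vderiv (Suc n) h x + of_nat (Suc n) * higher_vderiv n h x)) (at x)" for x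
  proof (cases n)
    case 0
    then show ?thesis
      using schwartz_higher_deriv[OF assms, of 0 x] by (auto intro!: derivative_eq_intros simp: algebra_simps)
  next
    case (Suc k)
    then show ?thesis
      using schwartz_higher_deriv[OF assms, of n x] schwartz_higher_deriv[OF assms, of k x]
      by (auto intro!: derivative_eq_intros simp: algebra_simps)
  qed
  then show ?case
    unfolding higher_vderiv_Suc[of n "xmul h"] Suc vderiv_def
    by (intro ext) (simp add: vector_derivative_at)
qed (simp add: xmul_def)

lemma schwartz_xmul:
  assumes h: "h \<in> schwartz"
  shows "xmul h \<in> schwartz"
proof -
  have "higher_vderiv n (xmul h) differentiable (at x)" for n x
    unfolding higher_vderiv_xmul[OF h]
    using h by (auto simp: schwartz_def intro!: derivative_intros)
  moreover have "bounded (range (\<lambda>x. x ^ m *\<^sub>R higher_vderiv n (xmul h) x))" for m n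
  proof -
    have "bounded (range (\<lambda>x. x ^ Suc m *\<^sub>R higher_vderiv n h x))"
        "bounded (range (\<lambda>x. x ^ m *\<^sub>R higher_vderiv (n - 1) h x))"
      using h unfolding schwartz_def by blast+
    then obtain B B' where B: "\<And>x. norm (x ^ Suc m *\<^sub>R higher_vderiv n h x) \<le> B"
        "\<And>x. norm (x ^ m *\<^sub>R higher_vderiv (n - 1) h x) \<le> B'"
      unfolding bounded_iff by auto
    have "norm (x ^ m *\<^sub>R higher_vderiv n (xmul h) x) \<le> B + real n * B'" for x
    proof -
      have "x ^ m *\<^sub>R higher_vderiv n (xmul h) x =
          x ^ Suc m *\<^sub>R higher_vderiv n h x + real n *\<^sub>R (x ^ m *\<^sub>R higher_vderiv (n - 1) h x)"
        unfolding higher_vderiv_xmul[OF h] by (simp add: algebra_simps scaleR_conv_of_real)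
      also have "norm \<dots> \<le> B + real n * B'"
        by (rule norm_triangle_mono[OF B(1)]) (use mult_left_mono[OF B(2)[of x], of "real n"] in \<open>simp add: abs_mult mult.assoc\<close>)
      finally show ?thesis .
    qed
    then show ?thesis unfolding bounded_iff by auto
  qed
  ultimately show ?thesis unfolding schwartz_def by blast
qed

lemma schwartz_continuous: "h \<in> schwartz \<Longrightarrow> continuous_on UNIV h"
  by (meson schwartz_deriv continuous_at_imp_continuous_on has_vector_derivative_continuous)

lemma schwartz_measurable [measurable_dest]: "h \<in> schwartz \<Longrightarrow> h \<in> borel_measurable borel"
  by (intro borel_measurable_continuous_onI schwartz_continuous)

lemma schwartz_bounded:
  assumes "h \<in> schwartz"
  obtains B where "\<And>x. cmod (h x) \<le> B"
proof -
  have "bounded (range (\<lambda>x. x ^ 0 *\<^sub>R higher_vderiv 0 h x))"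
    using assms unfolding schwartz_def by blast
  then show thesis using that unfolding bounded_iff by auto
qed

lemma integrable_inverse_1_plus_square_UNIV: "integrable lborel (\<lambda>x::real. inverse (1 + x\<^sup>2))"
  using integrable_inverse_1_plus_square by (simp add: set_integrable_def)

text \<open>Boundedness of h and of x h gives |h|^2 (1 + x^2) \<le> B^2 + B'^2, and 1 / (1 + x^2) is
  integrable.\<close>

lemma schwartz_L2:
  assumes h: "h \<in> schwartz"
  shows "h \<in> L2"
proof -
  obtain B where B: "\<And>x. cmod (h x) \<le> B" using schwartz_bounded[OF h] by blast
  obtain B' where B': "\<And>x. cmod (xmul h x) \<le> B'" using schwartz_bounded[OF schwartz_xmul[OF h]] by blast
  have "integrable lborel (\<lambda>x. (cmod (h x))\<^sup>2)"
  proof (rule Bochner_Integration.integrable_bound)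
    show "integrable lborel (\<lambda>x. (B\<^sup>2 + B'\<^sup>2) * inverse (1 + x\<^sup>2))"
      by (intro integrable_mult_right integrable_inverse_1_plus_square_UNIV)
    have "(cmod (h x))\<^sup>2 \<le> (B\<^sup>2 + B'\<^sup>2) * inverse (1 + x\<^sup>2)" for x
    proof -
      have "(cmod (h x))\<^sup>2 \<le> B\<^sup>2" "(cmod (xmul h x))\<^sup>2 \<le> B'\<^sup>2"
        using B B' by (auto intro: power_mono)
      then have "(cmod (h x))\<^sup>2 * (1 + x\<^sup>2) \<le> B\<^sup>2 + B'\<^sup>2"
        by (simp add: xmul_def power_mult_distrib algebra_simps)
      then show ?thesis
        by (simp add: divide_inverse[symmetric] pos_le_divide_eq add_pos_nonneg)
    qed
    then show "AE x in lborel. norm ((cmod (h x))\<^sup>2) \<le> norm ((B\<^sup>2 + B'\<^sup>2) * inverse (1 + x\<^sup>2))"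
      by (intro AE_I2) (metis abs_ge_self norm_ge_zero order_trans real_norm_def abs_of_nonneg zero_le_power2)
  qed (use h in measurable)
  then show ?thesis using schwartz_measurable[OF h] by (simp add: L2_def)
qed

section \<open>Local oscillation of the short-time Fourier transform\<close>

text \<open>The interval is half-open so that its integer translates tile the line; it has length 1,
  so integrals over \<open>cell\<close> are means and constants integrate to themselves.\<close>

definition cell :: "real measure" where
  "cell = density lborel (indicator {-1/2..<1/2})"

lemma sets_cell [measurable_cong, simp]: "sets cell = sets borel"
  by (simp add: cell_def)

lemma space_cell [simp]: "space cell = UNIV"
  by (simp add: cell_def)

lemma nn_integral_cell:
  "f \<in> borel_measurable borel \<Longrightarrow>
    (\<integral>\<^sup>+x. f x \<partial>cell) = (\<integral>\<^sup>+x. indicator {-1/2..<1/2} x * f x \<partial>lborel)"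
  unfolding cell_def by (rule nn_integral_density) auto

interpretation cell: prob_space cell
proof (rule prob_spaceI)
  have "emeasure cell (space cell) = (\<integral>\<^sup>+x. indicator {-1/2..<1/2::real} x * indicator UNIV x \<partial>lborel)"
    unfolding cell_def by (subst emeasure_density) auto
  then show "emeasure cell (space cell) = 1" by simp
qed

interpretation cell_pair: pair_sigma_finite cell cell ..

lemma emeasure_cell_UNIV [simp]: "emeasure cell UNIV = 1"
  using cell.emeasure_space_1 by simp

lemma AE_cell: "AE s in cell. s \<in> {-1/2..<1/2}"
  unfolding cell_def by (subst AE_density) (auto simp: indicator_def)

lemma nn_integral_cell_mono:
  "(\<And>s. \<bar>s\<bar> \<le> 1/2 \<Longrightarrow> f s \<le> g s) \<Longrightarrow> (\<integral>\<^sup>+s. f s \<partial>cell) \<le> (\<integral>\<^sup>+s. g s \<partial>cell)"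
  by (rule nn_integral_mono_AE) (use AE_cell in eventually_elim, auto)

lemma nn_integral_cell_power2_le:
  assumes [measurable]: "f \<in> borel_measurable borel"
  shows "(\<integral>\<^sup>+s. f s \<partial>cell)\<^sup>2 \<le> (\<integral>\<^sup>+s. (f s)\<^sup>2 \<partial>cell)"
  using Cauchy_Schwarz_nn_integral[of f cell "\<lambda>_. 1"] by simp

text \<open>If |a|, |b| \<le> L and the frequency is at most 1 in modulus, then L times this
  quantity majorizes the derivative of \<open>stft h g\<close> in direction (a, b). The three terms
  belong to the \<xi>-derivative, the phase part of the y-derivative and the window part of the
  y-derivative.\<close>

definition stft_grad :: "(real \<Rightarrow> complex) \<Rightarrow> (real \<Rightarrow> complex) \<Rightarrow> real \<Rightarrow> real \<Rightarrow> real" where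
  "stft_grad h g y \<xi> = 2 * pi * cmod (stft (xmul h) g y \<xi>) + 2 * pi * cmod (stft h g y \<xi>) +
     cmod (stft (vderiv h) g y \<xi>)"

lemma stft_grad_nonneg [simp]: "stft_grad h g y \<xi> \<ge> 0"
  by (simp add: stft_grad_def)

text \<open>The phase is measured from y, so the \<xi>-derivative brings down x - y, which is
  absorbed into the window \<open>xmul h\<close>, while the y-derivative brings down the frequency
  itself. That coefficient is bounded only near frequency 0.\<close>

lemma gabor_atom_has_vector_derivative:
  assumes h: "h \<in> schwartz"
  shows "((\<lambda>s. gabor_atom h (y + s * a) (\<xi> + s * b) x) has_vector_derivative
     (\<i> * of_real (2 * pi * b) * gabor_atom (xmul h) (y + s * a) (\<xi> + s * b) x
      - \<i> * of_real (2 * pi * a * (\<xi> + s * b)) * gabor_atom h (y + s * a) (\<xi> + s * b) x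
      - of_real a * gabor_atom (vderiv h) (y + s * a) (\<xi> + s * b) x)) (at s within X)"
proof -
  let ?z = "x - (y + s * a)"
  have 1: "((\<lambda>s. h (x - (y + s * a))) has_vector_derivative (- a) *\<^sub>R vderiv h ?z) (at s within X)"
  proof -
    have "((\<lambda>s. x - (y + s * a)) has_vector_derivative - a) (at s within X)"
      by (auto intro!: derivative_eq_intros)
    from vector_diff_chain_within[OF this has_vector_derivative_at_within[OF schwartz_deriv[OF h]]]
    show ?thesis by (simp add: o_def)
  qed
  have 2: "((\<lambda>s. cis (2 * pi * (\<xi> + s * b) * (x - (y + s * a)))) has_vector_derivative
      (2 * pi * (b * ?z - (\<xi> + s * b) * a)) *\<^sub>R (\<i> * cis (2 * pi * (\<xi> + s * b) * ?z))) (at s within X)"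
  proof -
    have "((\<lambda>s. 2 * pi * (\<xi> + s * b) * (x - (y + s * a))) has_vector_derivative
        2 * pi * (b * ?z - (\<xi> + s * b) * a)) (at s within X)"
      by (auto intro!: derivative_eq_intros simp: has_real_derivative_iff_has_vector_derivative[symmetric] algebra_simps)
    from vector_diff_chain_within[OF this has_vector_derivative_iexp]
    show ?thesis by (simp add: o_def cis_conv_exp)
  qed
  show ?thesis
    unfolding gabor_atom_def
    by (rule has_vector_derivative_eq_rhs[OF has_vector_derivative_mult[OF 2 1]])
      (simp add: xmul_def scaleR_conv_of_real algebra_simps)
qed

lemma L2_inner_linear_combination:
  assumes "g \<in> L2" "u \<in> L2" "v \<in> L2" "w \<in> L2"
  shows "L2_inner g (\<lambda>x. \<alpha> * u x - \<beta> * v x - \<delta> * w x) =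
    cnj \<alpha> * L2_inner g u - cnj \<beta> * L2_inner g v - cnj \<delta> * L2_inner g w"
proof -
  have i: "integrable lborel (\<lambda>x. g x * cnj (u x))" "integrable lborel (\<lambda>x. g x * cnj (v x))"
    "integrable lborel (\<lambda>x. g x * cnj (w x))"
    using assms by (auto intro!: L2_mult_integrable L2_cnj)
  have "L2_inner g (\<lambda>x. \<alpha> * u x - \<beta> * v x - \<delta> * w x) =
    (LINT x|lborel. cnj \<alpha> * (g x * cnj (u x)) - cnj \<beta> * (g x * cnj (v x)) - cnj \<delta> * (g x * cnj (w x)))"
    unfolding L2_inner_def by (intro Bochner_Integration.integral_cong) (auto simp: algebra_simps)
  then show ?thesis
    using i by (simp add: L2_inner_def)
qed

lemma L2_inner_diff:
  assumes "g \<in> L2" "u \<in> L2" "v \<in> L2"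
  shows "L2_inner g (\<lambda>x. u x - v x) = L2_inner g u - L2_inner g v"
  using L2_inner_linear_combination[OF assms assms(3), of 1 1 0] by simp

text \<open>
  The increment is written as an integral of the derivative of the atom and Fubini's theorem is
  applied, so that no differentiation under the integral sign is needed.
\<close>

lemma stft_increment_le_aux:
  assumes h: "h \<in> schwartz" and g: "g \<in> L2" and ab: "\<bar>a\<bar> \<le> L" "\<bar>b\<bar> \<le> L"
    and \<xi>: "\<And>s. \<bar>s\<bar> \<le> 1/2 \<Longrightarrow> \<bar>\<xi> + s * b\<bar> \<le> 1" and rt: "-1/2 \<le> r" "r \<le> t" "t \<le> 1/2"
  shows "ennreal (cmod (stft h g (y + t * a) (\<xi> + t * b) - stft h g (y + r * a) (\<xi> + r * b))) \<le>
    ennreal L * (\<integral>\<^sup>+s. ennreal (stft_grad h g (y + s * a) (\<xi> + s * b)) \<partial>cell)"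
proof -
  note schw = h schwartz_xmul[OF h] schwartz_vderiv[OF h]
  note [measurable] = schw[THEN schwartz_measurable] L2_measurable[OF g]
  note l2 = schw[THEN schwartz_L2]
  have L: "L \<ge> 0" using ab by linarith
  have in_range: "\<bar>\<xi> + s * b\<bar> \<le> 1" if "s \<in> {r..t}" for s
    using that rt by (intro \<xi>) auto
  let ?d = "\<lambda>s x. \<i> * of_real (2 * pi * b) * gabor_atom (xmul h) (y + s * a) (\<xi> + s * b) x
      - \<i> * of_real (2 * pi * a * (\<xi> + s * b)) * gabor_atom h (y + s * a) (\<xi> + s * b) x
      - of_real a * gabor_atom (vderiv h) (y + s * a) (\<xi> + s * b) x"
  \<comment> \<open>A window that dominates the derivative of the atom for all s at once, up to
    translation and the factor L; it provides the absolute integrability that Fubini needs.\<close>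
  define q where "q x = 2 * pi * cmod (xmul h x) + 2 * pi * cmod (h x) + cmod (vderiv h x)" for x
  have q0: "q x \<ge> 0" for x by (simp add: q_def)
  have [measurable]: "q \<in> borel_measurable borel" unfolding q_def by measurable
  have coef: "\<bar>2 * pi * b\<bar> \<le> L * (2 * pi)" "\<bar>a\<bar> \<le> L" using ab by (simp_all add: abs_mult mult.commute)
  have coef': "\<bar>2 * pi * a * (\<xi> + s * b)\<bar> \<le> L * (2 * pi)" if "s \<in> {r..t}" for s
  proof -
    have "\<bar>a\<bar> * \<bar>\<xi> + s * b\<bar> \<le> L * 1"
      using ab in_range[OF that] L by (intro mult_mono) auto
    then have "\<bar>a\<bar> * \<bar>\<xi> + s * b\<bar> * (2 * pi) \<le> L * 1 * (2 * pi)"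
      by (rule mult_right_mono) simp
    moreover have "\<bar>2 * pi * a * (\<xi> + s * b)\<bar> = \<bar>a\<bar> * \<bar>\<xi> + s * b\<bar> * (2 * pi)"
      unfolding abs_mult by simp
    ultimately show ?thesis by simp
  qed
  \<comment> \<open>One estimate in two versions: \<open>comb\<close> for the derivative of the atom
    at a point, \<open>comb'\<close> for its scalar product with g, where the coefficients appear
    conjugated.\<close>
  have comb: "cmod (\<i> * of_real (2 * pi * b) * z1 - \<i> * of_real (2 * pi * a * (\<xi> + s * b)) * z2 - of_real a * z3) \<le>
      L * (2 * pi * cmod z1 + 2 * pi * cmod z2 + cmod z3)"
    and comb': "cmod (cnj (\<i> * of_real (2 * pi * b)) * z1 - cnj (\<i> * of_real (2 * pi * a * (\<xi> + s * b))) * z2 - cnj (of_real a) * z3) \<le>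
      L * (2 * pi * cmod z1 + 2 * pi * cmod z2 + cmod z3)"
    if s: "s \<in> {r..t}" for s z1 z2 z3
  proof -
    have *: "cmod (w1 - w2 - w3) \<le> L * (2 * pi * cmod z1 + 2 * pi * cmod z2 + cmod z3)"
      if "cmod w1 = \<bar>2 * pi * b\<bar> * cmod z1" "cmod w2 = \<bar>2 * pi * a * (\<xi> + s * b)\<bar> * cmod z2"
        "cmod w3 = \<bar>a\<bar> * cmod z3" for w1 w2 w3
    proof -
      have "cmod (w1 - w2 - w3) \<le> cmod w1 + cmod w2 + cmod w3"
        by (meson norm_triangle_ineq4 norm_triangle_le_diff add_mono order_refl order_trans)
      also have "\<dots> \<le> L * (2 * pi) * cmod z1 + L * (2 * pi) * cmod z2 + L * cmod z3"
        unfolding that by (intro add_mono mult_right_mono coef coef' s) auto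
      finally show ?thesis by (simp add: algebra_simps)
    qed
    show "cmod (\<i> * of_real (2 * pi * b) * z1 - \<i> * of_real (2 * pi * a * (\<xi> + s * b)) * z2 - of_real a * z3) \<le>
      L * (2 * pi * cmod z1 + 2 * pi * cmod z2 + cmod z3)"
      by (rule *) (simp_all only: norm_mult norm_ii norm_of_real mult_1_left)
    show "cmod (cnj (\<i> * of_real (2 * pi * b)) * z1 - cnj (\<i> * of_real (2 * pi * a * (\<xi> + s * b))) * z2 - cnj (of_real a) * z3) \<le>
      L * (2 * pi * cmod z1 + 2 * pi * cmod z2 + cmod z3)"
      by (rule *) (simp_all only: norm_mult complex_mod_cnj norm_ii norm_of_real mult_1_left)
  qed
  have d_le: "cmod (?d s x) \<le> L * q (x - (y + s * a))" if "s \<in> {r..t}" for s x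
    by (rule order_trans[OF comb[OF that]]) (simp add: gabor_atom_def norm_mult q_def)
  have FTC: "(LINT s|lborel. indicator {r..t} s *\<^sub>R ?d s x) =
      gabor_atom h (y + t * a) (\<xi> + t * b) x - gabor_atom h (y + r * a) (\<xi> + r * b) x" for x
  proof (rule integral_FTC_Icc[OF rt(2) gabor_atom_has_vector_derivative[OF h]])
    have c: "continuous_on {r..t} (\<lambda>s. gabor_atom k (y + s * a) (\<xi> + s * b) x)" if "k \<in> schwartz" for k
      unfolding gabor_atom_def cis_conv_exp
      by (intro continuous_intros continuous_on_compose2[OF schwartz_continuous[OF that]]) auto
    show "continuous_on {r..t} (\<lambda>s. ?d s x)"
      by (intro continuous_intros c schw)
  qed
  let ?f = "\<lambda>s x. indicator {r..t} s *\<^sub>R (g x * cnj (?d s x))"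
  have [measurable]: "(\<lambda>(s, x). ?d s x) \<in> borel_measurable (lborel \<Otimes>\<^sub>M lborel)"
    unfolding gabor_atom_def by measurable
  have fub: "(LINT x|lborel. LINT s|lborel. ?f s x) = (LINT s|lborel. LINT x|lborel. ?f s x)"
  proof (rule Fubini_lborel[symmetric])
    show "case_prod ?f \<in> borel_measurable (lborel \<Otimes>\<^sub>M lborel)"
      by measurable
    \<comment> \<open>The product |g| q is at most |g|^2 + q^2, and translating q leaves its square
      integral unchanged, so K does not depend on s.\<close>
    define K where "K = (\<integral>\<^sup>+x. ennreal ((cmod (g x))\<^sup>2) \<partial>lborel) + (\<integral>\<^sup>+x. ennreal ((q x)\<^sup>2) \<partial>lborel)"
    have "(\<lambda>x. of_real (cmod (k x))) \<in> L2" if "k \<in> L2" for k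
      using that by (auto simp: L2_def)
    then have "(\<lambda>x. 2 * pi * cmod (k x)) \<in> L2" if "k \<in> L2" for k
      using L2_mult_bounded[of "\<lambda>x. of_real (cmod (k x))" "\<lambda>_. 2 * pi" "2 * pi"] that
      by (simp add: mult.commute)
    then have "(\<lambda>x. of_real (q x)) \<in> L2"
      unfolding q_def using l2 by (simp add: L2_add \<open>\<And>k. k \<in> L2 \<Longrightarrow> (\<lambda>x. of_real (cmod (k x))) \<in> L2\<close>)
    from L2_nn_integral[OF this] L2_nn_integral[OF g] have Kfin: "K < \<infinity>"
      unfolding K_def using q0 by (simp add: ennreal_plus[symmetric] del: ennreal_plus)
    have "(\<integral>\<^sup>+s. \<integral>\<^sup>+x. ennreal (norm (?f s x)) \<partial>lborel \<partial>lborel) \<le>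
        (\<integral>\<^sup>+s. ennreal L * K * indicator {r..t} s \<partial>lborel)"
    proof (rule nn_integral_mono)
      fix s
      show "(\<integral>\<^sup>+x. ennreal (norm (?f s x)) \<partial>lborel) \<le> ennreal L * K * indicator {r..t} s"
      proof (cases "s \<in> {r..t}")
        case True
        have "(\<integral>\<^sup>+x. ennreal (norm (?f s x)) \<partial>lborel) \<le>
            (\<integral>\<^sup>+x. ennreal L * (ennreal ((cmod (g x))\<^sup>2) + ennreal ((q (x - (y + s * a)))\<^sup>2)) \<partial>lborel)"
        proof (rule nn_integral_mono)
          fix x
          have "norm (?f s x) = cmod (g x) * cmod (?d s x)"
            using True by (simp only: indicator_simps scaleR_one norm_mult complex_mod_cnj)
          also have "\<dots> \<le> cmod (g x) * (L * q (x - (y + s * a)))"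
            by (intro mult_left_mono d_le True) auto
          also have "\<dots> \<le> L * ((cmod (g x))\<^sup>2 + (q (x - (y + s * a)))\<^sup>2)"
          proof -
            have "cmod (g x) * q (x - (y + s * a)) \<le> (cmod (g x))\<^sup>2 + (q (x - (y + s * a)))\<^sup>2"
              using sum_squares_bound[of "cmod (g x)" "q (x - (y + s * a))"] q0
                mult_nonneg_nonneg[OF norm_ge_zero[of "g x"] q0[of "x - (y + s * a)"]] by linarith
            from mult_left_mono[OF this L] show ?thesis by (simp add: mult_ac)
          qed
          finally show "ennreal (norm (?f s x)) \<le> ennreal L * (ennreal ((cmod (g x))\<^sup>2) + ennreal ((q (x - (y + s * a)))\<^sup>2))"
            using L by (simp add: ennreal_mult[symmetric] ennreal_plus[symmetric] ennreal_leI del: ennreal_plus)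
        qed
        also have "\<dots> = ennreal L * ((\<integral>\<^sup>+x. ennreal ((cmod (g x))\<^sup>2) \<partial>lborel) + (\<integral>\<^sup>+x. ennreal ((q (x - (y + s * a)))\<^sup>2) \<partial>lborel))"
          by (simp add: nn_integral_cmult nn_integral_add)
        also have "(\<integral>\<^sup>+x. ennreal ((q (x - (y + s * a)))\<^sup>2) \<partial>lborel) = (\<integral>\<^sup>+x. ennreal ((q x)\<^sup>2) \<partial>lborel)"
          by (rule nn_integral_lborel_shift) measurable
        finally show ?thesis using True by (simp add: K_def)
      qed simp
    qed
    also have "\<dots> < \<infinity>"
      using Kfin rt by (simp add: nn_integral_cmult_indicator ennreal_mult_less_top)
    finally show "(\<integral>\<^sup>+s. \<integral>\<^sup>+x. ennreal (norm (?f s x)) \<partial>lborel \<partial>lborel) < \<infinity>" .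
  qed
  have "stft h g (y + t * a) (\<xi> + t * b) - stft h g (y + r * a) (\<xi> + r * b) =
      L2_inner g (\<lambda>x. gabor_atom h (y + t * a) (\<xi> + t * b) x - gabor_atom h (y + r * a) (\<xi> + r * b) x)"
    unfolding stft_def by (rule L2_inner_diff[symmetric]) (intro g gabor_atom_L2 l2)+
  also have "\<dots> = (LINT x|lborel. LINT s|lborel. ?f s x)"
    unfolding L2_inner_def
  proof (rule Bochner_Integration.integral_cong[OF refl])
    fix x
    have "(LINT s|lborel. ?f s x) = (LINT s|lborel. g x * cnj (indicator {r..t} s *\<^sub>R ?d s x))"
      by (intro Bochner_Integration.integral_cong) auto
    also have "\<dots> = g x * cnj (LINT s|lborel. indicator {r..t} s *\<^sub>R ?d s x)"
      by (simp only: integral_mult_right_zero Bochner_Integration.integral_cnj)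
    finally show "g x * cnj (gabor_atom h (y + t * a) (\<xi> + t * b) x - gabor_atom h (y + r * a) (\<xi> + r * b) x) =
        (LINT s|lborel. ?f s x)"
      unfolding FTC by simp
  qed
  also have "\<dots> = (LINT s|lborel. LINT x|lborel. ?f s x)" by (rule fub)
  also have "\<dots> = (LINT s|lborel. indicator {r..t} s *\<^sub>R L2_inner g (?d s))"
    unfolding L2_inner_def by (simp only: integral_scaleR_right)
  finally have "ennreal (cmod (stft h g (y + t * a) (\<xi> + t * b) - stft h g (y + r * a) (\<xi> + r * b))) =
      ennreal (norm (LINT s|lborel. indicator {r..t} s *\<^sub>R L2_inner g (?d s)))" by simp
  also have "\<dots> \<le> (\<integral>\<^sup>+s. norm (indicator {r..t} s *\<^sub>R L2_inner g (?d s)) \<partial>lborel)"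
  proof (cases "integrable lborel (\<lambda>s. indicator {r..t} s *\<^sub>R L2_inner g (?d s))")
    case True
    then show ?thesis by (rule integral_norm_bound_ennreal)
  \<comment> \<open>A Bochner integral that does not exist has the default value 0, for which the
    bound is trivial.\<close>
  qed (simp add: not_integrable_integral_eq)
  also have "\<dots> \<le> (\<integral>\<^sup>+s. indicator {r..t} s * (ennreal L * ennreal (stft_grad h g (y + s * a) (\<xi> + s * b))) \<partial>lborel)"
  proof (rule nn_integral_mono)
    fix s
    show "ennreal (norm (indicator {r..t} s *\<^sub>R L2_inner g (?d s))) \<le>
        indicator {r..t} s * (ennreal L * ennreal (stft_grad h g (y + s * a) (\<xi> + s * b)))"
    proof (cases "s \<in> {r..t}")
      case True
      have "cmod (L2_inner g (?d s)) \<le> L * stft_grad h g (y + s * a) (\<xi> + s * b)"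
        unfolding L2_inner_linear_combination[OF g gabor_atom_L2[OF l2(2)] gabor_atom_L2[OF l2(1)] gabor_atom_L2[OF l2(3)]]
          stft_grad_def stft_def
        by (rule comb'[OF True])
      then show ?thesis
        using True L by (simp add: ennreal_mult[symmetric] ennreal_leI)
    qed simp
  qed
  \<comment> \<open>The endpoint t = 1/2 may belong to {r..t} but not to the half-open cell; it is a
    null set.\<close>
  also have "\<dots> \<le> (\<integral>\<^sup>+s. indicator {-1/2..<1/2} s * (ennreal L * ennreal (stft_grad h g (y + s * a) (\<xi> + s * b))) \<partial>lborel)"
  proof (rule nn_integral_mono_AE)
    show "AE s in lborel. indicator {r..t} s * (ennreal L * ennreal (stft_grad h g (y + s * a) (\<xi> + s * b)))
        \<le> indicator {-1/2..<1/2} s * (ennreal L * ennreal (stft_grad h g (y + s * a) (\<xi> + s * b)))"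
      using AE_lborel_singleton[of "1/2"] by eventually_elim (use rt in \<open>auto simp: indicator_def\<close>)
  qed
  also have "\<dots> = (\<integral>\<^sup>+s. ennreal L * ennreal (stft_grad h g (y + s * a) (\<xi> + s * b)) \<partial>cell)"
    by (rule nn_integral_cell[symmetric]) (unfold stft_grad_def, measurable)
  also have "\<dots> = ennreal L * (\<integral>\<^sup>+s. ennreal (stft_grad h g (y + s * a) (\<xi> + s * b)) \<partial>cell)"
    by (rule nn_integral_cmult) (unfold stft_grad_def, measurable)
  finally show ?thesis .
qed

lemma stft_grad_measurable:
  assumes h: "h \<in> schwartz"
    and [measurable]: "g \<in> borel_measurable borel" "p \<in> borel_measurable M" "q \<in> borel_measurable M"
  shows "(\<lambda>z. stft_grad h g (p z) (q z)) \<in> borel_measurable M"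
proof -
  note [measurable] = h[THEN schwartz_measurable] schwartz_xmul[OF h, THEN schwartz_measurable]
    schwartz_vderiv[OF h, THEN schwartz_measurable]
  show ?thesis unfolding stft_grad_def by measurable
qed

lemma stft_increment_le:
  assumes h: "h \<in> schwartz" and g: "g \<in> L2" and ab: "\<bar>a\<bar> \<le> L" "\<bar>b\<bar> \<le> L"
    and \<xi>: "\<And>s. \<bar>s\<bar> \<le> 1/2 \<Longrightarrow> \<bar>\<xi> + s * b\<bar> \<le> 1" and rt: "\<bar>r\<bar> \<le> 1/2" "\<bar>t\<bar> \<le> 1/2"
  shows "ennreal (cmod (stft h g (y + t * a) (\<xi> + t * b) - stft h g (y + r * a) (\<xi> + r * b))) \<le>
    ennreal L * (\<integral>\<^sup>+s. ennreal (stft_grad h g (y + s * a) (\<xi> + s * b)) \<partial>cell)"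
proof (cases "r \<le> t")
  case True
  then show ?thesis
    using rt by (intro stft_increment_le_aux[OF h g ab \<xi>]) auto
next
  case False
  then show ?thesis
    using rt by (subst norm_minus_commute, intro stft_increment_le_aux[OF h g ab \<xi>]) auto
qed

text \<open>A one-dimensional Sobolev inequality: the increment bound from r to t is averaged over
  r, which turns a value at a point into means over the cell. The factor 2 is the bound on
  L.\<close>

lemma stft_sup_le:
  assumes h: "h \<in> schwartz" and g: "g \<in> L2" and ab: "\<bar>a\<bar> \<le> L" "\<bar>b\<bar> \<le> L" and L: "L \<le> 2"
    and \<xi>: "\<And>s. \<bar>s\<bar> \<le> 1/2 \<Longrightarrow> \<bar>\<xi> + s * b\<bar> \<le> 1" and t: "\<bar>t\<bar> \<le> 1/2"
  shows "ennreal (cmod (stft h g (y + t * a) (\<xi> + t * b))) \<le>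
    (\<integral>\<^sup>+s. ennreal (cmod (stft h g (y + s * a) (\<xi> + s * b)) + 2 * stft_grad h g (y + s * a) (\<xi> + s * b)) \<partial>cell)"
proof -
  note [measurable] = h[THEN schwartz_measurable] L2_measurable[OF g]
  let ?V = "\<lambda>s. stft h g (y + s * a) (\<xi> + s * b)" and ?S = "\<lambda>s. stft_grad h g (y + s * a) (\<xi> + s * b)"
  have [measurable]: "?S \<in> borel_measurable borel" by (rule stft_grad_measurable[OF h]) measurable
  have "ennreal (cmod (?V t)) = (\<integral>\<^sup>+r. ennreal (cmod (?V t)) \<partial>cell)" by simp
  also have "\<dots> \<le> (\<integral>\<^sup>+r. (ennreal (cmod (?V r)) + 2 * (\<integral>\<^sup>+s. ennreal (?S s) \<partial>cell)) \<partial>cell)"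
  proof (rule nn_integral_cell_mono)
    fix r :: real assume r: "\<bar>r\<bar> \<le> 1/2"
    have "ennreal (cmod (?V t)) \<le> ennreal (cmod (?V r) + cmod (?V t - ?V r))"
      by (intro ennreal_leI) (metis norm_triangle_sub)
    also have "\<dots> = ennreal (cmod (?V r)) + ennreal (cmod (?V t - ?V r))"
      by (simp add: ennreal_plus)
    also have "ennreal (cmod (?V t - ?V r)) \<le> ennreal L * (\<integral>\<^sup>+s. ennreal (?S s) \<partial>cell)"
      by (rule stft_increment_le[OF h g ab \<xi> r t])
    also have "\<dots> \<le> 2 * (\<integral>\<^sup>+s. ennreal (?S s) \<partial>cell)"
      using L ennreal_leI[OF L] by (intro mult_right_mono) auto
    finally show "ennreal (cmod (?V t)) \<le> ennreal (cmod (?V r)) + 2 * (\<integral>\<^sup>+s. ennreal (?S s) \<partial>cell)"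
      by (simp add: add_left_mono)
  qed
  also have "\<dots> = (\<integral>\<^sup>+r. ennreal (cmod (?V r)) \<partial>cell) + 2 * (\<integral>\<^sup>+s. ennreal (?S s) \<partial>cell)"
    by (subst nn_integral_add) auto
  also have "\<dots> = (\<integral>\<^sup>+s. ennreal (cmod (?V s) + 2 * ?S s) \<partial>cell)"
    by (simp add: nn_integral_add nn_integral_cmult ennreal_plus ennreal_mult)
  finally show ?thesis .
qed

text \<open>
  Only a majorant of the second order derivatives along a cell: each of the three terms of
  \<open>stft_grad\<close> is replaced by its bound from \<open>stft_sup_le\<close>.
\<close>

definition stft_hess :: "(real \<Rightarrow> complex) \<Rightarrow> (real \<Rightarrow> complex) \<Rightarrow> real \<Rightarrow> real \<Rightarrow> real" where
  "stft_hess h g y \<xi> =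
     2 * pi * (cmod (stft (xmul h) g y \<xi>) + 2 * stft_grad (xmul h) g y \<xi>) +
     2 * pi * (cmod (stft h g y \<xi>) + 2 * stft_grad h g y \<xi>) +
     (cmod (stft (vderiv h) g y \<xi>) + 2 * stft_grad (vderiv h) g y \<xi>)"

lemma stft_hess_nonneg [simp]: "stft_hess h g y \<xi> \<ge> 0"
  by (simp add: stft_hess_def)

lemma stft_hess_measurable:
  assumes h: "h \<in> schwartz"
    and [measurable]: "g \<in> borel_measurable borel" "p \<in> borel_measurable M" "q \<in> borel_measurable M"
  shows "(\<lambda>z. stft_hess h g (p z) (q z)) \<in> borel_measurable M"
proof -
  note [measurable] = h[THEN schwartz_measurable] schwartz_xmul[OF h, THEN schwartz_measurable]
    schwartz_vderiv[OF h, THEN schwartz_measurable]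
    stft_grad_measurable[OF h] stft_grad_measurable[OF schwartz_xmul[OF h]]
    stft_grad_measurable[OF schwartz_vderiv[OF h]]
  show ?thesis unfolding stft_hess_def by measurable
qed

lemma stft_grad_sup_le:
  assumes h: "h \<in> schwartz" and g: "g \<in> L2" and ab: "\<bar>a\<bar> \<le> L" "\<bar>b\<bar> \<le> L" and L: "L \<le> 2"
    and \<xi>: "\<And>s. \<bar>s\<bar> \<le> 1/2 \<Longrightarrow> \<bar>\<xi> + s * b\<bar> \<le> 1" and t: "\<bar>t\<bar> \<le> 1/2"
  shows "ennreal (stft_grad h g (y + t * a) (\<xi> + t * b)) \<le>
    (\<integral>\<^sup>+s. ennreal (stft_hess h g (y + s * a) (\<xi> + s * b)) \<partial>cell)"
proof -
  note schw = h schwartz_xmul[OF h] schwartz_vderiv[OF h]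
  note [measurable] = schw[THEN schwartz_measurable] L2_measurable[OF g] schw[THEN stft_grad_measurable]
  define T where "T k s = cmod (stft k g (y + s * a) (\<xi> + s * b)) + 2 * stft_grad k g (y + s * a) (\<xi> + s * b)" for k s
  have T0: "T k s \<ge> 0" for k s by (simp add: T_def)
  have [measurable]: "T (xmul h) \<in> borel_measurable borel" "T h \<in> borel_measurable borel"
    "T (vderiv h) \<in> borel_measurable borel" unfolding T_def by measurable
  have "ennreal (stft_grad h g (y + t * a) (\<xi> + t * b)) =
      ennreal (2 * pi) * ennreal (cmod (stft (xmul h) g (y + t * a) (\<xi> + t * b))) +
      ennreal (2 * pi) * ennreal (cmod (stft h g (y + t * a) (\<xi> + t * b))) +
      ennreal (cmod (stft (vderiv h) g (y + t * a) (\<xi> + t * b)))"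
    unfolding stft_grad_def by (simp add: ennreal_plus[symmetric] ennreal_mult[symmetric] del: ennreal_plus)
  also have "\<dots> \<le> ennreal (2 * pi) * (\<integral>\<^sup>+s. ennreal (T (xmul h) s) \<partial>cell) +
      ennreal (2 * pi) * (\<integral>\<^sup>+s. ennreal (T h s) \<partial>cell) + (\<integral>\<^sup>+s. ennreal (T (vderiv h) s) \<partial>cell)"
    unfolding T_def by (intro add_mono mult_left_mono stft_sup_le[OF _ g ab L \<xi> t] schw) auto
  also have "\<dots> = (\<integral>\<^sup>+s. ennreal (2 * pi) * ennreal (T (xmul h) s) + ennreal (2 * pi) * ennreal (T h s)
      + ennreal (T (vderiv h) s) \<partial>cell)"
    by (simp add: nn_integral_add nn_integral_cmult)
  also have "\<dots> = (\<integral>\<^sup>+s. ennreal (stft_hess h g (y + s * a) (\<xi> + s * b)) \<partial>cell)"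
  proof (rule nn_integral_cong)
    fix s
    have "stft_hess h g (y + s * a) (\<xi> + s * b) = 2 * pi * T (xmul h) s + 2 * pi * T h s + T (vderiv h) s"
      by (simp add: stft_hess_def T_def)
    then show "ennreal (2 * pi) * ennreal (T (xmul h) s) + ennreal (2 * pi) * ennreal (T h s) + ennreal (T (vderiv h) s)
       = ennreal (stft_hess h g (y + s * a) (\<xi> + s * b))"
      using T0 by (simp add: ennreal_plus[symmetric] ennreal_mult[symmetric] del: ennreal_plus)
  qed
  finally show ?thesis .
qed

text \<open>The path runs from (0, 0) to (0, t) and on to (s, t). Each leg costs L times a mean of
  the gradient along a segment, and \<open>stft_grad_sup_le\<close> in the transverse direction
  replaces that by a mean over the whole cell, the same for all s and t. The two legs account for
  the factor 2.\<close>

lemma stft_oscillation_le: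
  assumes h: "h \<in> schwartz" and g: "g \<in> L2"
    and abcd: "\<bar>a\<bar> \<le> L" "\<bar>b\<bar> \<le> L" "\<bar>c\<bar> \<le> L" "\<bar>d\<bar> \<le> L" and L: "L \<le> 2"
    and freq: "\<And>s t. \<bar>s\<bar> \<le> 1/2 \<Longrightarrow> \<bar>t\<bar> \<le> 1/2 \<Longrightarrow> \<bar>c * s + d * t\<bar> \<le> 1"
    and s: "\<bar>s\<bar> \<le> 1/2" and t: "\<bar>t\<bar> \<le> 1/2"
  shows "ennreal (cmod (stft h g (a * s + b * t) (c * s + d * t) - stft h g 0 0)) \<le>
    2 * ennreal L * (\<integral>\<^sup>+s. \<integral>\<^sup>+t. ennreal (stft_hess h g (a * s + b * t) (c * s + d * t)) \<partial>cell \<partial>cell)"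
proof -
  note [measurable] = h[THEN schwartz_measurable] L2_measurable[OF g] stft_grad_measurable[OF h]
    stft_hess_measurable[OF h]
  let ?V = "\<lambda>s t. stft h g (a * s + b * t) (c * s + d * t)"
  let ?S = "\<lambda>s t. stft_grad h g (a * s + b * t) (c * s + d * t)"
  let ?R = "\<lambda>s t. stft_hess h g (a * s + b * t) (c * s + d * t)"
  have along_a: "a * s + b * t = b * t + s * a" "c * s + d * t = d * t + s * c"
    and along_b: "a * s + b * t = a * s + t * b" "c * s + d * t = c * s + t * d" for s t
    by (simp_all add: mult.commute add.commute)
  have freq_a: "\<bar>d * t + s * c\<bar> \<le> 1" and freq_b: "\<bar>c * s + t * d\<bar> \<le> 1"
    if "\<bar>s\<bar> \<le> 1/2" "\<bar>t\<bar> \<le> 1/2" for s t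
    using freq[OF that] by (simp_all only: along_a(2)[symmetric] along_b(2)[symmetric])
  have "ennreal (cmod (?V s t - ?V 0 t)) \<le> ennreal L * (\<integral>\<^sup>+s'. ennreal (?S s' t) \<partial>cell)"
    unfolding along_a by (rule stft_increment_le[OF h g abcd(1,3) freq_a]) (use s t in auto)
  also have "\<dots> \<le> ennreal L * (\<integral>\<^sup>+s'. \<integral>\<^sup>+t'. ennreal (?R s' t') \<partial>cell \<partial>cell)"
  proof (intro mult_left_mono nn_integral_cell_mono)
    fix s' :: real assume s': "\<bar>s'\<bar> \<le> 1/2"
    show "ennreal (?S s' t) \<le> (\<integral>\<^sup>+t'. ennreal (?R s' t') \<partial>cell)"
      unfolding along_b by (rule stft_grad_sup_le[OF h g abcd(2,4) L freq_b]) (use s' t in auto)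
  qed simp
  finally have 1: "ennreal (cmod (?V s t - ?V 0 t)) \<le>
      ennreal L * (\<integral>\<^sup>+s'. \<integral>\<^sup>+t'. ennreal (?R s' t') \<partial>cell \<partial>cell)" .
  have "ennreal (cmod (?V 0 t - ?V 0 0)) \<le> ennreal L * (\<integral>\<^sup>+t'. ennreal (?S 0 t') \<partial>cell)"
    unfolding along_b by (rule stft_increment_le[OF h g abcd(2,4) freq_b]) (use t in auto)
  also have "\<dots> \<le> ennreal L * (\<integral>\<^sup>+t'. \<integral>\<^sup>+s'. ennreal (?R s' t') \<partial>cell \<partial>cell)"
  proof (intro mult_left_mono nn_integral_cell_mono)
    fix t' :: real assume t': "\<bar>t'\<bar> \<le> 1/2"
    show "ennreal (?S 0 t') \<le> (\<integral>\<^sup>+s'. ennreal (?R s' t') \<partial>cell)"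
      unfolding along_a by (rule stft_grad_sup_le[OF h g abcd(1,3) L freq_a]) (use t' in auto)
  qed simp
  also have "(\<integral>\<^sup>+t'. \<integral>\<^sup>+s'. ennreal (?R s' t') \<partial>cell \<partial>cell) = (\<integral>\<^sup>+s'. \<integral>\<^sup>+t'. ennreal (?R s' t') \<partial>cell \<partial>cell)"
    by (rule cell_pair.Fubini') measurable
  finally have 2: "ennreal (cmod (?V 0 t - ?V 0 0)) \<le>
      ennreal L * (\<integral>\<^sup>+s'. \<integral>\<^sup>+t'. ennreal (?R s' t') \<partial>cell \<partial>cell)" .
  have "cmod (?V s t - ?V 0 0) \<le> cmod (?V s t - ?V 0 t) + cmod (?V 0 t - ?V 0 0)"
    using norm_triangle_ineq[of "?V s t - ?V 0 t" "?V 0 t - ?V 0 0"] by simp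
  then have "ennreal (cmod (?V s t - ?V 0 0)) \<le> ennreal (cmod (?V s t - ?V 0 t)) + ennreal (cmod (?V 0 t - ?V 0 0))"
    by (simp add: ennreal_plus[symmetric] ennreal_leI del: ennreal_plus)
  also have "\<dots> \<le> ennreal L * (\<integral>\<^sup>+s'. \<integral>\<^sup>+t'. ennreal (?R s' t') \<partial>cell \<partial>cell) +
      ennreal L * (\<integral>\<^sup>+s'. \<integral>\<^sup>+t'. ennreal (?R s' t') \<partial>cell \<partial>cell)"
    by (intro add_mono 1 2)
  finally show ?thesis
    by (simp add: mult_2 distrib_right)
qed

text \<open>The constant K is uniform in g. Measurability is part of the notion so that it is
  inherited under sums and multiples, where the integrals have to be split.\<close>

definition moyal_bounded :: "((real \<Rightarrow> complex) \<Rightarrow> real \<Rightarrow> real \<Rightarrow> real) \<Rightarrow> bool" where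
  "moyal_bounded R \<longleftrightarrow> (\<forall>g\<in>L2. case_prod (R g) \<in> borel_measurable (lborel \<Otimes>\<^sub>M lborel)) \<and>
     (\<exists>K\<ge>0. \<forall>g\<in>L2. (\<integral>\<^sup>+y. \<integral>\<^sup>+\<xi>. ennreal ((R g y \<xi>)\<^sup>2) \<partial>lborel \<partial>lborel) \<le>
        ennreal (K * (LINT x|lborel. (cmod (g x))\<^sup>2)))"

lemma moyal_bounded_stft:
  assumes h: "h \<in> schwartz"
  shows "moyal_bounded (\<lambda>g y \<xi>. cmod (stft h g y \<xi>))"
proof -
  note [measurable] = schwartz_measurable[OF h]
  obtain B where B: "\<And>x. cmod (h x) \<le> B" using schwartz_bounded[OF h] by blast
  have "(\<lambda>(y, \<xi>). cmod (stft h g y \<xi>)) \<in> borel_measurable (lborel \<Otimes>\<^sub>M lborel)" if "g \<in> L2" for g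
  proof -
    note [measurable] = L2_measurable[OF that]
    show ?thesis by measurable
  qed
  then show ?thesis
    unfolding moyal_bounded_def
    by (intro conjI ballI exI[of _ "LINT x|lborel. (cmod (h x))\<^sup>2"])
      (simp_all add: moyal_scalar[OF _ schwartz_L2[OF h] B])
qed

lemma moyal_bounded_cmult:
  assumes "moyal_bounded R"
  shows "moyal_bounded (\<lambda>g y \<xi>. c * R g y \<xi>)"
proof -
  from assms obtain K where K: "K \<ge> 0" "\<And>g. g \<in> L2 \<Longrightarrow>
      (\<integral>\<^sup>+y. \<integral>\<^sup>+\<xi>. ennreal ((R g y \<xi>)\<^sup>2) \<partial>lborel \<partial>lborel) \<le> ennreal (K * (LINT x|lborel. (cmod (g x))\<^sup>2))"
    and m: "\<And>g. g \<in> L2 \<Longrightarrow> case_prod (R g) \<in> borel_measurable (lborel \<Otimes>\<^sub>M lborel)"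
    unfolding moyal_bounded_def by blast
  have "(\<integral>\<^sup>+y. \<integral>\<^sup>+\<xi>. ennreal ((c * R g y \<xi>)\<^sup>2) \<partial>lborel \<partial>lborel) \<le>
      ennreal (c\<^sup>2 * K * (LINT x|lborel. (cmod (g x))\<^sup>2))" if g: "g \<in> L2" for g
  proof -
    note [measurable] = m[OF g]
    have "(\<integral>\<^sup>+y. \<integral>\<^sup>+\<xi>. ennreal ((c * R g y \<xi>)\<^sup>2) \<partial>lborel \<partial>lborel) =
        ennreal (c\<^sup>2) * (\<integral>\<^sup>+y. \<integral>\<^sup>+\<xi>. ennreal ((R g y \<xi>)\<^sup>2) \<partial>lborel \<partial>lborel)"
      by (simp add: power_mult_distrib ennreal_mult nn_integral_cmult)
    also have "\<dots> \<le> ennreal (c\<^sup>2) * ennreal (K * (LINT x|lborel. (cmod (g x))\<^sup>2))"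
      by (intro mult_left_mono K g) simp
    finally show ?thesis using K(1) by (simp add: ennreal_mult[symmetric] mult.assoc)
  qed
  moreover have "(\<lambda>(y, \<xi>). c * R g y \<xi>) \<in> borel_measurable (lborel \<Otimes>\<^sub>M lborel)" if g: "g \<in> L2" for g
  proof -
    note [measurable] = m[OF g]
    show ?thesis by measurable
  qed
  ultimately show ?thesis
    unfolding moyal_bounded_def using K(1) by (intro conjI ballI exI[of _ "c\<^sup>2 * K"]) auto
qed

lemma moyal_bounded_add:
  assumes "moyal_bounded R" "moyal_bounded R'"
  shows "moyal_bounded (\<lambda>g y \<xi>. R g y \<xi> + R' g y \<xi>)"
proof -
  from assms(1) obtain K where K: "K \<ge> 0" "\<And>g. g \<in> L2 \<Longrightarrow>
      (\<integral>\<^sup>+y. \<integral>\<^sup>+\<xi>. ennreal ((R g y \<xi>)\<^sup>2) \<partial>lborel \<partial>lborel) \<le> ennreal (K * (LINT x|lborel. (cmod (g x))\<^sup>2))"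
    and m: "\<And>g. g \<in> L2 \<Longrightarrow> case_prod (R g) \<in> borel_measurable (lborel \<Otimes>\<^sub>M lborel)"
    unfolding moyal_bounded_def by blast
  from assms(2) obtain K' where K': "K' \<ge> 0" "\<And>g. g \<in> L2 \<Longrightarrow>
      (\<integral>\<^sup>+y. \<integral>\<^sup>+\<xi>. ennreal ((R' g y \<xi>)\<^sup>2) \<partial>lborel \<partial>lborel) \<le> ennreal (K' * (LINT x|lborel. (cmod (g x))\<^sup>2))"
    and m': "\<And>g. g \<in> L2 \<Longrightarrow> case_prod (R' g) \<in> borel_measurable (lborel \<Otimes>\<^sub>M lborel)"
    unfolding moyal_bounded_def by blast
  have "(\<integral>\<^sup>+y. \<integral>\<^sup>+\<xi>. ennreal ((R g y \<xi> + R' g y \<xi>)\<^sup>2) \<partial>lborel \<partial>lborel) \<le>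
      ennreal ((2 * K + 2 * K') * (LINT x|lborel. (cmod (g x))\<^sup>2))" if g: "g \<in> L2" for g
  proof -
    note [measurable] = m[OF g] m'[OF g]
    have "ennreal ((p + q)\<^sup>2) \<le> 2 * ennreal (p\<^sup>2) + 2 * ennreal (q\<^sup>2)" for p q :: real
    proof -
      have "(p + q)\<^sup>2 \<le> 2 * p\<^sup>2 + 2 * q\<^sup>2"
        using sum_squares_bound[of p q] by (simp add: power2_sum)
      from ennreal_leI[OF this] show ?thesis by (simp add: ennreal_plus ennreal_mult)
    qed
    then have "(\<integral>\<^sup>+y. \<integral>\<^sup>+\<xi>. ennreal ((R g y \<xi> + R' g y \<xi>)\<^sup>2) \<partial>lborel \<partial>lborel) \<le>
        (\<integral>\<^sup>+y. \<integral>\<^sup>+\<xi>. 2 * ennreal ((R g y \<xi>)\<^sup>2) + 2 * ennreal ((R' g y \<xi>)\<^sup>2) \<partial>lborel \<partial>lborel)"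
      by (intro nn_integral_mono)
    also have "\<dots> = 2 * (\<integral>\<^sup>+y. \<integral>\<^sup>+\<xi>. ennreal ((R g y \<xi>)\<^sup>2) \<partial>lborel \<partial>lborel) +
        2 * (\<integral>\<^sup>+y. \<integral>\<^sup>+\<xi>. ennreal ((R' g y \<xi>)\<^sup>2) \<partial>lborel \<partial>lborel)"
      by (simp add: nn_integral_add nn_integral_cmult)
    also have "\<dots> \<le> 2 * ennreal (K * (LINT x|lborel. (cmod (g x))\<^sup>2)) +
        2 * ennreal (K' * (LINT x|lborel. (cmod (g x))\<^sup>2))"
      by (intro add_mono mult_left_mono K K' g) simp_all
    also have "\<dots> = ennreal ((2 * K + 2 * K') * (LINT x|lborel. (cmod (g x))\<^sup>2))"
      using K(1) K'(1) by (simp add: distrib_right ennreal_plus ennreal_mult mult.assoc)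
    finally show ?thesis .
  qed
  moreover have "(\<lambda>(y, \<xi>). R g y \<xi> + R' g y \<xi>) \<in> borel_measurable (lborel \<Otimes>\<^sub>M lborel)" if g: "g \<in> L2" for g
  proof -
    note [measurable] = m[OF g] m'[OF g]
    show ?thesis by measurable
  qed
  ultimately show ?thesis
    unfolding moyal_bounded_def using K(1) K'(1)
    by (intro conjI ballI exI[of _ "2 * K + 2 * K'"]) auto
qed

text \<open>Every window inside the majorant arises from h by at most two applications of
  \<open>xmul\<close> and \<open>vderiv\<close>, hence is again a Schwartz function.\<close>

lemma moyal_bounded_hess:
  assumes h: "h \<in> schwartz"
  shows "moyal_bounded (stft_hess h)"
  unfolding stft_hess_def[abs_def] stft_grad_def[abs_def]
  by (intro moyal_bounded_add moyal_bounded_cmult moyal_bounded_stft schwartz_xmul schwartz_vderiv h)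

section \<open>Tiling by lattice cells\<close>

text \<open>Gaussian elimination with pivot a: first \<xi> = c y / a + e t for fixed y, then y = b t
  + a s for fixed t. The second entry of the elimination is e = det / a, so the two one-dimensional
  Jacobians multiply to |det|.\<close>

lemma nn_integral_linear_2d_aux:
  fixes \<phi> :: "real \<Rightarrow> real \<Rightarrow> ennreal"
  assumes [measurable]: "case_prod \<phi> \<in> borel_measurable (lborel \<Otimes>\<^sub>M lborel)"
    and a: "a \<noteq> 0" and det: "a * d - b * c \<noteq> 0"
  shows "(\<integral>\<^sup>+y. \<integral>\<^sup>+\<xi>. \<phi> y \<xi> \<partial>lborel \<partial>lborel) =
    ennreal \<bar>a * d - b * c\<bar> * (\<integral>\<^sup>+s. \<integral>\<^sup>+t. \<phi> (a * s + b * t) (c * s + d * t) \<partial>lborel \<partial>lborel)"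
proof -
  define e where "e = (a * d - b * c) / a"
  have e: "e \<noteq> 0" using a det by (simp add: e_def)
  have "(\<integral>\<^sup>+y. \<integral>\<^sup>+\<xi>. \<phi> y \<xi> \<partial>lborel \<partial>lborel) =
      (\<integral>\<^sup>+y. ennreal \<bar>e\<bar> * (\<integral>\<^sup>+t. \<phi> y (c * y / a + e * t) \<partial>lborel) \<partial>lborel)"
    by (intro nn_integral_cong nn_integral_real_affine[OF _ e]) measurable
  also have "\<dots> = ennreal \<bar>e\<bar> * (\<integral>\<^sup>+y. \<integral>\<^sup>+t. \<phi> y (c * y / a + e * t) \<partial>lborel \<partial>lborel)"
    by (rule nn_integral_cmult) measurable
  also have "(\<integral>\<^sup>+y. \<integral>\<^sup>+t. \<phi> y (c * y / a + e * t) \<partial>lborel \<partial>lborel) =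
      (\<integral>\<^sup>+t. \<integral>\<^sup>+y. \<phi> y (c * y / a + e * t) \<partial>lborel \<partial>lborel)"
    by (rule lborel_pair.Fubini'[symmetric]) measurable
  also have "\<dots> = (\<integral>\<^sup>+t. ennreal \<bar>a\<bar> * (\<integral>\<^sup>+s. \<phi> (b * t + a * s) (c * (b * t + a * s) / a + e * t) \<partial>lborel) \<partial>lborel)"
    by (intro nn_integral_cong nn_integral_real_affine[OF _ a]) measurable
  also have "\<dots> = ennreal \<bar>a\<bar> * (\<integral>\<^sup>+t. \<integral>\<^sup>+s. \<phi> (b * t + a * s) (c * (b * t + a * s) / a + e * t) \<partial>lborel \<partial>lborel)"
    by (rule nn_integral_cmult) measurable
  also have "(\<integral>\<^sup>+t. \<integral>\<^sup>+s. \<phi> (b * t + a * s) (c * (b * t + a * s) / a + e * t) \<partial>lborel \<partial>lborel) =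
      (\<integral>\<^sup>+s. \<integral>\<^sup>+t. \<phi> (b * t + a * s) (c * (b * t + a * s) / a + e * t) \<partial>lborel \<partial>lborel)"
    by (rule lborel_pair.Fubini') measurable
  also have "\<dots> = (\<integral>\<^sup>+s. \<integral>\<^sup>+t. \<phi> (a * s + b * t) (c * s + d * t) \<partial>lborel \<partial>lborel)"
  proof (intro nn_integral_cong)
    fix s t
    have "c * (b * t + a * s) / a + e * t = c * s + d * t"
      using a by (simp add: e_def field_simps)
    then show "\<phi> (b * t + a * s) (c * (b * t + a * s) / a + e * t) = \<phi> (a * s + b * t) (c * s + d * t)"
      by (simp only: add.commute)
  qed
  also have "ennreal \<bar>e\<bar> * (ennreal \<bar>a\<bar> * (\<integral>\<^sup>+s. \<integral>\<^sup>+t. \<phi> (a * s + b * t) (c * s + d * t) \<partial>lborel \<partial>lborel)) =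
      ennreal \<bar>a * d - b * c\<bar> * (\<integral>\<^sup>+s. \<integral>\<^sup>+t. \<phi> (a * s + b * t) (c * s + d * t) \<partial>lborel \<partial>lborel)"
    unfolding mult.assoc[symmetric] ennreal_mult[OF abs_ge_zero abs_ge_zero, symmetric]
    using a by (simp add: e_def abs_divide)
  finally show ?thesis .
qed

lemma nn_integral_linear_2d:
  fixes \<phi> :: "real \<Rightarrow> real \<Rightarrow> ennreal"
  assumes m: "case_prod \<phi> \<in> borel_measurable (lborel \<Otimes>\<^sub>M lborel)"
    and det: "a * d - b * c \<noteq> 0"
  shows "(\<integral>\<^sup>+y. \<integral>\<^sup>+\<xi>. \<phi> y \<xi> \<partial>lborel \<partial>lborel) =
    ennreal \<bar>a * d - b * c\<bar> * (\<integral>\<^sup>+s. \<integral>\<^sup>+t. \<phi> (a * s + b * t) (c * s + d * t) \<partial>lborel \<partial>lborel)"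
proof (cases "a = 0")
  case False
  then show ?thesis by (rule nn_integral_linear_2d_aux[OF m _ det])
next
  case True
  note [measurable] = m
  \<comment> \<open>If a = 0, the determinant condition forces b to be nonzero; exchanging the
    columns makes b the pivot and only changes the sign of the determinant.\<close>
  have "(\<integral>\<^sup>+y. \<integral>\<^sup>+\<xi>. \<phi> y \<xi> \<partial>lborel \<partial>lborel) =
      ennreal \<bar>b * c - a * d\<bar> * (\<integral>\<^sup>+t. \<integral>\<^sup>+s. \<phi> (b * t + a * s) (d * t + c * s) \<partial>lborel \<partial>lborel)"
    using True det by (intro nn_integral_linear_2d_aux[OF m]) auto
  also have "(\<integral>\<^sup>+t. \<integral>\<^sup>+s. \<phi> (b * t + a * s) (d * t + c * s) \<partial>lborel \<partial>lborel) =
      (\<integral>\<^sup>+s. \<integral>\<^sup>+t. \<phi> (b * t + a * s) (d * t + c * s) \<partial>lborel \<partial>lborel)"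
    by (rule lborel_pair.Fubini') measurable
  finally show ?thesis
    by (simp only: add.commute abs_minus_commute)
qed

lemma nn_integral_lborel_eq_sum_cells:
  fixes f :: "real \<Rightarrow> ennreal"
  assumes [measurable]: "f \<in> borel_measurable borel"
  shows "(\<integral>\<^sup>+x. f x \<partial>lborel) = (\<integral>\<^sup>+n. \<integral>\<^sup>+s. f (of_int n + s) \<partial>cell \<partial>count_space UNIV)"
proof -
  let ?J = "{-1/2..<1/2::real}"
  have "(\<integral>\<^sup>+x. f x \<partial>lborel) = (\<integral>\<^sup>+x. \<integral>\<^sup>+n. indicator ?J (x - of_int n) * f x \<partial>count_space UNIV \<partial>lborel)"
  proof (rule nn_integral_cong)
    fix x
    \<comment> \<open>Rounding to the nearest integer: each x lies in exactly one translate of the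
      half-open interval, so the indicators sum to 1.\<close>
    have "x - of_int n \<in> ?J \<longleftrightarrow> n = \<lfloor>x + 1/2\<rfloor>" for n
      by (auto simp: floor_eq_iff eq_commute[of n])
    then have "indicator ?J (x - of_int n) = (indicator {\<lfloor>x + 1/2\<rfloor>} n :: ennreal)" for n
      by (simp add: indicator_def)
    then show "f x = (\<integral>\<^sup>+n. indicator ?J (x - of_int n) * f x \<partial>count_space UNIV)"
      by (simp add: nn_integral_indicator_singleton mult.commute[of _ "f x"])
  qed
  also have "\<dots> = (\<integral>\<^sup>+n. \<integral>\<^sup>+x. indicator ?J (x - of_int n) * f x \<partial>lborel \<partial>count_space UNIV)"
    by (rule nn_integral_count_space_nn_integral) auto
  also have "\<dots> = (\<integral>\<^sup>+n. \<integral>\<^sup>+s. f (of_int n + s) \<partial>cell \<partial>count_space UNIV)"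
  proof (rule nn_integral_cong)
    fix n :: int
    have "(\<integral>\<^sup>+x. indicator ?J (x - of_int n) * f x \<partial>lborel) =
        (\<integral>\<^sup>+x. indicator ?J x * f (of_int n + x) \<partial>lborel)"
      using nn_integral_lborel_shift[of "\<lambda>x. indicator ?J x * f (of_int n + x)" "of_int n"] by simp
    then show "(\<integral>\<^sup>+x. indicator ?J (x - of_int n) * f x \<partial>lborel) = (\<integral>\<^sup>+s. f (of_int n + s) \<partial>cell)"
      by (simp add: nn_integral_cell)
  qed
  finally show ?thesis .
qed

lemma nn_integral_eq_sum_lattice_cells:
  fixes \<phi> :: "real \<Rightarrow> real \<Rightarrow> ennreal"
  assumes m[measurable]: "case_prod \<phi> \<in> borel_measurable (lborel \<Otimes>\<^sub>M lborel)"
    and det: "a * d - b * c \<noteq> 0"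
  shows "(\<integral>\<^sup>+y. \<integral>\<^sup>+\<xi>. \<phi> y \<xi> \<partial>lborel \<partial>lborel) =
    ennreal \<bar>a * d - b * c\<bar> * (\<integral>\<^sup>+k. \<integral>\<^sup>+s. \<integral>\<^sup>+t.
      \<phi> (a * of_int (fst k) + b * of_int (snd k) + (a * s + b * t))
        (c * of_int (fst k) + d * of_int (snd k) + (c * s + d * t)) \<partial>cell \<partial>cell \<partial>count_space UNIV)"
proof -
  define \<psi> where "\<psi> s t = \<phi> (a * s + b * t) (c * s + d * t)" for s t
  have [measurable]: "case_prod \<psi> \<in> borel_measurable (lborel \<Otimes>\<^sub>M lborel)"
    unfolding \<psi>_def by measurable
  have "(\<integral>\<^sup>+s. \<integral>\<^sup>+t. \<psi> s t \<partial>lborel \<partial>lborel) =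
      (\<integral>\<^sup>+s. \<integral>\<^sup>+n. \<integral>\<^sup>+t. \<psi> s (of_int n + t) \<partial>cell \<partial>count_space UNIV \<partial>lborel)"
    by (intro nn_integral_cong nn_integral_lborel_eq_sum_cells) measurable
  also have "\<dots> = (\<integral>\<^sup>+n. \<integral>\<^sup>+s. \<integral>\<^sup>+t. \<psi> s (of_int n + t) \<partial>cell \<partial>lborel \<partial>count_space UNIV)"
    by (rule nn_integral_count_space_nn_integral) measurable
  also have "\<dots> = (\<integral>\<^sup>+n. \<integral>\<^sup>+m. \<integral>\<^sup>+s. \<integral>\<^sup>+t. \<psi> (of_int m + s) (of_int n + t) \<partial>cell \<partial>cell \<partial>count_space UNIV \<partial>count_space UNIV)"
    by (intro nn_integral_cong nn_integral_lborel_eq_sum_cells) measurable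
  also have "\<dots> = (\<integral>\<^sup>+k. \<integral>\<^sup>+s. \<integral>\<^sup>+t. \<psi> (of_int (fst k) + s) (of_int (snd k) + t) \<partial>cell \<partial>cell \<partial>count_space UNIV)"
    using nn_integral_snd_count_space[of "\<lambda>k. \<integral>\<^sup>+s. \<integral>\<^sup>+t. \<psi> (of_int (fst k) + s) (of_int (snd k) + t) \<partial>cell \<partial>cell"]
    by simp
  finally show ?thesis
    unfolding nn_integral_linear_2d[OF m det] \<psi>_def by (simp add: algebra_simps)
qed

text \<open>
  The phase on the right does not depend on the window, so moving a lattice point to the origin
  leaves the modulus of every sum over the components of a vector-valued window unchanged.
\<close>

lemma stft_shift:
  assumes [measurable]: "h \<in> borel_measurable borel" "g \<in> borel_measurable borel"
  shows "stft h (\<lambda>x. cis (- (2 * pi * \<xi>\<^sub>0 * x)) * g (x + y\<^sub>0)) y \<xi> =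
    cis (- (2 * pi * \<xi>\<^sub>0 * y)) * stft h g (y\<^sub>0 + y) (\<xi>\<^sub>0 + \<xi>)"
proof -
  have "stft h (\<lambda>x. cis (- (2 * pi * \<xi>\<^sub>0 * x)) * g (x + y\<^sub>0)) y \<xi> =
    (LINT x|lborel. cis (- (2 * pi * \<xi>\<^sub>0 * (x - y\<^sub>0))) * g (x - y\<^sub>0 + y\<^sub>0) * cnj (gabor_atom h y \<xi> (x - y\<^sub>0)))"
    unfolding stft_def L2_inner_def
    by (rule integral_lborel_shift[symmetric])
  also have "\<dots> = (LINT x|lborel. cis (- (2 * pi * \<xi>\<^sub>0 * y)) * (g x * cnj (gabor_atom h (y\<^sub>0 + y) (\<xi>\<^sub>0 + \<xi>) x)))"
  proof (rule Bochner_Integration.integral_cong[OF refl])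
    fix x
    have "cis (- (2 * pi * \<xi>\<^sub>0 * (x - y\<^sub>0))) * cnj (cis (2 * pi * \<xi> * (x - y\<^sub>0 - y))) =
        cis (- (2 * pi * \<xi>\<^sub>0 * y)) * cnj (cis (2 * pi * (\<xi>\<^sub>0 + \<xi>) * (x - (y\<^sub>0 + y))))"
      by (simp add: cis_cnj cis_mult algebra_simps)
    then show "cis (- (2 * pi * \<xi>\<^sub>0 * (x - y\<^sub>0))) * g (x - y\<^sub>0 + y\<^sub>0) * cnj (gabor_atom h y \<xi> (x - y\<^sub>0)) =
        cis (- (2 * pi * \<xi>\<^sub>0 * y)) * (g x * cnj (gabor_atom h (y\<^sub>0 + y) (\<xi>\<^sub>0 + \<xi>) x))"
      by (simp add: gabor_atom_def diff_diff_eq)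
  qed
  finally show ?thesis
    by (simp add: stft_def L2_inner_def)
qed

lemma stft_hess_shift:
  assumes h: "h \<in> schwartz" and g: "g \<in> borel_measurable borel"
  shows "stft_hess h (\<lambda>x. cis (- (2 * pi * \<xi>\<^sub>0 * x)) * g (x + y\<^sub>0)) y \<xi> = stft_hess h g (y\<^sub>0 + y) (\<xi>\<^sub>0 + \<xi>)"
proof -
  have "cmod (stft k (\<lambda>x. cis (- (2 * pi * \<xi>\<^sub>0 * x)) * g (x + y\<^sub>0)) y \<xi>) = cmod (stft k g (y\<^sub>0 + y) (\<xi>\<^sub>0 + \<xi>))"
    if "k \<in> schwartz" for k
    by (simp add: stft_shift[OF schwartz_measurable[OF that] g] norm_mult)
  then show ?thesis
    unfolding stft_hess_def stft_grad_def
    by (simp only: h schwartz_xmul schwartz_vderiv)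
qed

section \<open>Values at lattice points against means over cells\<close>

lemma power2_sum_le_weighted:
  fixes p q e :: real
  assumes "e > 0"
  shows "(p + q)\<^sup>2 \<le> (1 + e) * p\<^sup>2 + (1 + 1 / e) * q\<^sup>2"
proof -
  have "0 \<le> (e * p - q)\<^sup>2 / e" using assms by simp
  also have "\<dots> = e * p\<^sup>2 - 2 * p * q + q\<^sup>2 / e"
    using assms by (simp add: power2_eq_square field_simps)
  finally show ?thesis by (simp add: power2_sum algebra_simps)
qed

text \<open>A triangle inequality for squares that can be integrated over a cell and summed over the
  lattice term by term. The weight e stays free until the sums have been formed.\<close>

lemma norm_power2_le_weighted:
  assumes "e > 0" and "ennreal ((cmod (A - B))\<^sup>2) \<le> W"
  shows "ennreal ((cmod A)\<^sup>2) \<le> ennreal (1 + e) * ennreal ((cmod B)\<^sup>2) + ennreal (1 + 1 / e) * W"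
proof -
  have "(cmod A)\<^sup>2 \<le> (cmod B + cmod (A - B))\<^sup>2"
    by (intro power_mono norm_triangle_sub) simp
  also have "\<dots> \<le> (1 + e) * (cmod B)\<^sup>2 + (1 + 1 / e) * (cmod (A - B))\<^sup>2"
    by (rule power2_sum_le_weighted[OF assms(1)])
  finally have "ennreal ((cmod A)\<^sup>2) \<le> ennreal ((1 + e) * (cmod B)\<^sup>2 + (1 + 1 / e) * (cmod (A - B))\<^sup>2)"
    by (rule ennreal_leI)
  also have "\<dots> = ennreal (1 + e) * ennreal ((cmod B)\<^sup>2) + ennreal (1 + 1 / e) * ennreal ((cmod (A - B))\<^sup>2)"
    using assms(1) by (simp add: ennreal_plus[symmetric] ennreal_mult[symmetric] del: ennreal_plus)
  also have "\<dots> \<le> ennreal (1 + e) * ennreal ((cmod B)\<^sup>2) + ennreal (1 + 1 / e) * W"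
    by (intro add_left_mono mult_left_mono assms(2)) simp
  finally show ?thesis .
qed

text \<open>The constant 4 N is 2 L with L = 2 N, the bound on the matrix entries. Cauchy-Schwarz in
  each cell variable then moves the square inside the mean, so that summation over the lattice gives
  an integral over the plane that Moyal's identity controls.\<close>

lemma local_oscillation_le:
  assumes fin: "finite I" and f: "\<And>i. i \<in> I \<Longrightarrow> f i \<in> schwartz" and g: "\<And>i. i \<in> I \<Longrightarrow> g i \<in> L2"
    and abcd: "\<bar>a\<bar> \<le> 2 * N" "\<bar>b\<bar> \<le> 2 * N" "\<bar>c\<bar> \<le> 2 * N" "\<bar>d\<bar> \<le> 2 * N" and N: "N \<le> 1"
    and freq: "\<And>s t. \<bar>s\<bar> \<le> 1/2 \<Longrightarrow> \<bar>t\<bar> \<le> 1/2 \<Longrightarrow> \<bar>c * s + d * t\<bar> \<le> 1"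
    and s: "\<bar>s\<bar> \<le> 1/2" and t: "\<bar>t\<bar> \<le> 1/2"
  shows "ennreal ((cmod ((\<Sum>i\<in>I. stft (f i) (g i) (a * s + b * t) (c * s + d * t)) - (\<Sum>i\<in>I. stft (f i) (g i) 0 0)))\<^sup>2) \<le>
    ennreal ((4 * N)\<^sup>2) * (\<integral>\<^sup>+s. \<integral>\<^sup>+t. ennreal ((\<Sum>i\<in>I. stft_hess (f i) (g i) (a * s + b * t) (c * s + d * t))\<^sup>2) \<partial>cell \<partial>cell)"
proof -
  have N0: "N \<ge> 0" using abcd(1) by linarith
  let ?P = "\<lambda>s t. \<Sum>i\<in>I. stft_hess (f i) (g i) (a * s + b * t) (c * s + d * t)"
  have m: "(\<lambda>(s, t). stft_hess (f i) (g i) (a * s + b * t) (c * s + d * t)) \<in> borel_measurable (lborel \<Otimes>\<^sub>M lborel)"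
    if "i \<in> I" for i
    unfolding split_beta
    by (rule stft_hess_measurable[OF f[OF that] L2_measurable[OF g[OF that]]]) measurable
  then have [measurable]: "(\<lambda>(s, t). ?P s t) \<in> borel_measurable (borel \<Otimes>\<^sub>M borel)"
    unfolding split_beta by (intro borel_measurable_sum) (simp cong: measurable_cong_sets sets_pair_measure_cong)
  have m1: "(\<lambda>z. stft_hess (f i) (g i) (a * p z + b * q z) (c * p z + d * q z)) \<in> borel_measurable S"
    if "i \<in> I" "p \<in> borel_measurable S" "q \<in> borel_measurable S" for i p q and S :: "'b measure"
    by (rule stft_hess_measurable[OF f[OF that(1)] L2_measurable[OF g[OF that(1)]]])
      (use that(2,3) in measurable)
  have "ennreal (cmod ((\<Sum>i\<in>I. stft (f i) (g i) (a * s + b * t) (c * s + d * t)) - (\<Sum>i\<in>I. stft (f i) (g i) 0 0))) \<le>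
      ennreal (\<Sum>i\<in>I. cmod (stft (f i) (g i) (a * s + b * t) (c * s + d * t) - stft (f i) (g i) 0 0))"
    unfolding sum_subtractf[symmetric] by (intro ennreal_leI norm_sum)
  also have "\<dots> = (\<Sum>i\<in>I. ennreal (cmod (stft (f i) (g i) (a * s + b * t) (c * s + d * t) - stft (f i) (g i) 0 0)))"
    by simp
  also have "\<dots> \<le> (\<Sum>i\<in>I. 2 * ennreal (2 * N) *
      (\<integral>\<^sup>+s. \<integral>\<^sup>+t. ennreal (stft_hess (f i) (g i) (a * s + b * t) (c * s + d * t)) \<partial>cell \<partial>cell))"
    using N by (intro sum_mono stft_oscillation_le[OF f g abcd _ freq s t]) auto
  also have "\<dots> = ennreal (4 * N) * (\<Sum>i\<in>I.
      (\<integral>\<^sup>+s. \<integral>\<^sup>+t. ennreal (stft_hess (f i) (g i) (a * s + b * t) (c * s + d * t)) \<partial>cell \<partial>cell))"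
  proof -
    have "2 * ennreal (2 * N) = ennreal (4 * N)"
      using N0 by (simp add: ennreal_mult)
    then show ?thesis by (simp add: sum_distrib_left)
  qed
  also have "(\<Sum>i\<in>I. (\<integral>\<^sup>+s. \<integral>\<^sup>+t. ennreal (stft_hess (f i) (g i) (a * s + b * t) (c * s + d * t)) \<partial>cell \<partial>cell)) =
      (\<integral>\<^sup>+s. \<integral>\<^sup>+t. ennreal (?P s t) \<partial>cell \<partial>cell)"
  proof -
    have "(\<integral>\<^sup>+s. \<integral>\<^sup>+t. ennreal (?P s t) \<partial>cell \<partial>cell) =
        (\<integral>\<^sup>+s. (\<Sum>i\<in>I. \<integral>\<^sup>+t. ennreal (stft_hess (f i) (g i) (a * s + b * t) (c * s + d * t)) \<partial>cell) \<partial>cell)"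
      by (subst nn_integral_sum[symmetric]) (auto intro!: measurable_compose[OF _ measurable_ennreal] m1)
    also have "\<dots> = (\<Sum>i\<in>I. (\<integral>\<^sup>+s. \<integral>\<^sup>+t. ennreal (stft_hess (f i) (g i) (a * s + b * t) (c * s + d * t)) \<partial>cell \<partial>cell))"
      by (intro nn_integral_sum cell.borel_measurable_nn_integral)
        (unfold split_beta, intro measurable_compose[OF _ measurable_ennreal] m1, auto)
    finally show ?thesis by simp
  qed
  finally have "(ennreal (cmod ((\<Sum>i\<in>I. stft (f i) (g i) (a * s + b * t) (c * s + d * t)) - (\<Sum>i\<in>I. stft (f i) (g i) 0 0))))\<^sup>2 \<le>
      (ennreal (4 * N) * (\<integral>\<^sup>+s. \<integral>\<^sup>+t. ennreal (?P s t) \<partial>cell \<partial>cell))\<^sup>2"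
    by (intro power_mono) auto
  also have "\<dots> = ennreal ((4 * N)\<^sup>2) * (\<integral>\<^sup>+s. \<integral>\<^sup>+t. ennreal (?P s t) \<partial>cell \<partial>cell)\<^sup>2"
    using N0 by (simp add: power_mult_distrib ennreal_power)
  also have "(\<integral>\<^sup>+s. \<integral>\<^sup>+t. ennreal (?P s t) \<partial>cell \<partial>cell)\<^sup>2 \<le> (\<integral>\<^sup>+s. (\<integral>\<^sup>+t. ennreal (?P s t) \<partial>cell)\<^sup>2 \<partial>cell)"
    by (rule nn_integral_cell_power2_le) measurable
  also have "\<dots> \<le> (\<integral>\<^sup>+s. \<integral>\<^sup>+t. (ennreal (?P s t))\<^sup>2 \<partial>cell \<partial>cell)"
    by (intro nn_integral_mono nn_integral_cell_power2_le) measurable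
  also have "\<dots> = (\<integral>\<^sup>+s. \<integral>\<^sup>+t. ennreal ((?P s t)\<^sup>2) \<partial>cell \<partial>cell)"
    by (simp add: ennreal_power sum_nonneg)
  finally show ?thesis
    by (simp add: ennreal_power mult_left_mono)
qed

text \<open>The witness is \<open>card I * sum K I\<close>: the cardinality comes from
  Cauchy-Schwarz for the square of the sum, and \<open>sum K I\<close> is a common bound for the
  constants \<open>K i\<close>.\<close>

lemma moyal_bounded_sum:
  assumes fin: "finite I" and R: "\<And>i. i \<in> I \<Longrightarrow> moyal_bounded (R i)"
  shows "\<exists>K\<ge>0. \<forall>g. (\<forall>i\<in>I. g i \<in> L2) \<longrightarrow>
    (\<integral>\<^sup>+y. \<integral>\<^sup>+\<xi>. ennreal ((\<Sum>i\<in>I. R i (g i) y \<xi>)\<^sup>2) \<partial>lborel \<partial>lborel) \<le>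
      ennreal (K * (\<Sum>i\<in>I. LINT x|lborel. (cmod (g i x))\<^sup>2))"
proof -
  have "\<forall>i\<in>I. \<exists>K\<ge>0. \<forall>g\<in>L2. (\<integral>\<^sup>+y. \<integral>\<^sup>+\<xi>. ennreal ((R i g y \<xi>)\<^sup>2) \<partial>lborel \<partial>lborel) \<le>
        ennreal (K * (LINT x|lborel. (cmod (g x))\<^sup>2))"
    using R unfolding moyal_bounded_def by blast
  then obtain K where K: "\<And>i. i \<in> I \<Longrightarrow> K i \<ge> 0" "\<And>i g. i \<in> I \<Longrightarrow> g \<in> L2 \<Longrightarrow>
      (\<integral>\<^sup>+y. \<integral>\<^sup>+\<xi>. ennreal ((R i g y \<xi>)\<^sup>2) \<partial>lborel \<partial>lborel) \<le> ennreal (K i * (LINT x|lborel. (cmod (g x))\<^sup>2))"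
    unfolding bchoice_iff by blast
  have "(\<integral>\<^sup>+y. \<integral>\<^sup>+\<xi>. ennreal ((\<Sum>i\<in>I. R i (g i) y \<xi>)\<^sup>2) \<partial>lborel \<partial>lborel) \<le>
      ennreal (real (card I) * sum K I * (\<Sum>i\<in>I. LINT x|lborel. (cmod (g i x))\<^sup>2))"
    if g: "\<forall>i\<in>I. g i \<in> L2" for g
  proof -
    have [measurable]: "(\<lambda>(y, \<xi>). R i (g i) y \<xi>) \<in> borel_measurable (lborel \<Otimes>\<^sub>M lborel)" if "i \<in> I" for i
      using R[OF that] g that unfolding moyal_bounded_def by blast
    have "(\<integral>\<^sup>+y. \<integral>\<^sup>+\<xi>. ennreal ((\<Sum>i\<in>I. R i (g i) y \<xi>)\<^sup>2) \<partial>lborel \<partial>lborel) \<le>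
        (\<integral>\<^sup>+y. \<integral>\<^sup>+\<xi>. ennreal (real (card I)) * (\<Sum>i\<in>I. ennreal ((R i (g i) y \<xi>)\<^sup>2)) \<partial>lborel \<partial>lborel)"
    proof (intro nn_integral_mono)
      fix y \<xi>
      have "(\<Sum>i\<in>I. R i (g i) y \<xi>)\<^sup>2 \<le> real (card I) * (\<Sum>i\<in>I. (R i (g i) y \<xi>)\<^sup>2)"
        using sum_squared_le_sum_of_squares[of "\<lambda>i. R i (g i) y \<xi>" I] by (simp add: mult.commute)
      from ennreal_leI[OF this]
      show "ennreal ((\<Sum>i\<in>I. R i (g i) y \<xi>)\<^sup>2) \<le> ennreal (real (card I)) * (\<Sum>i\<in>I. ennreal ((R i (g i) y \<xi>)\<^sup>2))"
        by (simp add: ennreal_mult sum_nonneg)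
    qed
    also have "\<dots> = ennreal (real (card I)) * (\<Sum>i\<in>I. \<integral>\<^sup>+y. \<integral>\<^sup>+\<xi>. ennreal ((R i (g i) y \<xi>)\<^sup>2) \<partial>lborel \<partial>lborel)"
      by (simp add: nn_integral_cmult nn_integral_sum del: sum_ennreal)
    also have "\<dots> \<le> ennreal (real (card I)) * (\<Sum>i\<in>I. ennreal (K i * (LINT x|lborel. (cmod (g i x))\<^sup>2)))"
      using g by (intro mult_left_mono sum_mono K(2)) auto
    also have "\<dots> = ennreal (real (card I) * (\<Sum>i\<in>I. K i * (LINT x|lborel. (cmod (g i x))\<^sup>2)))"
      using K(1) by (simp add: ennreal_mult[symmetric] sum_nonneg)
    also have "\<dots> \<le> ennreal (real (card I) * (\<Sum>i\<in>I. sum K I * (LINT x|lborel. (cmod (g i x))\<^sup>2)))"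
      using K(1) fin
      by (intro ennreal_leI mult_left_mono sum_mono mult_right_mono) (auto intro: member_le_sum)
    finally show ?thesis by (simp only: sum_distrib_left[symmetric] mult.assoc)
  qed
  then show ?thesis
    using K(1) by (intro exI[of _ "real (card I) * sum K I"]) (auto intro!: mult_nonneg_nonneg sum_nonneg)
qed

lemma sampling_estimates:
  assumes fin: "finite I" and f: "\<And>i. i \<in> I \<Longrightarrow> f i \<in> schwartz" and g: "\<And>i. i \<in> I \<Longrightarrow> g i \<in> L2"
    and abcd: "\<bar>a\<bar> \<le> 2 * N" "\<bar>b\<bar> \<le> 2 * N" "\<bar>c\<bar> \<le> 2 * N" "\<bar>d\<bar> \<le> 2 * N" and N: "N \<le> 1"
    and freq: "\<And>s t. \<bar>s\<bar> \<le> 1/2 \<Longrightarrow> \<bar>t\<bar> \<le> 1/2 \<Longrightarrow> \<bar>c * s + d * t\<bar> \<le> 1"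
    and e: "e > 0"
  fixes y \<xi> :: real
  defines "V \<equiv> \<lambda>s t. \<Sum>i\<in>I. stft (f i) (g i) (y + (a * s + b * t)) (\<xi> + (c * s + d * t))"
    and "P \<equiv> \<lambda>s t. \<Sum>i\<in>I. stft_hess (f i) (g i) (y + (a * s + b * t)) (\<xi> + (c * s + d * t))"
  defines "H \<equiv> ennreal ((4 * N)\<^sup>2) * (\<integral>\<^sup>+s. \<integral>\<^sup>+t. ennreal ((P s t)\<^sup>2) \<partial>cell \<partial>cell)"
  shows "ennreal ((cmod (V 0 0))\<^sup>2) \<le>
      ennreal (1 + e) * (\<integral>\<^sup>+s. \<integral>\<^sup>+t. ennreal ((cmod (V s t))\<^sup>2) \<partial>cell \<partial>cell) + ennreal (1 + 1 / e) * H"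
    and "(\<integral>\<^sup>+s. \<integral>\<^sup>+t. ennreal ((cmod (V s t))\<^sup>2) \<partial>cell \<partial>cell) \<le>
      ennreal (1 + e) * ennreal ((cmod (V 0 0))\<^sup>2) + ennreal (1 + 1 / e) * H"
proof -
  have mf: "f i \<in> borel_measurable borel" and mg: "g i \<in> borel_measurable borel" if "i \<in> I" for i
    using f[OF that] g[OF that] by measurable
  \<comment> \<open>Each component of g is translated and modulated so that the point (y, \<xi>)
    moves to the origin, where the local estimate holds. The resulting phase is the same for all
    components and equals 1 at s = t = 0; elsewhere it disappears when the modulus is taken.\<close>
  define G where "G i x = cis (- (2 * pi * \<xi> * x)) * g i (x + y)" for i x
  have GL2: "G i \<in> L2" if "i \<in> I" for i
    unfolding G_def using L2_mult_cis[OF L2_shift[OF g[OF that], of "- y"], of "\<lambda>x. - (2 * pi * \<xi> * x)"] by simp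
  have Gst: "stft (f i) (G i) p q = cis (- (2 * pi * \<xi> * p)) * stft (f i) (g i) (y + p) (\<xi> + q)" if "i \<in> I" for i p q
    unfolding G_def by (rule stft_shift[OF mf[OF that] mg[OF that]])
  have GV: "(\<Sum>i\<in>I. stft (f i) (G i) (a * s + b * t) (c * s + d * t)) = cis (- (2 * pi * \<xi> * (a * s + b * t))) * V s t" for s t
    unfolding V_def sum_distrib_left by (intro sum.cong refl Gst)
  have GV0: "(\<Sum>i\<in>I. stft (f i) (G i) 0 0) = V 0 0"
    unfolding V_def by (intro sum.cong refl) (simp add: Gst)
  have GP: "(\<Sum>i\<in>I. stft_hess (f i) (G i) (a * s + b * t) (c * s + d * t)) = P s t" for s t
    unfolding P_def G_def by (intro sum.cong refl stft_hess_shift f mg)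
  have osc: "ennreal ((cmod (cis (- (2 * pi * \<xi> * (a * s + b * t))) * V s t - V 0 0))\<^sup>2) \<le> H"
    if "\<bar>s\<bar> \<le> 1/2" "\<bar>t\<bar> \<le> 1/2" for s t
    unfolding H_def GV[symmetric] GV0[symmetric] GP[symmetric]
    by (rule local_oscillation_le[OF fin _ _ abcd N]) (use f GL2 freq that in auto)
  have [measurable]: "(\<lambda>(s, t). V s t) \<in> borel_measurable (borel \<Otimes>\<^sub>M borel)"
  proof -
    note [measurable] = mf mg
    show ?thesis unfolding V_def by measurable
  qed
  have "ennreal ((cmod (V 0 0))\<^sup>2) = (\<integral>\<^sup>+s. \<integral>\<^sup>+t. ennreal ((cmod (V 0 0))\<^sup>2) \<partial>cell \<partial>cell)" by simp
  also have "\<dots> \<le> (\<integral>\<^sup>+s. \<integral>\<^sup>+t. ennreal (1 + e) * ennreal ((cmod (V s t))\<^sup>2) + ennreal (1 + 1 / e) * H \<partial>cell \<partial>cell)"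
  proof (intro nn_integral_cell_mono)
    fix s t :: real assume "\<bar>s\<bar> \<le> 1/2" "\<bar>t\<bar> \<le> 1/2"
    from norm_power2_le_weighted[OF e osc[OF this, unfolded norm_minus_commute[of _ "V 0 0"]]]
    show "ennreal ((cmod (V 0 0))\<^sup>2) \<le> ennreal (1 + e) * ennreal ((cmod (V s t))\<^sup>2) + ennreal (1 + 1 / e) * H"
      by (simp add: norm_mult)
  qed
  also have "\<dots> = ennreal (1 + e) * (\<integral>\<^sup>+s. \<integral>\<^sup>+t. ennreal ((cmod (V s t))\<^sup>2) \<partial>cell \<partial>cell) + ennreal (1 + 1 / e) * H"
    by (simp add: nn_integral_add nn_integral_cmult)
  finally show "ennreal ((cmod (V 0 0))\<^sup>2) \<le>
      ennreal (1 + e) * (\<integral>\<^sup>+s. \<integral>\<^sup>+t. ennreal ((cmod (V s t))\<^sup>2) \<partial>cell \<partial>cell) + ennreal (1 + 1 / e) * H" .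
  have "(\<integral>\<^sup>+s. \<integral>\<^sup>+t. ennreal ((cmod (V s t))\<^sup>2) \<partial>cell \<partial>cell) \<le>
      (\<integral>\<^sup>+s. \<integral>\<^sup>+t. ennreal (1 + e) * ennreal ((cmod (V 0 0))\<^sup>2) + ennreal (1 + 1 / e) * H \<partial>cell \<partial>cell)"
  proof (intro nn_integral_cell_mono)
    fix s t :: real assume "\<bar>s\<bar> \<le> 1/2" "\<bar>t\<bar> \<le> 1/2"
    from norm_power2_le_weighted[OF e osc[OF this]]
    show "ennreal ((cmod (V s t))\<^sup>2) \<le> ennreal (1 + e) * ennreal ((cmod (V 0 0))\<^sup>2) + ennreal (1 + 1 / e) * H"
      by (simp add: norm_mult)
  qed
  then show "(\<integral>\<^sup>+s. \<integral>\<^sup>+t. ennreal ((cmod (V s t))\<^sup>2) \<partial>cell \<partial>cell) \<le>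
      ennreal (1 + e) * ennreal ((cmod (V 0 0))\<^sup>2) + ennreal (1 + 1 / e) * H"
    by simp
qed

text \<open>The optimal weights are \<open>e = r\<close> for the upper and \<open>e = r / (1 - r)\<close> for the lower bound.\<close>

lemma frame_bounds_from_estimates:
  fixes X :: ennreal and Y r :: real
  assumes r: "0 < r" "r < 1" and Y: "Y \<ge> 0" and E: "E \<le> ennreal (r\<^sup>2 * Y)"
    and up: "\<And>e. e > 0 \<Longrightarrow> X \<le> ennreal (1 + e) * ennreal Y + ennreal (1 + 1 / e) * E"
    and low: "\<And>e. e > 0 \<Longrightarrow> ennreal Y \<le> ennreal (1 + e) * X + ennreal (1 + 1 / e) * E"
  shows "ennreal ((1 - r)\<^sup>2 * Y) \<le> X" and "X \<le> ennreal ((1 + r)\<^sup>2 * Y)"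
proof -
  have "X \<le> ennreal (1 + r) * ennreal Y + ennreal (1 + 1 / r) * ennreal (r\<^sup>2 * Y)"
    by (rule order_trans[OF up[OF r(1)]]) (intro add_left_mono mult_left_mono E zero_le)
  also have "\<dots> = ennreal ((1 + r) * Y + (1 + 1 / r) * (r\<^sup>2 * Y))"
    using r Y by (simp add: ennreal_plus[symmetric] ennreal_mult[symmetric] del: ennreal_plus)
  also have "(1 + r) * Y + (1 + 1 / r) * (r\<^sup>2 * Y) = (1 + r)\<^sup>2 * Y"
    using r by (simp add: field_simps power2_eq_square)
  finally show X: "X \<le> ennreal ((1 + r)\<^sup>2 * Y)" .
  \<comment> \<open>The upper bound makes X finite, so the lower bound can be solved for it in the
    reals.\<close>
  then obtain x where x: "x \<ge> 0" "X = ennreal x"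
    using neq_top_trans[of "ennreal ((1 + r)\<^sup>2 * Y)" X] by (cases X) auto
  define e where "e = r / (1 - r)"
  have e: "e > 0" using r by (simp add: e_def)
  have "ennreal Y \<le> ennreal (1 + e) * X + ennreal (1 + 1 / e) * ennreal (r\<^sup>2 * Y)"
    by (rule order_trans[OF low[OF e]]) (intro add_left_mono mult_left_mono E zero_le)
  also have "\<dots> = ennreal ((1 + e) * x + (1 + 1 / e) * (r\<^sup>2 * Y))"
    using e x Y by (simp add: ennreal_plus[symmetric] ennreal_mult[symmetric] del: ennreal_plus)
  finally have "Y \<le> (1 + e) * x + (1 + 1 / e) * (r\<^sup>2 * Y)"
    by (subst (asm) ennreal_le_iff) (use e x Y in auto)
  also have "1 + e = 1 / (1 - r)" using r by (simp add: e_def field_simps)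
  also have "(1 + 1 / e) * (r\<^sup>2 * Y) = r * Y" using r by (simp add: e_def field_simps power2_eq_square)
  finally have "(1 - r) * Y \<le> x / (1 - r)" by (simp add: algebra_simps)
  then have "(1 - r) * Y * (1 - r) \<le> x" using r by (simp add: pos_le_divide_eq)
  then show "ennreal ((1 - r)\<^sup>2 * Y) \<le> X"
    unfolding x(2) by (intro ennreal_leI) (simp add: power2_eq_square mult_ac)
qed

text \<open>C is determined by the windows alone, since K bounds the majorant for all g at once. For
  a given matrix the tiling divides both Moyal estimates by |det|: the cell means sum to
  \<open>G / D\<close> and the error is at most (N / C)^2 times that, which is the situation of
  \<open>frame_bounds_from_estimates\<close> with r = N / C.\<close>

lemma sampling_theorem:
  assumes fin: "finite I" and f: "\<And>i. i \<in> I \<Longrightarrow> f i \<in> schwartz"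
    and orth: "\<And>i j. i \<in> I \<Longrightarrow> j \<in> I \<Longrightarrow> L2_inner (f i) (f j) = (if i = j then 1 else 0)"
  obtains C where "0 < C" "C \<le> 1"
    "\<And>a b c d N g. 0 < N \<Longrightarrow> N < C \<Longrightarrow>
      \<bar>a\<bar> \<le> 2 * N \<Longrightarrow> \<bar>b\<bar> \<le> 2 * N \<Longrightarrow> \<bar>c\<bar> \<le> 2 * N \<Longrightarrow> \<bar>d\<bar> \<le> 2 * N \<Longrightarrow>
      (\<And>s t. \<bar>s\<bar> \<le> 1/2 \<Longrightarrow> \<bar>t\<bar> \<le> 1/2 \<Longrightarrow> \<bar>c * s + d * t\<bar> \<le> N) \<Longrightarrow>
      a * d - b * c \<noteq> 0 \<Longrightarrow> (\<And>i. i \<in> I \<Longrightarrow> g i \<in> L2) \<Longrightarrow>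
      ennreal ((1 - N / C)\<^sup>2 * ((\<Sum>i\<in>I. LINT x|lborel. (cmod (g i x))\<^sup>2) / \<bar>a * d - b * c\<bar>)) \<le>
        (\<integral>\<^sup>+k. ennreal ((cmod (\<Sum>i\<in>I. stft (f i) (g i) (a * of_int (fst k) + b * of_int (snd k))
          (c * of_int (fst k) + d * of_int (snd k))))\<^sup>2) \<partial>count_space UNIV) \<and>
      (\<integral>\<^sup>+k. ennreal ((cmod (\<Sum>i\<in>I. stft (f i) (g i) (a * of_int (fst k) + b * of_int (snd k))
          (c * of_int (fst k) + d * of_int (snd k))))\<^sup>2) \<partial>count_space UNIV) \<le>
        ennreal ((1 + N / C)\<^sup>2 * ((\<Sum>i\<in>I. LINT x|lborel. (cmod (g i x))\<^sup>2) / \<bar>a * d - b * c\<bar>))"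
proof -
  have "\<exists>K\<ge>0. \<forall>g. (\<forall>i\<in>I. g i \<in> L2) \<longrightarrow>
      (\<integral>\<^sup>+y. \<integral>\<^sup>+\<xi>. ennreal ((\<Sum>i\<in>I. stft_hess (f i) (g i) y \<xi>)\<^sup>2) \<partial>lborel \<partial>lborel) \<le>
      ennreal (K * (\<Sum>i\<in>I. LINT x|lborel. (cmod (g i x))\<^sup>2))"
    by (rule moyal_bounded_sum[OF fin]) (intro moyal_bounded_hess f)
  then obtain K where K0: "K \<ge> 0" and K: "\<And>g. (\<And>i. i \<in> I \<Longrightarrow> g i \<in> L2) \<Longrightarrow>
      (\<integral>\<^sup>+y. \<integral>\<^sup>+\<xi>. ennreal ((\<Sum>i\<in>I. stft_hess (f i) (g i) y \<xi>)\<^sup>2) \<partial>lborel \<partial>lborel) \<le>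
      ennreal (K * (\<Sum>i\<in>I. LINT x|lborel. (cmod (g i x))\<^sup>2))"
    by blast
  have "\<forall>i\<in>I. \<exists>B. \<forall>x. cmod (f i x) \<le> B"
    by (meson schwartz_bounded f)
  then obtain B where B: "\<And>i x. i \<in> I \<Longrightarrow> cmod (f i x) \<le> B i"
    unfolding bchoice_iff by blast
  \<comment> \<open>Chosen so that 4 sqrt K \<le> 1 / C, which turns the error factor (4 N)^2 K into
    at most (N / C)^2. The summand 1 gives C \<le> 1, used for the frequency bound, and covers K =
    0.\<close>
  define C where "C = 1 / (1 + 4 * sqrt K)"
  have C: "0 < C" "C \<le> 1" "4 * sqrt K \<le> 1 / C"
    using K0 by (auto simp: C_def add_pos_nonneg)
  show thesis
  proof (rule that[OF C(1,2)])
    fix a b c d N :: real and g :: "'a \<Rightarrow> real \<Rightarrow> complex"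
    assume N: "0 < N" "N < C" and abcd: "\<bar>a\<bar> \<le> 2 * N" "\<bar>b\<bar> \<le> 2 * N" "\<bar>c\<bar> \<le> 2 * N" "\<bar>d\<bar> \<le> 2 * N"
      and freq: "\<And>s t. \<bar>s\<bar> \<le> 1/2 \<Longrightarrow> \<bar>t\<bar> \<le> 1/2 \<Longrightarrow> \<bar>c * s + d * t\<bar> \<le> N"
      and det: "a * d - b * c \<noteq> 0" and g: "\<And>i. i \<in> I \<Longrightarrow> g i \<in> L2"
    define G where "G = (\<Sum>i\<in>I. LINT x|lborel. (cmod (g i x))\<^sup>2)"
    define D where "D = \<bar>a * d - b * c\<bar>"
    have G0: "G \<ge> 0" unfolding G_def by (intro sum_nonneg) auto
    have D0: "D > 0" using det by (simp add: D_def)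
    have N1: "N \<le> 1" using N C by simp
    have freq1: "\<bar>c * s + d * t\<bar> \<le> 1" if "\<bar>s\<bar> \<le> 1/2" "\<bar>t\<bar> \<le> 1/2" for s t
      using freq[OF that] N1 by simp
    have mf: "f i \<in> borel_measurable borel" and mg: "g i \<in> borel_measurable borel" if "i \<in> I" for i
      using f[OF that] g[OF that] by measurable
    have mV: "(\<lambda>(y, \<xi>). ennreal ((cmod (\<Sum>i\<in>I. stft (f i) (g i) y \<xi>))\<^sup>2)) \<in> borel_measurable (lborel \<Otimes>\<^sub>M lborel)"
    proof -
      note [measurable] = mf mg
      show ?thesis by measurable
    qed
    have mP: "(\<lambda>(y, \<xi>). ennreal ((\<Sum>i\<in>I. stft_hess (f i) (g i) y \<xi>)\<^sup>2)) \<in> borel_measurable (lborel \<Otimes>\<^sub>M lborel)"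
    proof -
      have "(\<lambda>z. stft_hess (f i) (g i) (fst z) (snd z)) \<in> borel_measurable (lborel \<Otimes>\<^sub>M lborel)" if "i \<in> I" for i
        by (rule stft_hess_measurable[OF f[OF that] mg[OF that]]) auto
      then have "(\<lambda>z. \<Sum>i\<in>I. stft_hess (f i) (g i) (fst z) (snd z)) \<in> borel_measurable (lborel \<Otimes>\<^sub>M lborel)"
        by (rule borel_measurable_sum)
      then show ?thesis unfolding split_beta by measurable
    qed
    let ?y = "\<lambda>k :: int \<times> int. a * of_int (fst k) + b * of_int (snd k)"
    let ?\<xi> = "\<lambda>k :: int \<times> int. c * of_int (fst k) + d * of_int (snd k)"
    define V where "V k s t = (\<Sum>i\<in>I. stft (f i) (g i) (?y k + (a * s + b * t)) (?\<xi> k + (c * s + d * t)))" for k s t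
    define P where "P k s t = (\<Sum>i\<in>I. stft_hess (f i) (g i) (?y k + (a * s + b * t)) (?\<xi> k + (c * s + d * t)))" for k s t
    define X where "X = (\<integral>\<^sup>+k. ennreal ((cmod (V k 0 0))\<^sup>2) \<partial>count_space UNIV)"
    define Y where "Y = (\<integral>\<^sup>+k. \<integral>\<^sup>+s. \<integral>\<^sup>+t. ennreal ((cmod (V k s t))\<^sup>2) \<partial>cell \<partial>cell \<partial>count_space UNIV)"
    define H where "H = (\<integral>\<^sup>+k. \<integral>\<^sup>+s. \<integral>\<^sup>+t. ennreal ((P k s t)\<^sup>2) \<partial>cell \<partial>cell \<partial>count_space UNIV)"
    define E where "E = ennreal ((4 * N)\<^sup>2) * H"
    \<comment> \<open>The tiling formula read from right to left, followed by Moyal's identity.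
      Dividing by D > 0 afterwards has to exclude an infinite Y, which the finite right side
      does.\<close>
    have "ennreal D * Y = ennreal G"
      unfolding Y_def V_def D_def G_def
      by (subst nn_integral_eq_sum_lattice_cells[OF mV det, symmetric], rule moyal_orthonormal[OF fin])
        (use g schwartz_L2 f B orth in auto)
    then have Y: "Y = ennreal (G / D)"
    proof (cases Y)
      case (real y)
      then have "D * y = G" using \<open>ennreal D * Y = ennreal G\<close> D0 G0
        by (simp add: ennreal_mult[symmetric])
      then have "y = G / D" using D0 by (auto simp: field_simps)
      then show ?thesis using real by simp
    qed (use D0 in \<open>auto simp: ennreal_mult_top\<close>)
    have "ennreal D * H \<le> ennreal (K * G)"
      unfolding H_def P_def D_def G_def
      by (subst nn_integral_eq_sum_lattice_cells[OF mP det, symmetric], rule K) (rule g)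
    then have H: "H \<le> ennreal (K * (G / D))"
    proof (cases H)
      case (real h)
      then have "D * h \<le> K * G" using \<open>ennreal D * H \<le> ennreal (K * G)\<close> D0 G0 K0
        by (simp add: ennreal_mult[symmetric])
      then show ?thesis using real D0 by (auto intro!: ennreal_leI simp: field_simps)
    qed (use D0 in \<open>auto simp: ennreal_mult_top top_unique\<close>)
    have "(4 * N)\<^sup>2 * K \<le> (N / C)\<^sup>2"
    proof -
      have "(4 * sqrt K * N)\<^sup>2 \<le> (1 / C * N)\<^sup>2"
        using C(3) N K0 by (intro power_mono mult_right_mono) auto
      then show ?thesis using K0 by (simp add: power_mult_distrib power_divide mult_ac)
    qed
    then have "(4 * N)\<^sup>2 * K * (G / D) \<le> (N / C)\<^sup>2 * (G / D)"
      using G0 D0 by (intro mult_right_mono) auto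
    then have E: "E \<le> ennreal ((N / C)\<^sup>2 * (G / D))"
      unfolding E_def using K0 G0 D0
      by (intro order_trans[OF mult_left_mono[OF H]]) (auto simp: ennreal_mult[symmetric] mult.assoc intro!: ennreal_leI)
    have est: "ennreal ((cmod (V k 0 0))\<^sup>2) \<le> ennreal (1 + e) * (\<integral>\<^sup>+s. \<integral>\<^sup>+t. ennreal ((cmod (V k s t))\<^sup>2) \<partial>cell \<partial>cell) +
          ennreal (1 + 1 / e) * (ennreal ((4 * N)\<^sup>2) * (\<integral>\<^sup>+s. \<integral>\<^sup>+t. ennreal ((P k s t)\<^sup>2) \<partial>cell \<partial>cell))"
      "(\<integral>\<^sup>+s. \<integral>\<^sup>+t. ennreal ((cmod (V k s t))\<^sup>2) \<partial>cell \<partial>cell) \<le> ennreal (1 + e) * ennreal ((cmod (V k 0 0))\<^sup>2) +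
          ennreal (1 + 1 / e) * (ennreal ((4 * N)\<^sup>2) * (\<integral>\<^sup>+s. \<integral>\<^sup>+t. ennreal ((P k s t)\<^sup>2) \<partial>cell \<partial>cell))"
      if "e > 0" for k e
      unfolding V_def P_def
      by (rule sampling_estimates[OF fin _ _ abcd N1 _ that]; use f g freq1 in blast)+
    have up: "X \<le> ennreal (1 + e) * ennreal (G / D) + ennreal (1 + 1 / e) * E" if e: "e > 0" for e
    proof -
      have "X \<le> (\<integral>\<^sup>+k. ennreal (1 + e) * (\<integral>\<^sup>+s. \<integral>\<^sup>+t. ennreal ((cmod (V k s t))\<^sup>2) \<partial>cell \<partial>cell) +
          ennreal (1 + 1 / e) * (ennreal ((4 * N)\<^sup>2) * (\<integral>\<^sup>+s. \<integral>\<^sup>+t. ennreal ((P k s t)\<^sup>2) \<partial>cell \<partial>cell)) \<partial>count_space UNIV)"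
        unfolding X_def by (intro nn_integral_mono est(1) e)
      also have "\<dots> = ennreal (1 + e) * Y + ennreal (1 + 1 / e) * E"
        unfolding Y_def E_def H_def by (simp add: nn_integral_add nn_integral_cmult)
      finally show ?thesis by (simp only: Y)
    qed
    have low: "ennreal (G / D) \<le> ennreal (1 + e) * X + ennreal (1 + 1 / e) * E" if e: "e > 0" for e
    proof -
      have "Y \<le> (\<integral>\<^sup>+k. ennreal (1 + e) * ennreal ((cmod (V k 0 0))\<^sup>2) +
          ennreal (1 + 1 / e) * (ennreal ((4 * N)\<^sup>2) * (\<integral>\<^sup>+s. \<integral>\<^sup>+t. ennreal ((P k s t)\<^sup>2) \<partial>cell \<partial>cell)) \<partial>count_space UNIV)"
        unfolding Y_def by (intro nn_integral_mono est(2) e)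
      also have "\<dots> = ennreal (1 + e) * X + ennreal (1 + 1 / e) * E"
        unfolding X_def E_def H_def by (simp add: nn_integral_add nn_integral_cmult)
      finally show ?thesis by (simp only: Y)
    qed
    have "0 < N / C" "N / C < 1" "G / D \<ge> 0" using N C G0 D0 by simp_all
    note fb = frame_bounds_from_estimates[OF this E]
    have "ennreal ((1 - N / C)\<^sup>2 * (G / D)) \<le> X"
      by (rule fb(1)) (erule up, erule low)
    moreover have "X \<le> ennreal ((1 + N / C)\<^sup>2 * (G / D))"
      by (rule fb(2)) (erule up, erule low)
    ultimately show "ennreal ((1 - N / C)\<^sup>2 * ((\<Sum>i\<in>I. LINT x|lborel. (cmod (g i x))\<^sup>2) / \<bar>a * d - b * c\<bar>)) \<le>
        (\<integral>\<^sup>+k. ennreal ((cmod (\<Sum>i\<in>I. stft (f i) (g i) (?y k) (?\<xi> k)))\<^sup>2) \<partial>count_space UNIV) \<and>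
      (\<integral>\<^sup>+k. ennreal ((cmod (\<Sum>i\<in>I. stft (f i) (g i) (?y k) (?\<xi> k)))\<^sup>2) \<partial>count_space UNIV) \<le>
        ennreal ((1 + N / C)\<^sup>2 * ((\<Sum>i\<in>I. LINT x|lborel. (cmod (g i x))\<^sup>2) / \<bar>a * d - b * c\<bar>))"
      unfolding X_def V_def G_def D_def by simp
  qed
qed

section \<open>Frame bounds\<close>

text \<open>The supremum in \<open>matrix_norm\<close> is an upper bound only once the set is known
  to be bounded; the operator norm and the comparison of the Euclidean norm with
  \<open>infnorm\<close> provide that.\<close>

lemma norm_le_matrix_norm:
  assumes "infnorm z \<le> 1/2"
  shows "norm (M *v z) \<le> matrix_norm M"
  unfolding matrix_norm_def
proof (rule cSUP_upper)
  show "bdd_above ((\<lambda>z. norm (M *v z)) ` {z. infnorm z \<le> 1/2})"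
  proof (rule bdd_aboveI2)
    fix z :: "real ^ 2" assume "z \<in> {z. infnorm z \<le> 1/2}"
    then have z: "infnorm z \<le> 1/2" by simp
    have "norm (M *v z) \<le> onorm ((*v) M) * norm z"
      by (rule onorm) simp
    also have "\<dots> \<le> onorm ((*v) M) * (sqrt DIM(real ^ 2) * (1/2))"
      using order_trans[OF norm_le_infnorm[of z] mult_left_mono[OF z, of "sqrt DIM(real ^ 2)"]]
      by (intro mult_left_mono onorm_pos_le) simp_all
    finally show "norm (M *v z) \<le> onorm ((*v) M) * (sqrt DIM(real ^ 2) * (1/2))" .
  qed
qed (use assms in simp)

lemma matrix_vector_mult_2:
  fixes M :: "real ^ 2 ^ 2"
  shows "(M *v vector [s, t]) $ 1 = M $ 1 $ 1 * s + M $ 1 $ 2 * t"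
    and "(M *v vector [s, t]) $ 2 = M $ 2 $ 1 * s + M $ 2 $ 2 * t"
  by (simp_all add: matrix_vector_mult_def sum_2 vector_2)

lemma matrix_norm_bounds:
  fixes M :: "real ^ 2 ^ 2"
  assumes "\<bar>s\<bar> \<le> 1/2" "\<bar>t\<bar> \<le> 1/2"
  shows "\<bar>M $ 1 $ 1 * s + M $ 1 $ 2 * t\<bar> \<le> matrix_norm M"
    and "\<bar>M $ 2 $ 1 * s + M $ 2 $ 2 * t\<bar> \<le> matrix_norm M"
proof -
  have "infnorm (vector [s, t] :: real ^ 2) \<le> 1/2"
    using assms by (simp add: infnorm_2 vector_2)
  then have le: "norm (M *v vector [s, t]) \<le> matrix_norm M"
    by (rule norm_le_matrix_norm)
  show "\<bar>M $ 1 $ 1 * s + M $ 1 $ 2 * t\<bar> \<le> matrix_norm M"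
    using component_le_norm_cart[of "M *v vector [s, t]" 1] le by (simp add: matrix_vector_mult_2)
  show "\<bar>M $ 2 $ 1 * s + M $ 2 $ 2 * t\<bar> \<le> matrix_norm M"
    using component_le_norm_cart[of "M *v vector [s, t]" 2] le by (simp add: matrix_vector_mult_2)
qed

text \<open>The points (1/2, 0) and (0, 1/2) of the cube pick out half of each column, hence the
  factor 2.\<close>

lemma matrix_norm_entries:
  fixes M :: "real ^ 2 ^ 2"
  shows "\<bar>M $ 1 $ 1\<bar> \<le> 2 * matrix_norm M" "\<bar>M $ 1 $ 2\<bar> \<le> 2 * matrix_norm M"
    "\<bar>M $ 2 $ 1\<bar> \<le> 2 * matrix_norm M" "\<bar>M $ 2 $ 2\<bar> \<le> 2 * matrix_norm M"
  using matrix_norm_bounds[of "1/2" 0 M] matrix_norm_bounds[of 0 "1/2" M] by auto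

text \<open>The Gabor system is indexed by the set of lattice points, the tiling by pairs of
  integers; injectivity ensures that no lattice point is counted twice.\<close>

lemma bij_betw_int_lattice:
  fixes M :: "real ^ 2 ^ 2"
  assumes "invertible M"
  shows "bij_betw (\<lambda>k :: int \<times> int. M *v vector [of_int (fst k), of_int (snd k)]) UNIV ((\<lambda>z. M *v z) ` int_lattice)"
proof -
  have inj_M: "inj ((*v) M)"
    using assms by (simp add: invertible_eq_bij bij_is_inj)
  have "inj (\<lambda>k :: int \<times> int. vector [of_int (fst k), of_int (snd k)] :: real ^ 2)"
    by (auto simp: inj_def vec_eq_iff forall_2 vector_2 prod_eq_iff)
  from inj_compose[OF inj_M this]
  have inj: "inj (\<lambda>k :: int \<times> int. M *v vector [of_int (fst k), of_int (snd k)])"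
    unfolding o_def .
  have range: "range (\<lambda>k :: int \<times> int. vector [of_int (fst k), of_int (snd k)] :: real ^ 2) = int_lattice"
  proof (intro equalityI subsetI)
    fix z :: "real ^ 2" assume "z \<in> int_lattice"
    then have "z $ 1 \<in> \<int>" "z $ 2 \<in> \<int>" by (simp_all add: int_lattice_def)
    then obtain m n :: int where "z $ 1 = of_int m" "z $ 2 = of_int n"
      by (elim Ints_cases)
    then have "z = vector [of_int (fst (m, n)), of_int (snd (m, n))]"
      by (simp add: vec_eq_iff forall_2 vector_2)
    then show "z \<in> range (\<lambda>k :: int \<times> int. vector [of_int (fst k), of_int (snd k)])" by blast
  qed (auto simp: int_lattice_def forall_2 vector_2)
  show ?thesis
    unfolding bij_betw_def range[symmetric] image_image by (intro conjI inj refl)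
qed

text \<open>Finiteness is what makes the translation faithful: \<open>infsum\<close> is 0 for a
  divergent series, while the integral over the counting measure is then infinite.\<close>

lemma infsum_nn_integral_count_space:
  fixes F :: "'a \<Rightarrow> real"
  assumes F: "\<And>x. F x \<ge> 0" and fin: "(\<integral>\<^sup>+x. ennreal (F x) \<partial>count_space I) < \<infinity>"
  shows "F summable_on I" and "(\<integral>\<^sup>+x. ennreal (F x) \<partial>count_space I) = ennreal (\<Sum>\<^sub>\<infinity>x\<in>I. F x)"
proof -
  have "integrable (count_space I) F"
    using F fin by (intro integrableI_bounded) auto
  then have F': "Infinite_Set_Sum.abs_summable_on F I"
    by (simp add: Infinite_Set_Sum.abs_summable_on_def)
  then show "F summable_on I"
    using F by (simp add: abs_summable_equivalent[symmetric])
  show "(\<integral>\<^sup>+x. ennreal (F x) \<partial>count_space I) = ennreal (\<Sum>\<^sub>\<infinity>x\<in>I. F x)"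
    unfolding infsetsum_infsum[OF F', symmetric] infsetsum_def
    using \<open>integrable (count_space I) F\<close> F by (intro nn_integral_eq_integral) auto
qed

lemma gabor_shift_component:
  "(\<lambda>x. gabor_shift f \<gamma> x $ i) = gabor_atom (\<lambda>x. f x $ i) (\<gamma> $ 1) (\<gamma> $ 2)"
  by (rule ext) (simp add: gabor_shift_def translation_def modulation_def gabor_atom_def cis_conv_exp mult_ac)

lemma L2_vec_inner_gabor_shift:
  "L2_vec_inner \<phi> (gabor_shift f \<gamma>) = (\<Sum>i\<in>UNIV. stft (\<lambda>x. f x $ i) (\<lambda>x. \<phi> x $ i) (\<gamma> $ 1) (\<gamma> $ 2))"
  by (simp add: L2_vec_inner_def stft_def gabor_shift_component)

lemma Re_L2_vec_inner_self:
  "Re (L2_vec_inner \<phi> \<phi>) = (\<Sum>i\<in>UNIV. LINT x|lborel. (cmod (\<phi> x $ i))\<^sup>2)"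
proof -
  have "L2_inner u u = of_real (LINT x|lborel. (cmod (u x))\<^sup>2)" for u
    unfolding L2_inner_def integral_complex_of_real[symmetric] complex_norm_square ..
  then show ?thesis by (simp add: L2_vec_inner_def)
qed

theorem theorem1p1:
  fixes f :: "real \<Rightarrow> complex ^ 'd"
  assumes "f \<in> L2_vec"
    and "\<And>i. (\<lambda>x. f x $ i) \<in> schwartz"
    and "\<And>i j. L2_inner (\<lambda>x. f x $ i) (\<lambda>x. f x $ j) = (if i = j then 1 else 0)"
  shows "\<exists>C::real. 0 < C \<and> C \<le> 1 \<and>
    (\<forall>M :: real ^ 2 ^ 2. invertible M \<and> matrix_norm M < C \<longrightarrow>
       gabor_frame f ((\<lambda>z. M *v z) ` int_lattice)
         (1 / \<bar>det M\<bar> * (1 - matrix_norm M / C)\<^sup>2)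
         (1 / \<bar>det M\<bar> * (1 + matrix_norm M / C)\<^sup>2))"
proof -
  obtain C where C: "0 < C" "C \<le> 1" and sampling:
    "\<And>a b c d N g. 0 < N \<Longrightarrow> N < C \<Longrightarrow>
      \<bar>a\<bar> \<le> 2 * N \<Longrightarrow> \<bar>b\<bar> \<le> 2 * N \<Longrightarrow> \<bar>c\<bar> \<le> 2 * N \<Longrightarrow> \<bar>d\<bar> \<le> 2 * N \<Longrightarrow>
      (\<And>s t. \<bar>s\<bar> \<le> 1/2 \<Longrightarrow> \<bar>t\<bar> \<le> 1/2 \<Longrightarrow> \<bar>c * s + d * t\<bar> \<le> N) \<Longrightarrow>
      a * d - b * c \<noteq> 0 \<Longrightarrow> (\<And>i. i \<in> UNIV \<Longrightarrow> g i \<in> L2) \<Longrightarrow>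
      ennreal ((1 - N / C)\<^sup>2 * ((\<Sum>i\<in>UNIV. LINT x|lborel. (cmod (g i x))\<^sup>2) / \<bar>a * d - b * c\<bar>)) \<le>
        (\<integral>\<^sup>+k. ennreal ((cmod (\<Sum>i\<in>UNIV. stft (\<lambda>x. f x $ i) (g i) (a * of_int (fst k) + b * of_int (snd k))
          (c * of_int (fst k) + d * of_int (snd k))))\<^sup>2) \<partial>count_space UNIV) \<and>
      (\<integral>\<^sup>+k. ennreal ((cmod (\<Sum>i\<in>UNIV. stft (\<lambda>x. f x $ i) (g i) (a * of_int (fst k) + b * of_int (snd k))
          (c * of_int (fst k) + d * of_int (snd k))))\<^sup>2) \<partial>count_space UNIV) \<le>
        ennreal ((1 + N / C)\<^sup>2 * ((\<Sum>i\<in>UNIV. LINT x|lborel. (cmod (g i x))\<^sup>2) / \<bar>a * d - b * c\<bar>))"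
    by (rule sampling_theorem[of UNIV "\<lambda>i x. f x $ i"]) (use assms in auto)
  show ?thesis
  proof (intro exI[of _ C] conjI C allI impI)
    fix M :: "real ^ 2 ^ 2" assume M: "invertible M \<and> matrix_norm M < C"
    define N where "N = matrix_norm M"
    have D: "det M \<noteq> 0" using M invertible_det_nz by blast
    have detM: "det M = M $ 1 $ 1 * M $ 2 $ 2 - M $ 1 $ 2 * M $ 2 $ 1" by (rule det_2)
    \<comment> \<open>Norm 0 would make the first row vanish and with it the determinant;
      \<open>sampling\<close> needs N > 0 because r = N / C also serves as a weight e.\<close>
    have "N \<noteq> 0"
    proof
      assume "N = 0"
      with matrix_norm_entries[of M] have "M $ 1 $ 1 = 0" "M $ 1 $ 2 = 0" by (auto simp: N_def)
      with D detM show False by simp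
    qed
    moreover have "N \<ge> 0" using matrix_norm_entries(1)[of M] unfolding N_def by linarith
    ultimately have N: "0 < N" "N < C" using M by (auto simp: N_def)
    let ?\<Gamma> = "(\<lambda>z. M *v z) ` int_lattice"
    let ?A = "1 / \<bar>det M\<bar> * (1 - N / C)\<^sup>2" and ?B = "1 / \<bar>det M\<bar> * (1 + N / C)\<^sup>2"
    have NC: "0 < N / C" "N / C < 1" using N C by simp_all
    have "0 < ?A" using D NC by (intro mult_pos_pos zero_less_power) auto
    moreover have "?A \<le> ?B" using NC by (intro mult_left_mono power_mono) auto
    moreover have "gabor_shift f \<gamma> \<in> L2_vec" for \<gamma>
      using assms(1) by (auto simp: L2_vec_def gabor_shift_component intro: gabor_atom_L2)
    moreover have "(\<lambda>\<gamma>. (cmod (L2_vec_inner \<phi> (gabor_shift f \<gamma>)))\<^sup>2) summable_on ?\<Gamma> \<and>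
        ?A * Re (L2_vec_inner \<phi> \<phi>) \<le> (\<Sum>\<^sub>\<infinity>\<gamma>\<in>?\<Gamma>. (cmod (L2_vec_inner \<phi> (gabor_shift f \<gamma>)))\<^sup>2) \<and>
        (\<Sum>\<^sub>\<infinity>\<gamma>\<in>?\<Gamma>. (cmod (L2_vec_inner \<phi> (gabor_shift f \<gamma>)))\<^sup>2) \<le> ?B * Re (L2_vec_inner \<phi> \<phi>)"
      if \<phi>: "\<phi> \<in> L2_vec" for \<phi>
    proof -
      let ?F = "\<lambda>\<gamma>. (cmod (L2_vec_inner \<phi> (gabor_shift f \<gamma>)))\<^sup>2"
      let ?G = "Re (L2_vec_inner \<phi> \<phi>)"
      have "?G \<ge> 0" unfolding Re_L2_vec_inner_self by (intro sum_nonneg) auto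
      have eq: "(\<integral>\<^sup>+\<gamma>. ennreal (?F \<gamma>) \<partial>count_space ?\<Gamma>) =
        (\<integral>\<^sup>+k. ennreal ((cmod (\<Sum>i\<in>UNIV. stft (\<lambda>x. f x $ i) (\<lambda>x. \<phi> x $ i)
          (M $ 1 $ 1 * of_int (fst k) + M $ 1 $ 2 * of_int (snd k))
          (M $ 2 $ 1 * of_int (fst k) + M $ 2 $ 2 * of_int (snd k))))\<^sup>2) \<partial>count_space UNIV)"
        using M unfolding L2_vec_inner_gabor_shift
        by (subst nn_integral_bij_count_space[OF bij_betw_int_lattice[of M], symmetric])
          (simp_all add: matrix_vector_mult_2)
      have "ennreal ((1 - N / C)\<^sup>2 * (?G / \<bar>det M\<bar>)) \<le> (\<integral>\<^sup>+\<gamma>. ennreal (?F \<gamma>) \<partial>count_space ?\<Gamma>) \<and>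
          (\<integral>\<^sup>+\<gamma>. ennreal (?F \<gamma>) \<partial>count_space ?\<Gamma>) \<le> ennreal ((1 + N / C)\<^sup>2 * (?G / \<bar>det M\<bar>))"
        unfolding eq Re_L2_vec_inner_self detM
      proof (rule sampling[OF N, where a="M $ 1 $ 1" and b="M $ 1 $ 2" and c="M $ 2 $ 1" and d="M $ 2 $ 2"
            and g="\<lambda>i x. \<phi> x $ i"])
        show "\<bar>M $ 2 $ 1 * s + M $ 2 $ 2 * t\<bar> \<le> N" if "\<bar>s\<bar> \<le> 1/2" "\<bar>t\<bar> \<le> 1/2" for s t
          unfolding N_def by (rule matrix_norm_bounds(2)[OF that])
        show "M $ 1 $ 1 * M $ 2 $ 2 - M $ 1 $ 2 * M $ 2 $ 1 \<noteq> 0" using D detM by simp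
        show "(\<lambda>x. \<phi> x $ i) \<in> L2" for i using \<phi> by (simp add: L2_vec_def)
      qed (simp_all only: N_def matrix_norm_entries)
      moreover have "c * (?G / \<bar>det M\<bar>) = 1 / \<bar>det M\<bar> * c * ?G" for c
        by simp
      ultimately have lo: "ennreal (?A * ?G) \<le> (\<integral>\<^sup>+\<gamma>. ennreal (?F \<gamma>) \<partial>count_space ?\<Gamma>)"
        and hi: "(\<integral>\<^sup>+\<gamma>. ennreal (?F \<gamma>) \<partial>count_space ?\<Gamma>) \<le> ennreal (?B * ?G)"
        by (simp_all only:)
      have fin: "(\<integral>\<^sup>+\<gamma>. ennreal (?F \<gamma>) \<partial>count_space ?\<Gamma>) < \<infinity>"
        by (rule le_less_trans[OF hi]) simp
      note sm = infsum_nn_integral_count_space[OF _ fin]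
      \<comment> \<open>Removing \<open>ennreal\<close> from the two inequalities requires their
        right sides to be nonnegative, since negative reals are truncated to 0.\<close>
      have "?B * ?G \<ge> 0" using \<open>?G \<ge> 0\<close> by (intro mult_nonneg_nonneg) auto
      moreover have "(\<Sum>\<^sub>\<infinity>\<gamma>\<in>?\<Gamma>. ?F \<gamma>) \<ge> 0" by (rule infsum_nonneg) simp
      ultimately show ?thesis
        using lo hi sm(1) unfolding sm(2)[OF zero_le_power2] by (simp only: ennreal_le_iff zero_le_power2)
    qed
    ultimately show "gabor_frame f ?\<Gamma> (1 / \<bar>det M\<bar> * (1 - matrix_norm M / C)\<^sup>2) (1 / \<bar>det M\<bar> * (1 + matrix_norm M / C)\<^sup>2)"
      unfolding gabor_frame_def frame_with_bounds_def N_def by blast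
  qed
qed

end
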